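(* For every $q\geqslant 1$ there exist $\tilde{p}<1$ and $\kappa>0$ such that for every $p\geqslant\tilde{p}$, every $c\geqslant 1$ and every box $\Lambda$ with $|\Lambda|\geqslant\max\{3^{6d},(cd)^{cd^2}\}$, $$\mu_{\Lambda,p,q}\Big(\exists e\in\mathcal{P}\cup\mathcal{I},\ d\big(e,\Lambda^c\cup\mathcal{P}\setminus\{e\}\big)\geqslant \kappa c^2\ln^2|\Lambda|\Big)\leqslant\frac{1}{|\Lambda|^c}.$$
   Context: Let $d\geqslant 2$ and $\mathbb{L}^d=(\mathbb{Z}^d,\mathbb{E}^d)$ the nearest-neighbour lattice. The box $\Lambda=(V,E)$ is the subgraph of $\mathbb{L}^d$ induced by the vertices in a $d$-dimensional cube centred at the origin (not necessarily axis-parallel); $|\Lambda|$ is its cardinality (number of edges), $\Lambda^c$ its complement, $d(\cdot,\cdot)$ the lattice distance between edges/sets of edges. $\partial\Lambda=\{x\in V:\exists y\notin V,\ \langle x,y\rangle\in\mathbb{E}^d\}$. A hyperplane through the origin parallel to a face of the cube splits $\Lambda$ into $\Lambda^+,\Lambda^-$; $T=\partial\Lambda\cap\Lambda^+$, $B=\partial\Lambda\cap\Lambda^-$. FK measure with Dobrushin boundary condition: for $\omega\in\{0,1\}^E$ (edges with $\omega(e)=1$ open, others closed), $\Phi^{TB}_{\Lambda,p,q}(\omega)\propto\prod_{e\in E}p^{\omega(e)}(1-p)^{1-\omega(e)}q^{k^{TB}(\omega)}$, where $k^{TB}(\omega)$ is the number of connected components (isolated vertices included) of the graph obtained from $(V,\{\text{open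 edges}\})$ by adding two extra vertices, one joined to every vertex of $T$, the other to every vertex of $B$. $\{T\nleftrightarrow B\}$: no open path in $\Lambda$ joins $T$ to $B$. Coupled dynamics: $(E_t)_{t\in\mathbb{N}}$ i.i.d. uniform on $E$ and $(U_t)_{t\in\mathbb{N}}$ i.i.d. uniform on $[0,1]$, independent. With $\Phi=\Phi^{TB}_{\Lambda,p,q}$, $\omega^e$ (resp. $\omega_e$) the configuration $\omega$ with $e$ opened (resp. closed), and $\theta(\omega,e)=\Phi(\omega_e)/(\Phi(\omega^e)+\Phi(\omega_e))$: at time $t$, with $e=E_t$, only edge $e$ is updated; $X_t(e)=1$ if $U_t\geqslant\theta(X_{t-1},e)$ and $0$ otherwise; $Y_t(e)=1$ if $U_t\geqslant\theta(Y_{t-1},e)$ and $T$ is not connected to $B$ in $(Y_{t-1})^e$, and $0$ otherwise. On the state space $\{(\omega_1,\omega_2):\omega_2\in\{T\nleftrightarrow B\},\ \omega_1\geqslant\omega_2\text{ edgewise}\}$ the chain $(X_t,Y_t)$ has a unique stationary distribution $\mu_{\Lambda,p,q}$. For a pair $(X,Y)$ distributed according to $\mu_{\Lambda,p,q}$: the interface is $\mathcal{I}=\{e\in E: X(e)\neq Y(e)\}$, and $\mathcal{P}$ is the set of pivotal edges of $Y$, i.e. edges $e\in E$ such that $T$ is connected to $B$ by an open path in $Y^e$. *)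

theory Defs
  imports "HOL-Analysis.Analysis"
begin

section \<open>The lattice Z^d (d = CARD('d))\<close>

definition l1dist :: "('d::finite \<Rightarrow> int) \<Rightarrow> ('d \<Rightarrow> int) \<Rightarrow> nat" where
  "l1dist x y = nat (\<Sum>i\<in>UNIV. \<bar>x i - y i\<bar>)"

definition lattice_adj :: "('d::finite \<Rightarrow> int) \<Rightarrow> ('d \<Rightarrow> int) \<Rightarrow> bool" where
  "lattice_adj x y \<longleftrightarrow> l1dist x y = 1"

text \<open>Edges of the nearest-neighbour lattice, as two-element vertex sets.\<close>
definition lattice_edges :: "('d::finite \<Rightarrow> int) set set" where
  "lattice_edges = {{x, y} | x y. lattice_adj x y}"

text \<open>Lattice distance between edges (minimal distance between endpoints) and
  from an edge to a set of edges.\<close>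
definition edge_dist :: "('d::finite \<Rightarrow> int) set \<Rightarrow> ('d \<Rightarrow> int) set \<Rightarrow> nat" where
  "edge_dist e f = Min {l1dist x y | x y. x \<in> e \<and> y \<in> f}"

definition set_edge_dist :: "('d::finite \<Rightarrow> int) set \<Rightarrow> ('d \<Rightarrow> int) set set \<Rightarrow> nat" where
  "set_edge_dist e F = (INF f\<in>F. edge_dist e f)"

section \<open>Boxes\<close>

text \<open>@u i@ (i ranging over the index type) is an orthonormal frame of R^d.\<close>
definition orthonormal_frame :: "('d::finite \<Rightarrow> 'd \<Rightarrow> real) \<Rightarrow> bool" where
  "orthonormal_frame u \<longleftrightarrow> (\<forall>i k. (\<Sum>j\<in>UNIV. u i j * u k j) = (if i = k then 1 else 0))"

text \<open>Vertices of the box: lattice points in the closed cube centred at the origin with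
  half side length r and axes given by the frame u.\<close>
definition box_V :: "('d::finite \<Rightarrow> 'd \<Rightarrow> real) \<Rightarrow> real \<Rightarrow> ('d \<Rightarrow> int) set" where
  "box_V u r = {x. \<forall>i. \<bar>\<Sum>j\<in>UNIV. u i j * real_of_int (x j)\<bar> \<le> r}"

text \<open>Edges of the induced subgraph.\<close>
definition box_E :: "('d::finite \<Rightarrow> 'd \<Rightarrow> real) \<Rightarrow> real \<Rightarrow> ('d \<Rightarrow> int) set set" where
  "box_E u r = {e \<in> lattice_edges. e \<subseteq> box_V u r}"

definition vboundary :: "('d::finite \<Rightarrow> int) set \<Rightarrow> ('d \<Rightarrow> int) set" where
  "vboundary V = {x \<in> V. \<exists>y. lattice_adj x y \<and> y \<notin> V}"

text \<open>The hyperplane through the origin orthogonal to the frame vector u k (hence parallel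
  to a pair of faces) splits the box into a closed upper and an open lower half.\<close>
definition box_T :: "('d::finite \<Rightarrow> 'd \<Rightarrow> real) \<Rightarrow> real \<Rightarrow> 'd \<Rightarrow> ('d \<Rightarrow> int) set" where
  "box_T u r k = {x \<in> vboundary (box_V u r). (\<Sum>j\<in>UNIV. u k j * real_of_int (x j)) \<ge> 0}"

definition box_B :: "('d::finite \<Rightarrow> 'd \<Rightarrow> real) \<Rightarrow> real \<Rightarrow> 'd \<Rightarrow> ('d \<Rightarrow> int) set" where
  "box_B u r k = {x \<in> vboundary (box_V u r). (\<Sum>j\<in>UNIV. u k j * real_of_int (x j)) < 0}"

section \<open>Connectivity and FK measure with Dobrushin boundary condition\<close>

text \<open>Configurations are represented by their sets of open edges.\<close>
definition open_rel :: "'v set set \<Rightarrow> ('v \<times> 'v) set" where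
  "open_rel \<omega> = {(x, y). {x, y} \<in> \<omega>}"

definition connects :: "'v set set \<Rightarrow> 'v set \<Rightarrow> 'v set \<Rightarrow> bool" where
  "connects \<omega> T B \<longleftrightarrow> (\<exists>x\<in>T. \<exists>y\<in>B. (x, y) \<in> (open_rel \<omega>)\<^sup>*)"

text \<open>The graph with the two extra vertices (Inr True joined to T, Inr False joined to B).\<close>
definition ext_vertices :: "'v set \<Rightarrow> ('v + bool) set" where
  "ext_vertices V = Inl ` V \<union> {Inr True, Inr False}"

definition ext_rel :: "'v set \<Rightarrow> 'v set \<Rightarrow> 'v set set \<Rightarrow> (('v + bool) \<times> ('v + bool)) set" where
  "ext_rel T B \<omega> = {(Inl x, Inl y) | x y. {x, y} \<in> \<omega>}
     \<union> {(Inl x, Inr True) | x. x \<in> T} \<union> {(Inr True, Inl x) | x. x \<in> T}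
     \<union> {(Inl x, Inr False) | x. x \<in> B} \<union> {(Inr False, Inl x) | x. x \<in> B}"

definition num_clusters :: "'v set \<Rightarrow> 'v set \<Rightarrow> 'v set \<Rightarrow> 'v set set \<Rightarrow> nat" where
  "num_clusters V T B \<omega> =
     card (ext_vertices V // ((ext_rel T B \<omega>)\<^sup>* \<inter> (ext_vertices V \<times> ext_vertices V)))"

definition fk_weight :: "'v set \<Rightarrow> 'v set set \<Rightarrow> 'v set \<Rightarrow> 'v set \<Rightarrow> real \<Rightarrow> real \<Rightarrow> 'v set set \<Rightarrow> real" where
  "fk_weight V E T B p q \<omega> =
     p ^ card \<omega> * (1 - p) ^ (card E - card \<omega>) * q ^ num_clusters V T B \<omega>"

text \<open>Phi^{TB}_{Lambda,p,q} on configurations (subsets of E).\<close>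
definition fk_measure :: "'v set \<Rightarrow> 'v set set \<Rightarrow> 'v set \<Rightarrow> 'v set \<Rightarrow> real \<Rightarrow> real \<Rightarrow> 'v set set \<Rightarrow> real" where
  "fk_measure V E T B p q \<omega> =
     fk_weight V E T B p q \<omega> / (\<Sum>\<eta>\<in>Pow E. fk_weight V E T B p q \<eta>)"

definition theta :: "'v set \<Rightarrow> 'v set set \<Rightarrow> 'v set \<Rightarrow> 'v set \<Rightarrow> real \<Rightarrow> real \<Rightarrow> 'v set set \<Rightarrow> 'v set \<Rightarrow> real" where
  "theta V E T B p q \<omega> e =
     fk_measure V E T B p q (\<omega> - {e}) /
       (fk_measure V E T B p q (insert e \<omega>) + fk_measure V E T B p q (\<omega> - {e}))"

section \<open>The coupled dynamics\<close>

text \<open>One step of the coupled chain when edge e and uniform variable u are drawn.\<close>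
definition coupled_step :: "'v set \<Rightarrow> 'v set set \<Rightarrow> 'v set \<Rightarrow> 'v set \<Rightarrow> real \<Rightarrow> real \<Rightarrow> 'v set \<Rightarrow> real
    \<Rightarrow> 'v set set \<times> 'v set set \<Rightarrow> 'v set set \<times> 'v set set" where
  "coupled_step V E T B p q e u s =
     (let X = fst s; Y = snd s in
      (if u \<ge> theta V E T B p q X e then insert e X else X - {e},
       if u \<ge> theta V E T B p q Y e \<and> \<not> connects (insert e Y) T B then insert e Y else Y - {e}))"

text \<open>Transition probabilities: E_t uniform on E, U_t uniform on [0,1], independent.\<close>
definition coupled_kernel :: "'v set \<Rightarrow> 'v set set \<Rightarrow> 'v set \<Rightarrow> 'v set \<Rightarrow> real \<Rightarrow> real
    \<Rightarrow> 'v set set \<times> 'v set set \<Rightarrow> 'v set set \<times> 'v set set \<Rightarrow> real" where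
  "coupled_kernel V E T B p q s s' =
     (\<Sum>e\<in>E. measure lborel {u \<in> {0..1}. coupled_step V E T B p q e u s = s'}) / real (card E)"

definition coupled_states :: "'v set set \<Rightarrow> 'v set \<Rightarrow> 'v set \<Rightarrow> ('v set set \<times> 'v set set) set" where
  "coupled_states E T B = {(X, Y). X \<subseteq> E \<and> Y \<subseteq> X \<and> \<not> connects Y T B}"

definition stationary_dist :: "'v set \<Rightarrow> 'v set set \<Rightarrow> 'v set \<Rightarrow> 'v set \<Rightarrow> real \<Rightarrow> real
    \<Rightarrow> ('v set set \<times> 'v set set \<Rightarrow> real) \<Rightarrow> bool" where
  "stationary_dist V E T B p q \<mu> \<longleftrightarrow>
     (\<forall>s. 0 \<le> \<mu> s) \<and> (\<forall>s. s \<notin> coupled_states E T B \<longrightarrow> \<mu> s = 0) \<and>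
     (\<Sum>s\<in>coupled_states E T B. \<mu> s) = 1 \<and>
     (\<forall>s'\<in>coupled_states E T B.
        \<mu> s' = (\<Sum>s\<in>coupled_states E T B. \<mu> s * coupled_kernel V E T B p q s s'))"

section \<open>Interface and pivotal edges\<close>

definition interface :: "'v set set \<Rightarrow> 'v set set \<Rightarrow> 'v set set \<Rightarrow> 'v set set" where
  "interface E X Y = {e \<in> E. (e \<in> X) \<noteq> (e \<in> Y)}"

definition pivotal :: "'v set set \<Rightarrow> 'v set \<Rightarrow> 'v set \<Rightarrow> 'v set set \<Rightarrow> 'v set set" where
  "pivotal E T B Y = {e \<in> E. connects (insert e Y) T B}"

end

theory Submission
  imports Defs
begin

text \<open>
  The law of \<open>Y\<close> is the FK measure conditioned on the disconnection event, and the dynamics of \<open>Y\<close> is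
  reversible for it. Opening a closed edge multiplies the FK weight by at least \<open>p / (q (1 - p))\<close>, and at
  least half of any set of closed edges that are not pivotal can be opened simultaneously without connecting
  \<open>T\<close> to \<open>B\<close>. A Peierls argument therefore excludes long paths (with respect to the plaquette adjacency) of
  closed edges that are not pivotal.

  The boundary of the cluster of \<open>T\<close> is connected for this adjacency, which excludes isolated pivotal edges.
  For the same reason a pivotal edge that appears far from the earlier ones yields a long path of edges each of
  which was closed from the start, or closed by a rare coin, while it was not pivotal; hence pivotal edges move
  by at most a constant times \<open>c ln |\<Lambda>|\<close> during \<open>|\<Lambda>|\<close> steps, and by reversibility this also holds backwards
  in time. Finally an edge that enters the interface without being pivotal is joined by closed edges to an edge
  that was already in the interface. Far from the pivotal edges, going back in time along such edges produces
  a space-time path in which every edge fails to be reopened, which cannot last much longer than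
  \<open>c |\<Lambda>| ln |\<Lambda>|\<close> steps. In that time the pivotal edges move by at most a constant times \<open>c\<^sup>2 ln\<^sup>2 |\<Lambda>|\<close>.
\<close>

section \<open>Paths and union bounds\<close>

text \<open>Planar duality is replaced by cohomology modulo 2: a component of an edge boundary is
  the coboundary of a 0/1 function, and if it stays in a ball then this function is constant
  outside, because the outside of a ball is connected when d >= 2. Every statement that some
  boundary component must leave a ball, or must be crossed inside it, comes from this.

  A pivotal edge is never reopened, so being closed is improbable only for edges that are not
  pivotal. Each Peierls argument is therefore run inside a ball clear of pivotal edges, and the
  price of keeping such a ball clear over time has to be controlled.

  Time is cut into blocks of \<open>L = K * N\<close> steps, in which an edge is drawn
  \<open>K\<close> times on average. \<open>K\<close> is taken large, so that an edge seldom lacks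
  an opening coin in a block, and \<open>1 - p\<close> is then small depending on \<open>K\<close>,
  so that closing coins stay rare over a whole block. With \<open>m\<close> of order
  \<open>c * ln N\<close>, a bad walk of \<open>m\<close> steps from a given start has probability
  at most \<open>exp (- m)\<close>. The squared logarithm is the number of blocks,
  \<open>2 * m + 4\<close>, times the radius \<open>2 * m + 3\<close> lost per block.\<close>

lemma sum_union_bound:
  fixes w :: "'a \<Rightarrow> real"
  assumes "finite \<Omega>" "finite I" "\<And>\<omega>. \<omega> \<in> \<Omega> \<Longrightarrow> 0 \<le> w \<omega>"
    and "\<And>\<omega>. \<omega> \<in> \<Omega> \<Longrightarrow> A \<omega> \<Longrightarrow> \<exists>i\<in>I. P i \<omega>"
  shows "(\<Sum>\<omega>\<in>{\<omega>\<in>\<Omega>. A \<omega>}. w \<omega>) \<le> (\<Sum>i\<in>I. \<Sum>\<omega>\<in>{\<omega>\<in>\<Omega>. P i \<omega>}. w \<omega>)"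
proof -
  have "(\<Sum>\<omega>\<in>{\<omega>\<in>\<Omega>. A \<omega>}. w \<omega>) = (\<Sum>\<omega>\<in>\<Omega>. if A \<omega> then w \<omega> else 0)"
    using assms(1) by (simp add: sum.inter_filter)
  also have "\<dots> \<le> (\<Sum>\<omega>\<in>\<Omega>. \<Sum>i\<in>I. if P i \<omega> then w \<omega> else 0)"
  proof (rule sum_mono)
    fix \<omega> assume w: "\<omega> \<in> \<Omega>"
    have nn: "\<And>i. 0 \<le> (if P i \<omega> then w \<omega> else 0)" using assms(3) w by auto
    show "(if A \<omega> then w \<omega> else 0) \<le> (\<Sum>i\<in>I. if P i \<omega> then w \<omega> else 0)"
    proof (cases "A \<omega>")
      case True
      then obtain i where i: "i \<in> I" "P i \<omega>" using assms(4) w by blast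
      have "(if P i \<omega> then w \<omega> else 0) \<le> (\<Sum>i\<in>I. if P i \<omega> then w \<omega> else 0)"
        by (rule member_le_sum[OF i(1)]) (use nn assms(2) in auto)
      then show ?thesis using i True by simp
    next
      case False
      then show ?thesis using nn by (simp add: sum_nonneg)
    qed
  qed
  also have "\<dots> = (\<Sum>i\<in>I. \<Sum>\<omega>\<in>\<Omega>. if P i \<omega> then w \<omega> else 0)"
    by (rule sum.swap)
  also have "\<dots> = (\<Sum>i\<in>I. \<Sum>\<omega>\<in>{\<omega>\<in>\<Omega>. P i \<omega>}. w \<omega>)"
    using assms(1) by (simp add: sum.inter_filter)
  finally show ?thesis .
qed

lemma sum_event_mono:
  fixes w :: "'a \<Rightarrow> real"
  assumes "finite \<Omega>" "\<And>\<omega>. \<omega> \<in> \<Omega> \<Longrightarrow> 0 \<le> w \<omega>" "\<And>\<omega>. \<omega> \<in> \<Omega> \<Longrightarrow> A \<omega> \<Longrightarrow> B \<omega>"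
  shows "(\<Sum>\<omega>\<in>{\<omega>\<in>\<Omega>. A \<omega>}. w \<omega>) \<le> (\<Sum>\<omega>\<in>{\<omega>\<in>\<Omega>. B \<omega>}. w \<omega>)"
  by (rule sum_mono2) (use assms in auto)

lemma sum_event_Un:
  fixes w :: "'a \<Rightarrow> real"
  assumes "finite \<Omega>" "\<And>\<omega>. \<omega> \<in> \<Omega> \<Longrightarrow> 0 \<le> w \<omega>"
    and "\<And>\<omega>. \<omega> \<in> \<Omega> \<Longrightarrow> A \<omega> \<Longrightarrow> B \<omega> \<or> C \<omega>"
  shows "(\<Sum>\<omega>\<in>{\<omega>\<in>\<Omega>. A \<omega>}. w \<omega>) \<le> (\<Sum>\<omega>\<in>{\<omega>\<in>\<Omega>. B \<omega>}. w \<omega>) + (\<Sum>\<omega>\<in>{\<omega>\<in>\<Omega>. C \<omega>}. w \<omega>)"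
proof -
  have "(\<Sum>\<omega>\<in>{\<omega>\<in>\<Omega>. A \<omega>}. w \<omega>)
      \<le> (\<Sum>i\<in>{True, False}. \<Sum>\<omega>\<in>{\<omega>\<in>\<Omega>. (if i then B else C) \<omega>}. w \<omega>)"
    by (rule sum_union_bound) (use assms in auto)
  then show ?thesis by simp
qed

section \<open>Walks of given length and the Peierls estimate\<close>

definition walks :: "('a \<Rightarrow> 'a \<Rightarrow> bool) \<Rightarrow> 'a \<Rightarrow> nat \<Rightarrow> 'a list set" where
  "walks adj x m = {xs. length xs = Suc m \<and> hd xs = x \<and> successively adj xs}"

lemma walks_0: "walks adj x 0 = {[x]}"
  by (auto simp: walks_def length_Suc_conv)

lemma walks_Suc: "walks adj x (Suc m) = (\<Union>y\<in>{y. adj x y}. (#) x ` walks adj y m)"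
proof (intro equalityI subsetI)
  fix xs assume "xs \<in> walks adj x (Suc m)"
  then obtain ys where "xs = x # ys" "length ys = Suc m" "successively adj (x # ys)"
    by (auto simp: walks_def length_Suc_conv)
  then show "xs \<in> (\<Union>y\<in>{y. adj x y}. (#) x ` walks adj y m)"
    by (auto simp: walks_def successively_Cons length_Suc_conv)
qed (auto simp: walks_def successively_Cons)

lemma walks_finite_card:
  assumes "\<And>x. finite {y. adj x y}" "\<And>x. card {y. adj x y} \<le> D"
  shows "finite (walks adj x m) \<and> card (walks adj x m) \<le> D ^ m"
proof (induction m arbitrary: x)
  case 0
  then show ?case by (simp add: walks_0)
next
  case (Suc m)
  have "card (walks adj x (Suc m)) \<le> (\<Sum>y\<in>{y. adj x y}. card ((#) x ` walks adj y m))"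
    unfolding walks_Suc by (rule card_UN_le) (rule assms)
  also have "\<dots> \<le> (\<Sum>y\<in>{y. adj x y}. D ^ m)"
    using Suc.IH by (intro sum_mono) (meson card_image_le le_trans)
  also have "\<dots> \<le> D * D ^ m"
    using assms(2)[of x] by simp
  finally show ?case
    using assms(1) Suc.IH by (simp add: walks_Suc)
qed

lemma distinct_path_of_rtrancl:
  assumes "(x, y) \<in> r\<^sup>*"
  shows "\<exists>xs. xs \<noteq> [] \<and> hd xs = x \<and> last xs = y \<and> distinct xs \<and> successively (\<lambda>u v. (u, v) \<in> r) xs"
  using assms
proof (induction rule: rtrancl_induct)
  case base
  show ?case by (rule exI[of _ "[x]"]) auto
next
  case (step y z)
  then obtain xs where xs: "xs \<noteq> []" "hd xs = x" "last xs = y" "distinct xs"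
    "successively (\<lambda>u v. (u, v) \<in> r) xs" by blast
  show ?case
  proof (cases "z \<in> set xs")
    \<comment> \<open>Loop erasure: \<open>z\<close> was visited before, so the path is cut back to
      that visit.\<close>
    case True
    then obtain as bs where "xs = as @ z # bs" by (auto dest: split_list)
    then have "xs = (as @ [z]) @ bs" by simp
    then show ?thesis
      using xs by (intro exI[of _ "as @ [z]"]) (auto simp: successively_append_iff hd_append)
  next
    case False
    then show ?thesis
      using xs step(2) by (intro exI[of _ "xs @ [z]"]) (auto simp: successively_append_iff)
  qed
qed

lemma successively_potential_bound:
  fixes \<phi> :: "'a \<Rightarrow> nat"
  assumes "successively (\<lambda>u v. (u, v) \<in> r) xs" "xs \<noteq> []"
    and "\<And>u v. (u, v) \<in> r \<Longrightarrow> \<phi> v \<le> \<phi> u + 1"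
  shows "\<phi> (last xs) < \<phi> (hd xs) + length xs"
  using assms(1,2)
proof (induction xs rule: rev_induct)
  case (snoc z xs)
  show ?case
  proof (cases "xs = []")
    case False
    then have "\<phi> (last xs) < \<phi> (hd xs) + length xs" "(last xs, z) \<in> r"
      using snoc by (auto simp: successively_append_iff)
    then show ?thesis using assms(3)[of "last xs" z] False by simp
  qed simp
qed simp

text \<open>\<open>\<phi>\<close> grows by at most one per step, so a loop-free path from height 0
  to height at least \<open>m\<close> has at least \<open>m\<close> steps and can be cut after
  exactly \<open>m\<close>. This turns the statement that a connected set reaches far into an event
  indexed by \<open>walks\<close>.\<close>

lemma distinct_walk_of_rtrancl:
  fixes \<phi> :: "'a \<Rightarrow> nat"
  assumes "(x, y) \<in> {(u, v). adj u v \<and> u \<in> S \<and> v \<in> S}\<^sup>*" and "x \<in> S"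
    and "\<And>u v. adj u v \<Longrightarrow> \<phi> v \<le> \<phi> u + 1" and "\<phi> x = 0" and "m \<le> \<phi> y"
  shows "\<exists>xs\<in>walks adj x m. distinct xs \<and> set xs \<subseteq> S"
proof -
  let ?r = "{(u, v). adj u v \<and> u \<in> S \<and> v \<in> S}"
  obtain xs where xs: "xs \<noteq> []" "hd xs = x" "last xs = y" "distinct xs"
    "successively (\<lambda>u v. (u, v) \<in> ?r) xs"
    using distinct_path_of_rtrancl[OF assms(1)] by blast
  have "\<phi> (last xs) < \<phi> (hd xs) + length xs"
    by (rule successively_potential_bound[OF xs(5,1)]) (use assms(3) in auto)
  then have len: "Suc m \<le> length xs" using xs assms(4,5) by simp
  have sub: "set xs \<subseteq> S"
    using xs(5,1,2) \<open>x \<in> S\<close>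
  proof (induction xs arbitrary: x)
    case (Cons a xs)
    then show ?case by (cases xs) (auto simp: successively_Cons)
  qed simp
  define ys where "ys = take (Suc m) xs"
  have spl: "xs = ys @ drop (Suc m) xs" by (simp add: ys_def)
  have "successively (\<lambda>u v. (u, v) \<in> ?r) (ys @ drop (Suc m) xs)"
    using xs(5) spl by simp
  then have "successively (\<lambda>u v. (u, v) \<in> ?r) ys"
    unfolding successively_append_iff by blast
  then have "successively adj ys"
    by (rule successively_mono) auto
  moreover have "length ys = Suc m" using len by (simp add: ys_def)
  moreover have "hd ys = x" using xs len by (simp add: ys_def)
  moreover have "distinct ys" "set ys \<subseteq> S"
    using xs(4) sub by (auto simp: ys_def dest: in_set_takeD)
  ultimately show ?thesis by (auto simp: walks_def)
qed

text \<open>Peierls counting. Distinctness matters because \<open>small\<close> pays in the number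
  of different elements: a walk of \<open>m\<close> steps visits \<open>Suc m\<close> of them,
  against at most \<open>D ^ m\<close> walks.\<close>

lemma walk_union_bound:
  fixes w :: "'b \<Rightarrow> real"
  assumes "finite \<Omega>" "\<And>\<omega>. \<omega> \<in> \<Omega> \<Longrightarrow> 0 \<le> w \<omega>"
    and deg: "\<And>x. finite {y. adj x y}" "\<And>x. card {y. adj x y} \<le> D"
    and small: "\<And>S. finite S \<Longrightarrow> (\<Sum>\<omega>\<in>{\<omega>\<in>\<Omega>. S \<subseteq> Bad \<omega>}. w \<omega>) \<le> \<eta> ^ card S"
    and "0 \<le> \<eta>"
  shows "(\<Sum>\<omega>\<in>{\<omega>\<in>\<Omega>. \<exists>xs\<in>walks adj x m. distinct xs \<and> set xs \<subseteq> Bad \<omega>}. w \<omega>)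
    \<le> real D ^ m * \<eta> ^ Suc m"
proof -
  let ?I = "{xs \<in> walks adj x m. distinct xs}"
  have fc: "finite (walks adj x m)" "card (walks adj x m) \<le> D ^ m"
    using walks_finite_card[of adj D x m] deg by blast+
  have "(\<Sum>\<omega>\<in>{\<omega>\<in>\<Omega>. \<exists>xs\<in>walks adj x m. distinct xs \<and> set xs \<subseteq> Bad \<omega>}. w \<omega>)
      \<le> (\<Sum>xs\<in>?I. \<Sum>\<omega>\<in>{\<omega>\<in>\<Omega>. set xs \<subseteq> Bad \<omega>}. w \<omega>)"
    by (rule sum_union_bound) (use assms fc in auto)
  also have "\<dots> \<le> (\<Sum>xs\<in>?I. \<eta> ^ Suc m)"
  proof (rule sum_mono)
    fix xs assume "xs \<in> ?I"
    then have "card (set xs) = Suc m" by (auto simp: distinct_card walks_def)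
    then show "(\<Sum>\<omega>\<in>{\<omega>\<in>\<Omega>. set xs \<subseteq> Bad \<omega>}. w \<omega>) \<le> \<eta> ^ Suc m"
      using small[of "set xs"] by simp
  qed
  also have "\<dots> = real (card ?I) * \<eta> ^ Suc m" by simp
  also have "\<dots> \<le> real (D ^ m) * \<eta> ^ Suc m"
  proof (rule mult_right_mono)
    have "card ?I \<le> card (walks adj x m)" by (rule card_mono) (use fc in auto)
    then show "real (card ?I) \<le> real (D ^ m)" using fc by linarith
  qed (use assms in auto)
  finally show ?thesis by simp
qed

section \<open>Boundaries of vertex sets in the lattice\<close>

lemma int_l1dist: "int (l1dist x y) = (\<Sum>i\<in>UNIV. \<bar>x i - y i\<bar>)"
  unfolding l1dist_def by (simp add: sum_nonneg)

lemma l1dist_commute: "l1dist x y = l1dist y x"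
  unfolding l1dist_def by (simp add: abs_minus_commute)

lemma l1dist_self [simp]: "l1dist x x = 0"
  unfolding l1dist_def by simp

lemma l1dist_triangle: "l1dist x z \<le> l1dist x y + l1dist y z"
proof -
  have "int (l1dist x z) \<le> int (l1dist x y) + int (l1dist y z)"
    unfolding int_l1dist sum.distrib[symmetric] by (rule sum_mono) auto
  then show ?thesis by linarith
qed

lemma l1dist_fun_upd: "l1dist x (x(i := a)) = nat \<bar>x i - a\<bar>"
proof -
  have "(\<Sum>j\<in>UNIV. \<bar>x j - (x(i := a)) j\<bar>) = (\<Sum>j\<in>UNIV. if j = i then \<bar>x i - a\<bar> else 0)"
    by (rule sum.cong) auto
  then show ?thesis by (simp add: l1dist_def)
qed

lemma coord_le_l1dist: "\<bar>x i - y i\<bar> \<le> int (l1dist x y)"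
  unfolding int_l1dist by (rule member_le_sum) auto

definition up :: "'d \<Rightarrow> ('d \<Rightarrow> int) \<Rightarrow> ('d \<Rightarrow> int)" where
  "up i x = x(i := x i + 1)"

lemma up_commute: "i \<noteq> j \<Longrightarrow> up i (up j x) = up j (up i x)"
  by (auto simp: up_def)

lemma lattice_adj_commute: "lattice_adj x y \<longleftrightarrow> lattice_adj y x"
  by (simp add: lattice_adj_def l1dist_commute)

lemma lattice_adj_up [simp]: "lattice_adj x (up i x)"
  by (simp add: lattice_adj_def up_def l1dist_fun_upd)

lemma lattice_adj_cases:
  assumes "lattice_adj x y"
  obtains i where "y = up i x \<or> x = up i y"
proof -
  have s: "(\<Sum>i\<in>UNIV. \<bar>x i - y i\<bar>) = 1"
    using assms int_l1dist[of x y] by (simp add: lattice_adj_def)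
  then obtain i where i: "\<bar>x i - y i\<bar> \<noteq> 0"
    by (metis (no_types, lifting) sum.neutral zero_neq_one)
  have "(\<Sum>j\<in>UNIV. \<bar>x j - y j\<bar>) = \<bar>x i - y i\<bar> + (\<Sum>j\<in>UNIV - {i}. \<bar>x j - y j\<bar>)"
    by (rule sum.remove) auto
  moreover have nn: "0 \<le> (\<Sum>j\<in>UNIV - {i}. \<bar>x j - y j\<bar>)" by (rule sum_nonneg) auto
  ultimately have 1: "\<bar>x i - y i\<bar> = 1" and 0: "(\<Sum>j\<in>UNIV - {i}. \<bar>x j - y j\<bar>) = 0"
    using s i by linarith+
  have "\<forall>j\<in>UNIV - {i}. \<bar>x j - y j\<bar> = 0"
    using 0 by (subst (asm) sum_nonneg_eq_0_iff) auto
  then have eq: "\<And>j. j \<noteq> i \<Longrightarrow> x j = y j" by auto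
  have "y = up i x \<or> x = up i y"
  proof (cases "x i \<le> y i")
    case True
    then have "y i = x i + 1" using 1 by linarith
    then have "y = up i x" using eq by (auto simp: up_def fun_eq_iff)
    then show ?thesis ..
  next
    case False
    then have "x i = y i + 1" using 1 by linarith
    then have "x = up i y" using eq by (auto simp: up_def fun_eq_iff)
    then show ?thesis ..
  qed
  then show ?thesis by (rule that)
qed

lemma lattice_edge_iff: "{x, y} \<in> lattice_edges \<longleftrightarrow> lattice_adj x y"
  unfolding lattice_edges_def using lattice_adj_commute by (auto simp: doubleton_eq_iff)

lemma lattice_edgeE:
  assumes "e \<in> lattice_edges"
  obtains x y where "e = {x, y}" "lattice_adj x y"
  using assms unfolding lattice_edges_def by auto

lemma lattice_edge_finite: "e \<in> lattice_edges \<Longrightarrow> finite e"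
  and lattice_edge_nonempty: "e \<in> lattice_edges \<Longrightarrow> e \<noteq> {}"
  by (auto elim: lattice_edgeE)

lemma lattice_edge_diam:
  assumes "e \<in> lattice_edges" "u \<in> e" "v \<in> e"
  shows "l1dist u v \<le> 1"
  using assms by (auto elim!: lattice_edgeE simp: lattice_adj_def l1dist_commute)

text \<open>Booleans play the role of the integers modulo 2, with \<open>\<noteq>\<close> as addition.\<close>

definition line_parity :: "(int \<Rightarrow> bool) \<Rightarrow> int \<Rightarrow> bool" where
  "line_parity b n = odd (card {m \<in> {0..<n} \<union> {n..<0}. b m})"

text \<open>\<open>line_parity b n\<close> is the integral of \<open>b\<close> from 0 to
  \<open>n\<close>; orientation does not matter modulo 2, so negative \<open>n\<close> needs no
  sign.\<close>

lemma line_parity_step: "(line_parity b n \<noteq> line_parity b (n + 1)) = b n"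
proof -
  define S where "S n = {m \<in> {0..<n} \<union> {n..<0}. b m}" for n :: int
  have fin: "finite (S n)" for n by (simp add: S_def)
  have lp: "line_parity b n = odd (card (S n))" for n by (simp add: line_parity_def S_def)
  show ?thesis
  proof (cases "0 \<le> n")
    case True
    have "S (n + 1) = (if b n then insert n (S n) else S n)"
      using True by (auto simp: S_def less_le)
    moreover have "n \<notin> S n" using True by (auto simp: S_def)
    ultimately show ?thesis using fin by (simp add: lp)
  next
    case False
    have "S n = (if b n then insert n (S (n + 1)) else S (n + 1))"
      using False by (auto simp: S_def) (metis add1_zle_eq less_le)
    moreover have "n \<notin> S (n + 1)" using False by (auto simp: S_def)
    ultimately show ?thesis using fin by (simp add: lp)
  qed
qed

text \<open>The Poincare lemma for 1-cochains modulo 2 on the cubical lattice; the hypothesis says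
  that the sum around every plaquette vanishes. The induction adds one direction at a time and
  corrects the potential found so far by an integral along the new direction.\<close>

lemma potential_of_closed_form:
  fixes c :: "'d::finite \<Rightarrow> ('d \<Rightarrow> int) \<Rightarrow> bool"
  assumes closed: "\<And>i j x. i \<noteq> j \<Longrightarrow> (c i x \<noteq> c i (up j x)) = (c j x \<noteq> c j (up i x))"
  shows "\<exists>g :: ('d \<Rightarrow> int) \<Rightarrow> bool. \<forall>i x. (g x \<noteq> g (up i x)) = c i x"
proof -
  have "\<exists>g :: ('d \<Rightarrow> int) \<Rightarrow> bool. \<forall>i\<in>S. \<forall>x. (g x \<noteq> g (up i x)) = c i x" if "finite S" for S :: "'d set"
    using that
  proof (induction S rule: finite_induct)
    case empty
    then show ?case by simp
  next
    case (insert k S)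
    from insert.IH obtain g :: "('d \<Rightarrow> int) \<Rightarrow> bool" where "\<forall>i\<in>S. \<forall>x. (g x \<noteq> g (up i x)) = c i x" by (rule exE)
    note g = this[rule_format]
    \<comment> \<open>\<open>a\<close> is the error of \<open>g\<close> in direction
      \<open>k\<close>. Closedness makes it invariant in the directions already treated, so its
      integral \<open>f\<close> along \<open>k\<close> repairs direction \<open>k\<close> and spoils
      none of the others.\<close>
    define a where "a x = (c k x \<noteq> (g x \<noteq> g (up k x)))" for x
    define f where "f x = line_parity (\<lambda>m. a (x(k := m))) (x k)" for x
    have a_inv: "a (up i x) = a x" if "i \<in> S" for i x
    proof -
      have "i \<noteq> k" using that insert.hyps by auto
      then have "up k (up i x) = up i (up k x)" "(c k x \<noteq> c k (up i x)) = (c i x \<noteq> c i (up k x))"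
        using closed[of k i x] by (auto simp: up_commute)
      then show ?thesis
        using g[OF that, of x] g[OF that, of "up k x"] by (auto simp: a_def)
    qed
    have fk: "(f x \<noteq> f (up k x)) = a x" for x
    proof -
      have "(\<lambda>m. a ((up k x)(k := m))) = (\<lambda>m. a (x(k := m)))" by (simp add: up_def)
      then show ?thesis
        using line_parity_step[of "\<lambda>m. a (x(k := m))" "x k"] by (simp add: f_def up_def)
    qed
    have fS: "f (up i x) = f x" if "i \<in> S" for i x
    proof -
      have ik: "i \<noteq> k" using that insert.hyps by auto
      have "(up i x)(k := m) = up i (x(k := m))" for m using ik by (auto simp: up_def)
      then have "(\<lambda>m. a ((up i x)(k := m))) = (\<lambda>m. a (x(k := m)))" using a_inv[OF that] by simp
      moreover have "up i x k = x k" using ik by (simp add: up_def)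
      ultimately show ?thesis by (simp add: f_def)
    qed
    show ?case
    proof (intro exI[of _ "\<lambda>x. g x \<noteq> f x"] ballI allI)
      fix i x assume "i \<in> insert k S"
      then show "((g x \<noteq> f x) \<noteq> (g (up i x) \<noteq> f (up i x))) = c i x"
        using fk[of x] fS[of i x] g[of i x] unfolding a_def by (cases "i = k") auto
    qed
  qed
  from this[of UNIV] show ?thesis by auto
qed

section \<open>Edge boundaries and their components\<close>

definition edge_bd :: "('d::finite \<Rightarrow> int) set \<Rightarrow> ('d \<Rightarrow> int) set set" where
  "edge_bd A = {{u, v} | u v. lattice_adj u v \<and> u \<in> A \<and> v \<notin> A}"

lemma edge_bd_iff: "lattice_adj u v \<Longrightarrow> {u, v} \<in> edge_bd A \<longleftrightarrow> (u \<in> A) \<noteq> (v \<in> A)"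
  unfolding edge_bd_def using lattice_adj_commute by (auto simp: doubleton_eq_iff)

lemma edge_bd_lattice: "edge_bd A \<subseteq> lattice_edges"
  unfolding edge_bd_def lattice_edges_def by auto

text \<open>Edges of a common plaquette satisfy this, since a plaquette has l1 diameter 2. The
  metric form is more generous than sharing a plaquette, but it keeps degrees bounded and lets the
  distance to a fixed vertex change by at most 2 per step.\<close>

definition star :: "('d::finite \<Rightarrow> int) set \<Rightarrow> ('d \<Rightarrow> int) set \<Rightarrow> bool" where
  "star a b \<longleftrightarrow> a \<in> lattice_edges \<and> b \<in> lattice_edges \<and> (\<forall>u\<in>a. \<forall>v\<in>b. l1dist u v \<le> 2)"

lemma star_refl: "a \<in> lattice_edges \<Longrightarrow> star a a"
  unfolding star_def using lattice_edge_diam by (meson le_trans one_le_numeral)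

definition bd_comp :: "('d::finite \<Rightarrow> int) set \<Rightarrow> ('d \<Rightarrow> int) set \<Rightarrow> ('d \<Rightarrow> int) set set" where
  "bd_comp A e = {f. (e, f) \<in> {(a, b). star a b \<and> a \<in> edge_bd A \<and> b \<in> edge_bd A}\<^sup>*}"

lemma bd_comp_self: "e \<in> bd_comp A e"
  by (simp add: bd_comp_def)

lemma bd_comp_step:
  "f \<in> bd_comp A e \<Longrightarrow> star f f' \<Longrightarrow> f \<in> edge_bd A \<Longrightarrow> f' \<in> edge_bd A \<Longrightarrow> f' \<in> bd_comp A e"
  unfolding bd_comp_def by (auto intro: rtrancl_into_rtrancl)

lemma bd_comp_subset: "e \<in> edge_bd A \<Longrightarrow> bd_comp A e \<subseteq> edge_bd A"
  unfolding bd_comp_def by (auto elim: rtranclE)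

lemma bd_comp_induct [consumes 1, case_names base step]:
  assumes "f \<in> bd_comp A e" "P e"
    and "\<And>a b. a \<in> bd_comp A e \<Longrightarrow> star a b \<Longrightarrow> a \<in> edge_bd A \<Longrightarrow> b \<in> edge_bd A \<Longrightarrow> P a \<Longrightarrow> P b"
  shows "P f"
  using assms(1) unfolding bd_comp_def mem_Collect_eq
  by (induction rule: rtrancl_induct) (use assms(2,3) in \<open>auto simp: bd_comp_def\<close>)

lemma plaquette_star:
  assumes "i \<noteq> j"
    and "a \<in> {{x, up i x}, {up j x, up i (up j x)}, {x, up j x}, {up i x, up j (up i x)}}"
    and "b \<in> {{x, up i x}, {up j x, up i (up j x)}, {x, up j x}, {up i x, up j (up i x)}}"
  shows "star a b"
proof -
  let ?Q = "{x, up i x, up j x, up i (up j x)}"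
  have one: "l1dist u (up k u) = 1" for u :: "'a \<Rightarrow> int" and k
    using lattice_adj_up[of u k] by (simp add: lattice_adj_def)
  have far: "l1dist x (up i (up j x)) \<le> 2" "l1dist (up i x) (up j x) \<le> 2"
    using l1dist_triangle[of x "up i (up j x)" "up j x"] one[of x j] one[of "up j x" i]
      l1dist_triangle[of "up i x" "up j x" x] one[of x i] l1dist_commute[of x "up i x"] by auto
  have "l1dist (up i x) (up i (up j x)) = 1"
    using one[of "up i x" j] assms(1) by (simp add: up_commute)
  then have Q: "l1dist u v \<le> 2" if "u \<in> ?Q" "v \<in> ?Q" for u v
    using that far one[of x i] one[of x j] one[of "up j x" i]
    by (auto simp: l1dist_commute)
  have lat: "{u, up k u} \<in> lattice_edges" for u :: "'a \<Rightarrow> int" and k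
    by (simp add: lattice_edge_iff)
  have "a \<subseteq> ?Q" "b \<subseteq> ?Q" "a \<in> lattice_edges" "b \<in> lattice_edges"
    using assms(2,3) lat[of x i] lat[of "up j x" i] lat[of x j] lat[of "up i x" j]
      up_commute[OF assms(1), of x] by auto
  then show ?thesis unfolding star_def using Q by blast
qed

text \<open>Each plaquette meets the boundary of a set evenly and the plaquette's boundary edges are
  pairwise related by \<^const>\<open>star\<close>, so each component of the boundary is again a closed form.\<close>

lemma bd_comp_potential:
  fixes A :: "('d::finite \<Rightarrow> int) set"
  assumes e: "e \<in> edge_bd A"
  shows "\<exists>g :: ('d \<Rightarrow> int) \<Rightarrow> bool. \<forall>u v. lattice_adj u v \<longrightarrow> (g u \<noteq> g v) = ({u, v} \<in> bd_comp A e)"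
proof -
  define C where "C = bd_comp A e"
  have sub: "f \<in> C \<Longrightarrow> f \<in> edge_bd A" for f using bd_comp_subset[OF e] by (auto simp: C_def)
  have step: "f \<in> C \<Longrightarrow> star f f' \<Longrightarrow> f' \<in> edge_bd A \<Longrightarrow> f' \<in> C" for f f'
    using bd_comp_step sub by (metis C_def)
  have "\<exists>g :: ('d \<Rightarrow> int) \<Rightarrow> bool. \<forall>i x. (g x \<noteq> g (up i x)) = ({x, up i x} \<in> C)"
  proof (rule potential_of_closed_form)
    fix i j :: 'd and x assume ij: "i \<noteq> j"
    let ?e1 = "{x, up i x}" and ?e2 = "{up j x, up i (up j x)}"
      and ?e3 = "{x, up j x}" and ?e4 = "{up i x, up j (up i x)}"
    have st: "\<And>a b. a \<in> {?e1, ?e2, ?e3, ?e4} \<Longrightarrow> b \<in> {?e1, ?e2, ?e3, ?e4} \<Longrightarrow> star a b"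
      by (rule plaquette_star[OF ij])
    have all: "a \<in> C \<Longrightarrow> b \<in> edge_bd A \<Longrightarrow> b \<in> C"
      if "a \<in> {?e1, ?e2, ?e3, ?e4}" "b \<in> {?e1, ?e2, ?e3, ?e4}" for a b
      using step st[OF that] by blast
    have bd: "?e1 \<in> edge_bd A \<longleftrightarrow> (x \<in> A) \<noteq> (up i x \<in> A)"
      "?e2 \<in> edge_bd A \<longleftrightarrow> (up j x \<in> A) \<noteq> (up i (up j x) \<in> A)"
      "?e3 \<in> edge_bd A \<longleftrightarrow> (x \<in> A) \<noteq> (up j x \<in> A)"
      "?e4 \<in> edge_bd A \<longleftrightarrow> (up i x \<in> A) \<noteq> (up i (up j x) \<in> A)"
      using edge_bd_iff[OF lattice_adj_up, of x i A] edge_bd_iff[OF lattice_adj_up, of "up j x" i A]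
        edge_bd_iff[OF lattice_adj_up, of x j A] edge_bd_iff[OF lattice_adj_up, of "up i x" j A]
      by (simp_all add: up_commute[OF ij, of x])
    show "((?e1 \<in> C) \<noteq> (?e2 \<in> C)) = ((?e3 \<in> C) \<noteq> (?e4 \<in> C))"
    \<comment> \<open>As soon as one edge of the plaquette is in \<open>C\<close>, all its boundary
      edges are, so the parity identity for \<open>edge_bd A\<close> passes to \<open>C\<close>;
      otherwise both sides are trivial.\<close>
    proof (cases "?e1 \<in> C \<or> ?e2 \<in> C \<or> ?e3 \<in> C \<or> ?e4 \<in> C")
      case True
      then have "\<And>b. b \<in> {?e1, ?e2, ?e3, ?e4} \<Longrightarrow> (b \<in> C) = (b \<in> edge_bd A)"
        using all sub by blast
      then have "(?e1 \<in> C) = (?e1 \<in> edge_bd A)" "(?e2 \<in> C) = (?e2 \<in> edge_bd A)"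
        "(?e3 \<in> C) = (?e3 \<in> edge_bd A)" "(?e4 \<in> C) = (?e4 \<in> edge_bd A)" by blast+
      then show ?thesis using bd by argo
    qed blast
  qed
  then obtain g :: "('d \<Rightarrow> int) \<Rightarrow> bool" where "\<forall>i x. (g x \<noteq> g (up i x)) = ({x, up i x} \<in> C)" by (rule exE)
  note g = this[rule_format]
  have "(g u \<noteq> g v) = ({u, v} \<in> C)" if "lattice_adj u v" for u v
  proof -
    obtain i where "v = up i u \<or> u = up i v" using lattice_adj_cases[OF \<open>lattice_adj u v\<close>] .
    then show ?thesis using g[of u i] g[of v i] by (auto simp: insert_commute)
  qed
  then show ?thesis unfolding C_def by (intro exI[of _ g]) simp
qed

section \<open>The outside of an l1 ball\<close>

lemma outside_ball_line:
  fixes g :: "('d::finite \<Rightarrow> int) \<Rightarrow> 'b"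
  assumes const: "\<And>u v. lattice_adj u v \<Longrightarrow> m \<le> l1dist x0 u \<Longrightarrow> m \<le> l1dist x0 v \<Longrightarrow> g u = g v"
    and "a \<le> b" and "\<And>t. a \<le> t \<Longrightarrow> t \<le> b \<Longrightarrow> m \<le> l1dist x0 (u(k := t))"
  shows "g (u(k := a)) = g (u(k := b))"
  using assms(2,3)
proof (induction b rule: int_ge_induct)
  case (step b)
  have "lattice_adj (u(k := b)) (u(k := b + 1))"
    using lattice_adj_up[of "u(k := b)" k] by (simp add: up_def)
  then have "g (u(k := b)) = g (u(k := b + 1))"
    by (rule const[OF _ step.prems step.prems]) (use step.hyps in simp_all)
  moreover have "g (u(k := a)) = g (u(k := b))"
    by (rule step.IH) (use step.prems in simp)
  ultimately show ?case by (simp add: fun_upd_def)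
qed simp

text \<open>Connectedness of the outside of a ball, phrased through locally constant functions. Once
  one coordinate is at distance at least \<open>m\<close> from that of \<open>x0\<close>, all the
  others move freely; with a second coordinate available, every point is brought to the reference
  point \<open>z\<close>.\<close>

lemma outside_ball_const:
  fixes g :: "('d::finite \<Rightarrow> int) \<Rightarrow> 'b"
  assumes d: "CARD('d) \<ge> 2"
    and const: "\<And>u v. lattice_adj u v \<Longrightarrow> m \<le> l1dist x0 u \<Longrightarrow> m \<le> l1dist x0 v \<Longrightarrow> g u = g v"
    and "m \<le> l1dist x0 u" "m \<le> l1dist x0 v"
  shows "g u = g v"
proof -
  note line = outside_ball_line[of m x0 g, OF const]
  have far: "m \<le> l1dist x0 w" if "int m \<le> \<bar>w i - x0 i\<bar>" for w i
    using coord_le_l1dist[of w i x0] that by (simp add: l1dist_commute)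
  have line2: "g w = g (w(k := b))" if "i \<noteq> k" "int m \<le> \<bar>w i - x0 i\<bar>" for w i k b
  proof -
    have *: "m \<le> l1dist x0 (w(k := t))" for t using that by (intro far[of _ i]) auto
    have "g (w(k := w k)) = g (w(k := b))"
    proof (cases "w k \<le> b")
      case True then show ?thesis using line * by blast
    next
      case False
      then have "g (w(k := b)) = g (w(k := w k))" using line[of b "w k" w k] * by simp
      then show ?thesis by simp
    qed
    then show ?thesis by simp
  qed
  have multi: "g w = g w'" if "int m \<le> \<bar>w i - x0 i\<bar>" "w i = w' i" for w w' i
  proof -
    have "g w = g (\<lambda>k. if k \<in> S then w' k else w k)" if "finite S" for S
      using that
    proof (induction S rule: finite_induct)
      case (insert k S)
      let ?w = "\<lambda>k. if k \<in> S then w' k else w k"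
      have "(\<lambda>l. if l \<in> insert k S then w' l else w l) = ?w(k := w' k)" by auto
      moreover have "g ?w = g (?w(k := w' k))"
      proof (cases "k = i")
        case True
        then have "?w(k := w' k) = ?w" using \<open>w i = w' i\<close> by auto
        then show ?thesis by simp
      next
        case False
        then show ?thesis using \<open>int m \<le> \<bar>w i - x0 i\<bar>\<close> \<open>w i = w' i\<close>
          by (intro line2[of i]) auto
      qed
      ultimately show ?case using insert.IH by simp
    qed simp
    from this[of UNIV] show ?thesis by simp
  qed
  define z where "z = (\<lambda>k. x0 k + int m)"
  have "g w = g z" if w: "m \<le> l1dist x0 w" for w
  proof -
    obtain i j :: 'd where ij: "i \<noteq> j"
      using d by (metis card_2_iff' card_le_Suc_iff ex_card subset_UNIV numeral_2_eq_2)
    \<comment> \<open>Coordinate \<open>i\<close> is pushed away from \<open>x0 i\<close>, on the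
      side where it already lies, so the l1 distance never decreases on the way.\<close>
    obtain b where b: "int m \<le> \<bar>b - x0 i\<bar>" "g w = g (w(i := b))"
    proof (cases "x0 i \<le> w i")
      case True
      let ?b = "w i + int m"
      have "g (w(i := w i)) = g (w(i := ?b))"
      proof (rule line)
        fix t assume "w i \<le> t"
        have "int (l1dist x0 w) \<le> int (l1dist x0 (w(i := t)))"
          unfolding int_l1dist by (rule sum_mono) (use True \<open>w i \<le> t\<close> in auto)
        then show "m \<le> l1dist x0 (w(i := t))" using w by linarith
      qed auto
      then show ?thesis using that[of ?b] True by simp
    next
      case False
      let ?b = "w i - int m"
      have "g (w(i := ?b)) = g (w(i := w i))"
      proof (rule line)
        fix t assume "t \<le> w i"
        have "int (l1dist x0 w) \<le> int (l1dist x0 (w(i := t)))"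
          unfolding int_l1dist by (rule sum_mono) (use False \<open>t \<le> w i\<close> in auto)
        then show "m \<le> l1dist x0 (w(i := t))" using w by linarith
      qed auto
      then show ?thesis using that[of ?b] False by simp
    qed
    have "g (w(i := b)) = g (z(i := b))" by (rule multi[of _ i]) (use b in auto)
    also have "\<dots> = g z" by (rule multi[of _ j]) (use ij in \<open>auto simp: z_def\<close>)
    finally show ?thesis using b by simp
  qed
  then show ?thesis using assms(3,4) by metis
qed

section \<open>Radii of edges and the degree of \<open>star\<close>\<close>

definition edge_radius :: "('d::finite \<Rightarrow> int) \<Rightarrow> ('d \<Rightarrow> int) set \<Rightarrow> nat" where
  "edge_radius x0 f = Min (l1dist x0 ` f)"

lemma le_edge_radius_iff:
  "f \<in> lattice_edges \<Longrightarrow> m \<le> edge_radius x0 f \<longleftrightarrow> (\<forall>u\<in>f. m \<le> l1dist x0 u)"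
  using lattice_edge_finite[of f] lattice_edge_nonempty[of f] by (simp add: edge_radius_def)

lemma edge_radius_obtain:
  assumes "f \<in> lattice_edges"
  obtains u where "u \<in> f" "l1dist x0 u = edge_radius x0 f"
proof -
  have "Min (l1dist x0 ` f) \<in> l1dist x0 ` f"
    using assms by (intro Min_in) (auto simp: lattice_edge_finite lattice_edge_nonempty)
  then show ?thesis using that by (auto simp: edge_radius_def)
qed

lemma edge_radius_le: "f \<in> lattice_edges \<Longrightarrow> u \<in> f \<Longrightarrow> edge_radius x0 f \<le> l1dist x0 u"
  using le_edge_radius_iff by blast

text \<open>Half the radius thus grows by at most one per step, which is the form required by
  \<open>distinct_walk_of_rtrancl\<close>; this is the origin of the factors 2 in the later
  radii.\<close>

lemma edge_radius_star:
  assumes "star a b"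
  shows "edge_radius x0 b \<le> edge_radius x0 a + 2"
proof -
  have ab: "a \<in> lattice_edges" "b \<in> lattice_edges" using assms by (auto simp: star_def)
  obtain u where u: "u \<in> a" "l1dist x0 u = edge_radius x0 a"
    using edge_radius_obtain[OF ab(1)] .
  obtain v where v: "v \<in> b" using lattice_edge_nonempty[OF ab(2)] by blast
  have "edge_radius x0 b \<le> l1dist x0 v" by (rule edge_radius_le[OF ab(2) v])
  also have "\<dots> \<le> l1dist x0 u + l1dist u v" by (rule l1dist_triangle)
  also have "\<dots> \<le> edge_radius x0 a + 2" using assms u v by (auto simp: star_def)
  finally show ?thesis .
qed

text \<open>Both endpoints of \<open>b\<close> lie in the cube of side 5 around one endpoint of
  \<open>a\<close>, which leaves 5^d choices for each of them.\<close>

lemma star_degree: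
  fixes a :: "('d::finite \<Rightarrow> int) set"
  shows "finite {b. star a b}" "card {b. star a b} \<le> 25 ^ CARD('d)"
proof -
  have "finite {b. star a b} \<and> card {b. star a b} \<le> 25 ^ CARD('d)"
  proof (cases "a \<in> lattice_edges")
    case False
    then have "{b. star a b} = {}" by (auto simp: star_def)
    then show ?thesis by (simp only: card.empty) simp
  next
    case True
    then obtain u where u: "u \<in> a" using lattice_edge_nonempty by blast
    define Q where "Q = PiE UNIV (\<lambda>i. {u i - 2 .. u i + 2})"
    have finQ: "finite Q" unfolding Q_def by (rule finite_PiE) auto
    have cardQ: "card Q = 5 ^ CARD('d)" unfolding Q_def by (subst card_PiE) auto
    have inQ: "v \<in> Q" if "l1dist u v \<le> 2" for v
      unfolding Q_def
    proof (rule PiE_I)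
      fix i
      have "\<bar>u i - v i\<bar> \<le> 2" using coord_le_l1dist[of u i v] that by linarith
      then show "v i \<in> {u i - 2 .. u i + 2}" by auto
    qed auto
    have sub: "{b. star a b} \<subseteq> (\<lambda>(v, w). {v, w}) ` (Q \<times> Q)"
    proof
      fix b assume "b \<in> {b. star a b}"
      then have "b \<in> lattice_edges" "\<forall>v\<in>b. l1dist u v \<le> 2" using u by (auto simp: star_def)
      then show "b \<in> (\<lambda>(v, w). {v, w}) ` (Q \<times> Q)"
        using inQ by (auto elim!: lattice_edgeE)
    qed
    have "card {b. star a b} \<le> card ((\<lambda>(v, w). {v, w}) ` (Q \<times> Q))"
      by (rule card_mono[OF _ sub]) (use finQ in auto)
    also have "\<dots> \<le> card (Q \<times> Q)" by (rule card_image_le) (use finQ in auto)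
    also have "\<dots> = 25 ^ CARD('d)"
      by (simp add: card_cartesian_product cardQ power_mult_distrib[symmetric])
    finally show ?thesis using finite_subset[OF sub] finQ by auto
  qed
  then show "finite {b. star a b}" "card {b. star a b} \<le> 25 ^ CARD('d)" by auto
qed

lemma bd_comp_inside_potential:
  fixes A :: "('d::finite \<Rightarrow> int) set"
  assumes "CARD('d) \<ge> 2" and e: "e \<in> edge_bd A"
    and inside: "\<And>f. f \<in> bd_comp A e \<Longrightarrow> edge_radius x0 f < m"
  shows "\<exists>g :: ('d \<Rightarrow> int) \<Rightarrow> bool.
    (\<forall>u v. lattice_adj u v \<longrightarrow> (g u \<noteq> g v) = ({u, v} \<in> bd_comp A e)) \<and>
    (\<forall>u v. m \<le> l1dist x0 u \<longrightarrow> m \<le> l1dist x0 v \<longrightarrow> g u = g v)"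
proof -
  obtain g :: "('d \<Rightarrow> int) \<Rightarrow> bool" where g: "\<And>u v. lattice_adj u v \<Longrightarrow> (g u \<noteq> g v) = ({u, v} \<in> bd_comp A e)"
    using bd_comp_potential[OF e] by (elim exE) (simp, metis)
  have out: "g u = g v" if "m \<le> l1dist x0 u" "m \<le> l1dist x0 v" for u v
  proof (rule outside_ball_const[OF assms(1) _ that])
    fix u v :: "'d \<Rightarrow> int"
    assume uv: "lattice_adj u v" "m \<le> l1dist x0 u" "m \<le> l1dist x0 v"
    then have "m \<le> edge_radius x0 {u, v}" by (subst le_edge_radius_iff) (auto simp: lattice_edge_iff)
    then have "{u, v} \<notin> bd_comp A e" using inside by fastforce
    then show "g u = g v" using g[OF uv(1)] by simp
  qed
  show ?thesis
    by (intro exI[of _ g] conjI allI impI g out)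
qed

text \<open>If the component stayed inside the ball, its potential \<open>g\<close> would be
  unchanged along the two escape paths, which do not cross the boundary of \<open>A\<close>, and
  between their ends, which lie outside the ball; but \<open>g\<close> differs at \<open>x\<close>
  and \<open>y\<close>. This does the work of connectedness of cluster boundaries.\<close>

lemma bd_comp_exits_ball:
  fixes A :: "('d::finite \<Rightarrow> int) set"
  assumes "CARD('d) \<ge> 2" and adj: "lattice_adj x y" and xy: "(x \<in> A) \<noteq> (y \<in> A)"
    and x: "(x, z) \<in> {(u, v). lattice_adj u v \<and> (u \<in> A) = (v \<in> A)}\<^sup>*" "m \<le> l1dist x0 z"
    and y: "(y, z') \<in> {(u, v). lattice_adj u v \<and> (u \<in> A) = (v \<in> A)}\<^sup>*" "m \<le> l1dist x0 z'"
  shows "\<exists>f\<in>bd_comp A {x, y}. m \<le> edge_radius x0 f"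
proof (rule ccontr)
  assume "\<not> ?thesis"
  then have inside: "\<And>f. f \<in> bd_comp A {x, y} \<Longrightarrow> edge_radius x0 f < m" by (meson not_le)
  have e: "{x, y} \<in> edge_bd A" by (rule iffD2[OF edge_bd_iff[OF adj] xy])
  obtain g :: "('d \<Rightarrow> int) \<Rightarrow> bool" where
    "(\<forall>u v. lattice_adj u v \<longrightarrow> (g u \<noteq> g v) = ({u, v} \<in> bd_comp A {x, y})) \<and>
     (\<forall>u v. m \<le> l1dist x0 u \<longrightarrow> m \<le> l1dist x0 v \<longrightarrow> g u = g v)"
    using bd_comp_inside_potential[OF assms(1) e inside] by (rule exE)
  note g = this[THEN conjunct1, rule_format] and out = this[THEN conjunct2, rule_format]
  have path: "g u = g v" if "(u, v) \<in> {(u, v). lattice_adj u v \<and> (u \<in> A) = (v \<in> A)}\<^sup>*" for u v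
    using that
  proof (induction rule: rtrancl_induct)
    case (step v w)
    then have "{v, w} \<notin> edge_bd A" using edge_bd_iff[of v w A] by auto
    then have "{v, w} \<notin> bd_comp A {x, y}" using bd_comp_subset[OF e] by blast
    then show ?case using step g[of v w] by auto
  qed simp
  have "g x = g y" using path[OF x(1)] path[OF y(1)] out[OF x(2) y(2)] by metis
  then show False using g[OF adj] bd_comp_self by blast
qed

section \<open>The FK weights\<close>

lemma rtrancl_insert_edge:
  assumes "sym R" "(z, w) \<in> (insert (x, y) (insert (y, x) R))\<^sup>*"
  shows "(z, w) \<in> R\<^sup>* \<or> (((x, z) \<in> R\<^sup>* \<or> (y, z) \<in> R\<^sup>*) \<and> ((x, w) \<in> R\<^sup>* \<or> (y, w) \<in> R\<^sup>*))"
  using assms(2)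
proof (induction rule: rtrancl_induct)
  case (step w w')
  have s: "sym (R\<^sup>*)" using assms(1) by (rule sym_rtrancl)
  from step(2) consider "(w, w') \<in> R" | "w = x" "w' = y" | "w = y" "w' = x" by blast
  then show ?case
  proof cases
    case 1
    then show ?thesis using step(3) by (meson rtrancl.rtrancl_into_rtrancl)
  next
    case 2
    then show ?thesis using step(3) s by (meson rtrancl.rtrancl_refl symD)
  next
    case 3
    then show ?thesis using step(3) s by (meson rtrancl.rtrancl_refl symD)
  qed
qed simp

text \<open>Only the classes of \<open>x\<close> and \<open>y\<close> are affected: either they
  coincide already, or the two are replaced by their union, which is not among the remaining
  classes.\<close>

lemma card_quotient_insert_edge:
  fixes R :: "('a \<times> 'a) set"
  assumes "finite S" "sym R" "R \<subseteq> S \<times> S" "x \<in> S" "y \<in> S"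
  defines "R' \<equiv> insert (x, y) (insert (y, x) R)"
  shows "card (S // (R\<^sup>* \<inter> S \<times> S)) =
    (if (x, y) \<in> R\<^sup>* then card (S // (R'\<^sup>* \<inter> S \<times> S)) else Suc (card (S // (R'\<^sup>* \<inter> S \<times> S))))"
proof (cases "(x, y) \<in> R\<^sup>*")
  case True
  then have "(y, x) \<in> R\<^sup>*" using sym_rtrancl[OF assms(2)] by (auto dest: symD)
  then have "R' \<subseteq> R\<^sup>*" "R \<subseteq> R'" using True by (auto simp: R'_def)
  then have "R'\<^sup>* = R\<^sup>*" by (intro rtrancl_subset) auto
  then show ?thesis using True by simp
next
  case False
  define r where "r = R\<^sup>* \<inter> S \<times> S"
  define r' where "r' = R'\<^sup>* \<inter> S \<times> S"
  have symR: "sym (R\<^sup>*)" by (rule sym_rtrancl[OF assms(2)])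
  have eq: "equiv S r"
    unfolding r_def equiv_def
    using symR by (auto simp: refl_on_def sym_def trans_def intro: rtrancl_trans)
  define cx where "cx = r `` {x}"
  define cy where "cy = r `` {y}"
  have sub: "R\<^sup>* \<subseteq> R'\<^sup>*" unfolding R'_def by (rule rtrancl_mono) auto
  have xy': "(x, y) \<in> R'\<^sup>*" "(y, x) \<in> R'\<^sup>*" unfolding R'_def by auto
  have r'_iff: "(z, w) \<in> r' \<longleftrightarrow> (z, w) \<in> r \<or> (z \<in> cx \<union> cy \<and> w \<in> cx \<union> cy)" if "z \<in> S" "w \<in> S" for z w
  proof
    assume "(z, w) \<in> r'"
    then show "(z, w) \<in> r \<or> (z \<in> cx \<union> cy \<and> w \<in> cx \<union> cy)"
      using rtrancl_insert_edge[OF assms(2), of z w x y] that assms(4,5)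
      unfolding r'_def r_def R'_def cx_def cy_def by blast
  next
    assume "(z, w) \<in> r \<or> (z \<in> cx \<union> cy \<and> w \<in> cx \<union> cy)"
    then show "(z, w) \<in> r'"
    proof
      assume "(z, w) \<in> r" then show ?thesis using sub that by (auto simp: r_def r'_def)
    next
      assume "z \<in> cx \<union> cy \<and> w \<in> cx \<union> cy"
      then have z: "(x, z) \<in> R\<^sup>* \<or> (y, z) \<in> R\<^sup>*" and w: "(x, w) \<in> R\<^sup>* \<or> (y, w) \<in> R\<^sup>*"
        by (auto simp: cx_def cy_def r_def)
      have "(z, x) \<in> R'\<^sup>*" using z symR sub xy'(2) by (meson rtrancl_trans subsetD symD)
      moreover have "(x, w) \<in> R'\<^sup>*" using w sub xy'(1) by (meson rtrancl_trans subsetD)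
      ultimately show ?thesis using that by (auto simp: r'_def intro: rtrancl_trans)
    qed
  qed
  have S_sub: "cx \<subseteq> S" "cy \<subseteq> S" by (auto simp: cx_def cy_def r_def)
  have xcx: "x \<in> cx" "y \<in> cy" using assms(4,5) by (auto simp: cx_def cy_def r_def)
  have class_in: "r' `` {z} = cx \<union> cy" if "z \<in> cx \<union> cy" for z
  proof -
    have zS: "z \<in> S" using that S_sub by auto
    have "r `` {z} \<subseteq> cx \<union> cy"
      using that by (auto simp: cx_def cy_def r_def intro: rtrancl_trans)
    moreover have "r' `` {z} = {w \<in> S. (z, w) \<in> r'}" by (auto simp: r'_def)
    ultimately show ?thesis using r'_iff[OF zS] that S_sub by blast
  qed
  have class_out: "r' `` {z} = r `` {z}" if "z \<in> S" "z \<notin> cx \<union> cy" for z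
  proof -
    have "r' `` {z} = {w \<in> S. (z, w) \<in> r'}" "r `` {z} = {w \<in> S. (z, w) \<in> r}"
      by (auto simp: r'_def r_def)
    then show ?thesis using r'_iff[OF that(1)] that(2) by blast
  qed
  have in_iff: "z \<in> cx \<union> cy \<longleftrightarrow> r `` {z} \<in> {cx, cy}" if "z \<in> S" for z
  proof
    assume "z \<in> cx \<union> cy"
    then have "(x, z) \<in> r \<or> (y, z) \<in> r" by (auto simp: cx_def cy_def)
    then show "r `` {z} \<in> {cx, cy}" using equiv_class_eq[OF eq] by (auto simp: cx_def cy_def)
  next
    assume "r `` {z} \<in> {cx, cy}"
    moreover have "z \<in> r `` {z}" using that by (auto simp: r_def)
    ultimately show "z \<in> cx \<union> cy" by auto
  qed
  have quot: "S // r' = insert (cx \<union> cy) (S // r - {cx, cy})"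
  proof (intro equalityI subsetI)
    fix c assume "c \<in> S // r'"
    then obtain z where z: "z \<in> S" "c = r' `` {z}" by (auto elim: quotientE)
    show "c \<in> insert (cx \<union> cy) (S // r - {cx, cy})"
    proof (cases "z \<in> cx \<union> cy")
      case True then show ?thesis using class_in z by simp
    next
      case False
      then have "c = r `` {z}" "r `` {z} \<notin> {cx, cy}"
        using class_out in_iff z by blast+
      then show ?thesis using z by (auto intro: quotientI)
    qed
  next
    fix c assume c: "c \<in> insert (cx \<union> cy) (S // r - {cx, cy})"
    show "c \<in> S // r'"
    proof (cases "c = cx \<union> cy")
      case True
      then have "c = r' `` {x}" using class_in[of x] xcx by simp
      then show ?thesis using assms(4) by (auto intro: quotientI)
    next
      case False
      then obtain z where z: "z \<in> S" "c = r `` {z}" "c \<notin> {cx, cy}" using c by (auto elim: quotientE)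
      then have "z \<notin> cx \<union> cy" using in_iff by blast
      then have "c = r' `` {z}" using class_out z by simp
      then show ?thesis using z by (auto intro: quotientI)
    qed
  qed
  have fin: "finite (S // r)" by (rule finite_quotient) (use assms(1) in \<open>auto simp: r_def\<close>)
  have cin: "cx \<in> S // r" "cy \<in> S // r" using assms(4,5) by (auto simp: cx_def cy_def intro: quotientI)
  have ne: "cx \<noteq> cy"
  proof
    assume "cx = cy"
    then have "y \<in> cx" using xcx by simp
    then show False using False by (auto simp: cx_def r_def)
  qed
  have "cx \<union> cy \<notin> S // r - {cx, cy}"
  proof
    assume a: "cx \<union> cy \<in> S // r - {cx, cy}"
    then have "cx \<union> cy \<in> S // r" by simp
    then obtain z where z: "z \<in> S" "cx \<union> cy = r `` {z}" by (rule quotientE)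
    then have "(z, x) \<in> r" using xcx by auto
    then have "r `` {z} = cx" using equiv_class_eq[OF eq] by (auto simp: cx_def)
    then show False using a z by simp
  qed
  then have "card (S // r') = Suc (card (S // r - {cx, cy}))"
    unfolding quot using fin by simp
  also have "card (S // r - {cx, cy}) = card (S // r) - 2"
    using cin ne fin by (simp add: card_Diff_subset)
  finally have "card (S // r') = Suc (card (S // r) - 2)" .
  moreover have "2 \<le> card (S // r)"
    using card_mono[OF fin, of "{cx, cy}"] cin ne by simp
  ultimately show ?thesis using False unfolding r_def r'_def by simp
qed

section \<open>Clusters of vertex sets and connection events\<close>

definition reach :: "'v set set \<Rightarrow> 'v set \<Rightarrow> 'v set" where
  "reach \<omega> A = {x. \<exists>a\<in>A. (a, x) \<in> (open_rel \<omega>)\<^sup>*}"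

lemma sym_open_rel: "sym (open_rel \<omega>)"
  by (auto simp: sym_def open_rel_def insert_commute)

lemma reach_step: "x \<in> reach \<omega> A \<Longrightarrow> {x, y} \<in> \<omega> \<Longrightarrow> y \<in> reach \<omega> A"
  unfolding reach_def by (auto simp: open_rel_def intro: rtrancl_into_rtrancl)

lemma reach_start: "A \<subseteq> reach \<omega> A"
  unfolding reach_def by auto

lemma reach_mono: "\<omega> \<subseteq> \<omega>' \<Longrightarrow> reach \<omega> A \<subseteq> reach \<omega>' A"
proof -
  assume "\<omega> \<subseteq> \<omega>'"
  then have "(open_rel \<omega>)\<^sup>* \<subseteq> (open_rel \<omega>')\<^sup>*" by (intro rtrancl_mono) (auto simp: open_rel_def)
  then show ?thesis by (auto simp: reach_def)
qed

lemma connects_commute: "connects \<omega> T B \<longleftrightarrow> connects \<omega> B T"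
  unfolding connects_def using sym_rtrancl[OF sym_open_rel] by (meson symD)

lemma connects_iff_reach: "connects \<omega> T B \<longleftrightarrow> reach \<omega> T \<inter> reach \<omega> B \<noteq> {}"
proof
  assume "connects \<omega> T B"
  then show "reach \<omega> T \<inter> reach \<omega> B \<noteq> {}" unfolding connects_def reach_def by blast
next
  assume "reach \<omega> T \<inter> reach \<omega> B \<noteq> {}"
  then obtain x t b where "t \<in> T" "b \<in> B" "(t, x) \<in> (open_rel \<omega>)\<^sup>*" "(b, x) \<in> (open_rel \<omega>)\<^sup>*"
    unfolding reach_def by blast
  then show "connects \<omega> T B" unfolding connects_def
    using sym_rtrancl[OF sym_open_rel, of \<omega>] by (meson rtrancl_trans symD)
qed

lemma connects_mono: "\<omega> \<subseteq> \<omega>' \<Longrightarrow> connects \<omega> T B \<Longrightarrow> connects \<omega>' T B"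
  unfolding connects_iff_reach using reach_mono[of \<omega> \<omega>'] by blast

lemma reach_Un_disjoint:
  assumes "\<And>a. a \<in> S \<Longrightarrow> a \<inter> reach \<omega> A = {}"
  shows "reach (\<omega> \<union> S) A = reach \<omega> A"
proof
  show "reach (\<omega> \<union> S) A \<subseteq> reach \<omega> A"
  proof
    fix x assume "x \<in> reach (\<omega> \<union> S) A"
    then obtain a where a: "a \<in> A" "(a, x) \<in> (open_rel (\<omega> \<union> S))\<^sup>*" by (auto simp: reach_def)
    show "x \<in> reach \<omega> A" using a(2)
    proof (induction rule: rtrancl_induct)
      case base
      show ?case using a(1) reach_start[of A \<omega>] by (rule rev_subsetD)
    next
      case (step y z)
      then have "{y, z} \<in> \<omega> \<union> S" by (auto simp: open_rel_def)
      moreover have "{y, z} \<notin> S" using assms step(3) by blast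
      ultimately have "{y, z} \<in> \<omega>" by simp
      then show ?case by (rule reach_step[OF step(3)])
    qed
  qed
qed (rule reach_mono, simp)

text \<open>The cluster of \<open>B\<close> does not grow when edges avoiding it are opened, however
  these connect among themselves, so it still misses \<open>T\<close>.\<close>

lemma not_connects_Un:
  assumes "\<not> connects \<omega> T B" "\<And>a. a \<in> S \<Longrightarrow> a \<inter> reach \<omega> B = {}"
  shows "\<not> connects (\<omega> \<union> S) T B"
proof
  assume "connects (\<omega> \<union> S) T B"
  then have "connects (\<omega> \<union> S) B T" by (simp add: connects_commute)
  then obtain t where "t \<in> T" "t \<in> reach (\<omega> \<union> S) B"
    unfolding connects_def reach_def by blast
  then have "t \<in> reach \<omega> T \<inter> reach \<omega> B"
    using reach_Un_disjoint[OF assms(2)] reach_start[of T \<omega>] by blast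
  then show False using assms(1) connects_iff_reach[of \<omega> T B] by blast
qed

lemma connects_insert_iff:
  assumes "\<not> connects \<omega> T B"
  shows "connects (insert {u, v} \<omega>) T B \<longleftrightarrow>
    (u \<in> reach \<omega> T \<and> v \<in> reach \<omega> B) \<or> (v \<in> reach \<omega> T \<and> u \<in> reach \<omega> B)"
proof
  assume c: "connects (insert {u, v} \<omega>) T B"
  have disj: "reach \<omega> T \<inter> reach \<omega> B = {}" using assms connects_iff_reach by blast
  have "{u, v} \<inter> reach \<omega> B \<noteq> {}"
    using not_connects_Un[OF assms, of "{{u, v}}"] c by (metis Un_insert_right singletonD sup_bot_right)
  moreover have "{u, v} \<inter> reach \<omega> T \<noteq> {}"
    using not_connects_Un[of \<omega> B T "{{u, v}}"] assms c
    by (metis Un_insert_right connects_commute singletonD sup_bot_right)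
  ultimately show "(u \<in> reach \<omega> T \<and> v \<in> reach \<omega> B) \<or> (v \<in> reach \<omega> T \<and> u \<in> reach \<omega> B)"
    using disj by blast
next
  let ?\<omega> = "insert {u, v} \<omega>"
  assume a: "(u \<in> reach \<omega> T \<and> v \<in> reach \<omega> B) \<or> (v \<in> reach \<omega> T \<and> u \<in> reach \<omega> B)"
  have m: "reach \<omega> A \<subseteq> reach ?\<omega> A" for A by (rule reach_mono) auto
  have "v \<in> reach ?\<omega> A" if "u \<in> reach ?\<omega> A" for A using reach_step[OF that, of v] by simp
  moreover have "u \<in> reach ?\<omega> A" if "v \<in> reach ?\<omega> A" for A
    using reach_step[OF that, of u] by (simp add: insert_commute)
  ultimately show "connects ?\<omega> T B" unfolding connects_iff_reach using a m by blast
qed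

lemma ext_rel_insert:
  "ext_rel T B (insert {u, v} \<omega>)
    = insert (Inl u, Inl v) (insert (Inl v, Inl u) (ext_rel T B \<omega>))"
  unfolding ext_rel_def by (auto simp: doubleton_eq_iff)

lemma sym_ext_rel: "sym (ext_rel T B \<omega>)"
  unfolding ext_rel_def sym_def by (auto simp: insert_commute)

lemma ext_rel_mono: "\<omega> \<subseteq> \<omega>' \<Longrightarrow> ext_rel T B \<omega> \<subseteq> ext_rel T B \<omega>'"
  unfolding ext_rel_def by blast

section \<open>FK weights and the law conditioned on disconnection\<close>

locale fk_box =
  fixes V :: "('d::finite \<Rightarrow> int) set" and E T B and p q :: real
  assumes dim: "CARD('d) \<ge> 2" and finV: "finite V"
    and E_eq: "E = {e \<in> lattice_edges. e \<subseteq> V}"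
    and TB: "T \<union> B = vboundary V" and TB_disj: "T \<inter> B = {}"
    and p: "0 < p" "p < 1" and q: "1 \<le> q" and E_ne: "E \<noteq> {}"
begin

lemma finE: "finite E"
  by (rule finite_subset[of _ "Pow V"]) (use finV in \<open>auto simp: E_eq\<close>)

lemma TB_V: "T \<subseteq> V" "B \<subseteq> V"
  using TB by (auto simp: vboundary_def)

abbreviation "weight \<equiv> fk_weight V E T B p q"

text \<open>Connection in the wired graph, where a path may pass through the extra vertices attached
  to \<open>T\<close> and \<open>B\<close>. For \<open>\<omega> - {e}\<close> it decides whether
  closing \<open>e\<close> creates a new cluster.\<close>

definition "joined \<omega> e \<longleftrightarrow> (\<forall>u\<in>e. \<forall>v\<in>e. (Inl u, Inl v) \<in> (ext_rel T B \<omega>)\<^sup>*)"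

lemma joined_mono: "\<omega> \<subseteq> \<omega>' \<Longrightarrow> joined \<omega> e \<Longrightarrow> joined \<omega>' e"
  unfolding joined_def using rtrancl_mono[OF ext_rel_mono, of \<omega> \<omega>' T B] by blast

lemma joined_pair: "joined \<omega> {u, v} \<longleftrightarrow> (Inl u, Inl v) \<in> (ext_rel T B \<omega>)\<^sup>*"
  unfolding joined_def using sym_rtrancl[OF sym_ext_rel, of T B \<omega>] by (auto dest: symD)

lemma weight_pos: "0 < weight \<omega>"
  unfolding fk_weight_def using p q by simp

lemma weight_remove:
  assumes "e \<in> E" "\<omega> \<subseteq> E"
  shows "weight (\<omega> - {e}) = weight (insert e \<omega>) * ((1 - p) / p) * (if joined (\<omega> - {e}) e then 1 else q)"
proof -
  obtain u v where uv: "e = {u, v}" using assms(1) by (auto simp: E_eq elim: lattice_edgeE)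
  have uvV: "u \<in> V" "v \<in> V" using assms(1) uv by (auto simp: E_eq)
  let ?\<omega> = "\<omega> - {e}"
  have ins: "insert e ?\<omega> = insert e \<omega>" by auto
  have "x \<in> V \<and> y \<in> V" if "{x, y} \<in> \<omega>" for x y
    using that assms(2) by (auto simp: E_eq)
  then have "ext_rel T B ?\<omega> \<subseteq> ext_vertices V \<times> ext_vertices V"
    using TB_V unfolding ext_rel_def ext_vertices_def by blast
  moreover have "finite (ext_vertices V)" using finV by (simp add: ext_vertices_def)
  moreover have "Inl u \<in> ext_vertices V" "Inl v \<in> ext_vertices V"
    using uvV by (auto simp: ext_vertices_def)
  moreover have "ext_rel T B (insert e \<omega>)
      = insert (Inl u, Inl v) (insert (Inl v, Inl u) (ext_rel T B ?\<omega>))"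
    unfolding ins[symmetric] using ext_rel_insert[of T B u v ?\<omega>] uv by (simp only:)
  moreover have "joined ?\<omega> e \<longleftrightarrow> (Inl u, Inl v) \<in> (ext_rel T B ?\<omega>)\<^sup>*"
    using joined_pair[of ?\<omega> u v] uv by (simp only:)
  ultimately have nc: "num_clusters V T B ?\<omega> = (if joined ?\<omega> e then num_clusters V T B (insert e \<omega>)
      else Suc (num_clusters V T B (insert e \<omega>)))"
    using card_quotient_insert_edge[of "ext_vertices V" "ext_rel T B ?\<omega>" "Inl u" "Inl v"]
    unfolding num_clusters_def by (simp only: sym_ext_rel)
  have fin: "finite \<omega>" using assms(2) finE by (rule finite_subset)
  have c1: "card (insert e \<omega>) = Suc (card ?\<omega>)" using fin ins by (metis card_insert_disjoint finite_Diff Diff_iff singletonI)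
  have "card (insert e \<omega>) \<le> card E" using assms finE by (intro card_mono) auto
  then have c2: "card E - card ?\<omega> = Suc (card E - card (insert e \<omega>))" using c1 by simp
  show ?thesis
    unfolding fk_weight_def nc c2 c1 using p by (simp add: field_simps)
qed

text \<open>\<open>\<theta>1\<close> and \<open>\<theta>2\<close> are the conditional probabilities
  that an edge is closed when its endpoints are, respectively are not, joined by the rest of the
  configuration. \<open>\<delta>\<close> is the odds \<open>\<theta>2 / (1 - \<theta>2)\<close>, the
  largest possible ratio of the weights with the edge closed and open.\<close>

definition "\<theta>1 = 1 - p"
definition "\<theta>2 = q * (1 - p) / (p + q * (1 - p))"
definition "\<delta> = q * (1 - p) / p"

lemma den_pos: "0 < p + q * (1 - p)"
  using p q by (simp add: add_pos_pos)

lemma theta_bounds: "0 < \<theta>1" "\<theta>1 \<le> \<theta>2" "\<theta>2 < 1" "0 < \<delta>" "\<theta>2 \<le> \<delta>"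
proof -
  show "0 < \<theta>1" using p by (simp add: \<theta>1_def)
  have "(1 - p) * (p + q * (1 - p)) \<le> q * (1 - p)"
  proof -
    have "p + q * (1 - p) \<le> q" using p q by (simp add: algebra_simps)
    then show ?thesis using p by (simp add: mult.commute[of q] mult_left_mono)
  qed
  then show "\<theta>1 \<le> \<theta>2" unfolding \<theta>1_def \<theta>2_def using den_pos by (simp add: field_simps)
  show "\<theta>2 < 1" unfolding \<theta>2_def using den_pos p by (simp add: field_simps)
  show "0 < \<delta>" unfolding \<delta>_def using p q by simp
  show "\<theta>2 \<le> \<delta>" unfolding \<theta>2_def \<delta>_def using p q by (intro divide_left_mono) (auto intro: mult_pos_pos den_pos)
qed

abbreviation "th \<equiv> theta V E T B p q"

lemma theta_eq:
  assumes "e \<in> E" "\<omega> \<subseteq> E"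
  shows "th \<omega> e = (if joined (\<omega> - {e}) e then \<theta>1 else \<theta>2)"
proof -
  define Z where "Z = (\<Sum>\<eta>\<in>Pow E. weight \<eta>)"
  have Z: "Z > 0" unfolding Z_def using finE by (intro sum_pos) (auto simp: weight_pos)
  define w where "w = weight (insert e \<omega>)"
  define s where "s = (if joined (\<omega> - {e}) e then 1 else q)"
  have w: "w > 0" unfolding w_def by (rule weight_pos)
  have sp: "s > 0" using q by (simp add: s_def)
  have w0: "weight (\<omega> - {e}) = w * ((1 - p) / p) * s"
    unfolding w_def s_def by (rule weight_remove[OF assms])
  have d: "p + s * (1 - p) > 0" using p sp by (simp add: add_pos_pos)
  have "th \<omega> e = (w * ((1 - p) / p) * s / Z) / (w / Z + w * ((1 - p) / p) * s / Z)"
    unfolding theta_def fk_measure_def Z_def[symmetric] w0 w_def[symmetric] ..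
  also have "\<dots> = (w / (Z * p) * (s * (1 - p))) / (w / (Z * p) * (p + s * (1 - p)))"
    using w Z p by (simp add: field_simps)
  also have "\<dots> = s * (1 - p) / (p + s * (1 - p))"
    using w Z p by (subst mult_divide_mult_cancel_left) auto
  finally show ?thesis by (simp add: s_def \<theta>1_def \<theta>2_def)
qed

lemma theta_le: "e \<in> E \<Longrightarrow> \<omega> \<subseteq> E \<Longrightarrow> th \<omega> e \<le> \<theta>2"
  using theta_bounds by (simp add: theta_eq)

text \<open>More open edges join more endpoints, and \<open>\<theta>1 \<le> \<theta>2\<close>
  because q >= 1. This is what preserves \<open>Y \<subseteq> X\<close> in the coupling.\<close>

lemma theta_antimono:
  assumes "e \<in> E" "Y \<subseteq> X" "X \<subseteq> E"
  shows "th X e \<le> th Y e"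
proof -
  have "joined (Y - {e}) e \<Longrightarrow> joined (X - {e}) e" by (rule joined_mono) (use assms in auto)
  then show ?thesis using assms theta_bounds by (auto simp: theta_eq)
qed

lemma weight_open:
  assumes "finite S" "S \<subseteq> E" "y \<subseteq> E" "y \<inter> S = {}"
  shows "weight y \<le> \<delta> ^ card S * weight (y \<union> S)"
  using assms
proof (induction S rule: finite_induct)
  case (insert a S)
  have "weight y \<le> \<delta> ^ card S * weight (y \<union> S)" using insert by auto
  also have "weight (y \<union> S) \<le> \<delta> * weight (y \<union> insert a S)"
  proof -
    have eq: "(y \<union> S) - {a} = y \<union> S" "insert a (y \<union> S) = y \<union> insert a S" using insert by auto
    have "weight (y \<union> S) = weight (y \<union> insert a S) * ((1 - p) / p) * (if joined (y \<union> S) a then 1 else q)"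
      using weight_remove[of a "y \<union> S"] insert.prems unfolding eq by auto
    also have "\<dots> \<le> weight (y \<union> insert a S) * ((1 - p) / p) * q"
      using q p weight_pos[of "y \<union> insert a S"] by (intro mult_left_mono) auto
    finally show ?thesis by (simp add: \<delta>_def mult_ac)
  qed
  also have "\<delta> ^ card S * (\<delta> * weight (y \<union> insert a S)) = \<delta> ^ card (insert a S) * weight (y \<union> insert a S)"
    using insert.hyps by simp
  finally show ?case using theta_bounds(4) by simp
qed simp

definition "YS = {y. y \<subseteq> E \<and> \<not> connects y T B}"

lemma finYS: "finite YS"
  by (rule finite_subset[of _ "Pow E"]) (auto simp: YS_def finE)

lemma empty_YS: "{} \<in> YS"
proof -
  have "open_rel ({} :: ('d \<Rightarrow> int) set set) = {}" by (auto simp: open_rel_def)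
  then show ?thesis using TB_disj by (auto simp: YS_def connects_def)
qed

definition "cond_fk y = weight y / (\<Sum>z\<in>YS. weight z)"

lemma cond_Z_pos: "0 < (\<Sum>z\<in>YS. weight z)"
  using finYS empty_YS weight_pos by (intro sum_pos) auto

lemma cond_fk_pos: "0 < cond_fk y"
  unfolding cond_fk_def using cond_Z_pos weight_pos by simp

lemma cond_fk_sum: "(\<Sum>y\<in>YS. cond_fk y) = 1"
  unfolding cond_fk_def sum_divide_distrib[symmetric] using cond_Z_pos by simp

abbreviation "piv \<equiv> pivotal E T B"

definition "closed_np y = E - y - piv y"

lemma piv_iff:
  assumes "y \<in> YS" "{u, v} \<in> E"
  shows "{u, v} \<in> piv y \<longleftrightarrow>
    (u \<in> reach y T \<and> v \<in> reach y B) \<or> (v \<in> reach y T \<and> u \<in> reach y B)"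
  using connects_insert_iff[of y T B u v] assms by (simp add: pivotal_def YS_def)

lemma piv_closed: "y \<in> YS \<Longrightarrow> a \<in> piv y \<Longrightarrow> a \<notin> y"
  by (auto simp: pivotal_def YS_def insert_absorb)

text \<open>The edges of \<open>S\<close> without endpoint in the cluster of \<open>B\<close> can be opened simultaneously without
  connecting \<open>T\<close> to \<open>B\<close>, and so can the others, which have no endpoint in the cluster of \<open>T\<close>.\<close>

lemma closed_np_half_openable:
  assumes "y \<in> YS" "S \<subseteq> closed_np y"
  shows "\<exists>S'\<subseteq>S. card S \<le> 2 * card S' \<and> y \<union> S' \<in> YS"
proof -
  define S1 where "S1 = {a \<in> S. a \<inter> reach y B = {}}"
  define S2 where "S2 = S - S1"
  have yE: "y \<subseteq> E" "\<not> connects y T B" using assms by (auto simp: YS_def)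
  have SE: "S \<subseteq> E" using assms(2) by (auto simp: closed_np_def)
  have finS: "finite S" using SE finE by (rule finite_subset)
  have disj: "reach y T \<inter> reach y B = {}" using yE connects_iff_reach by blast
  have S2: "a \<inter> reach y T = {}" if "a \<in> S2" for a
  proof -
    have aE: "a \<in> E" "a \<notin> piv y" using that assms(2) by (auto simp: S2_def closed_np_def)
    obtain u v where uv: "a = {u, v}" using aE by (auto simp: E_eq elim: lattice_edgeE)
    have "u \<in> reach y B \<or> v \<in> reach y B" using that uv by (auto simp: S2_def S1_def)
    moreover have "\<not> ((u \<in> reach y T \<and> v \<in> reach y B) \<or> (v \<in> reach y T \<and> u \<in> reach y B))"
      using piv_iff[OF assms(1)] aE uv by blast
    ultimately show ?thesis using disj uv by blast
  qed
  have ok1: "y \<union> S1 \<in> YS"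
    using not_connects_Un[OF yE(2), of S1] yE SE by (auto simp: YS_def S1_def)
  have "\<not> connects y B T" using yE(2) connects_commute[of y T B] by simp
  then have "\<not> connects (y \<union> S2) B T" by (rule not_connects_Un) (rule S2)
  then have ok2: "y \<union> S2 \<in> YS"
    using connects_commute[of "y \<union> S2" T B] yE(1) SE by (auto simp: YS_def S2_def)
  have "S1 \<union> S2 = S" by (auto simp: S1_def S2_def)
  then have "card S = card S1 + card S2"
    using card_Un_disjoint[of S1 S2] finS finite_subset[of S1 S] by (auto simp: S2_def)
  then have "card S \<le> 2 * card S1 \<or> card S \<le> 2 * card S2" by linarith
  moreover have "S1 \<subseteq> S" "S2 \<subseteq> S" by (auto simp: S1_def S2_def)
  ultimately show ?thesis using ok1 ok2 by blast
qed

text \<open>For fixed \<open>S'\<close> the map from \<open>y\<close> to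
  \<open>y \<union> S'\<close> is injective on configurations closed on \<open>S'\<close>, and the
  weight grows at least by the factor \<open>1 / \<delta>\<close> per opened edge. Only half of
  \<open>S\<close> is guaranteed to be openable, whence the square in
  \<open>\<delta> \<le> \<epsilon>\<^sup>2\<close>; the choice of \<open>S'\<close> among the
  subsets of \<open>S\<close> costs a factor 2 per edge.\<close>

lemma closed_np_prob:
  assumes "finite S" "0 \<le> \<epsilon>" "\<epsilon> \<le> 1" "\<delta> \<le> \<epsilon>\<^sup>2"
  shows "(\<Sum>y\<in>{y\<in>YS. S \<subseteq> closed_np y}. cond_fk y) \<le> (2 * \<epsilon>) ^ card S"
proof (cases "S \<subseteq> E")
  case False
  then have "{y\<in>YS. S \<subseteq> closed_np y} = {}" by (auto simp: closed_np_def)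
  then show ?thesis using assms(2) by (simp only: sum.empty) simp
next
  case SE: True
  let ?I = "{S'. S' \<subseteq> S \<and> card S \<le> 2 * card S'}"
  have finI: "finite ?I" using assms(1) by simp
  have "(\<Sum>y\<in>{y\<in>YS. S \<subseteq> closed_np y}. cond_fk y)
      \<le> (\<Sum>S'\<in>?I. \<Sum>y\<in>{y\<in>YS. y \<inter> S' = {} \<and> y \<union> S' \<in> YS}. cond_fk y)"
  proof (rule sum_union_bound[OF finYS finI])
    fix y assume y: "y \<in> YS" "S \<subseteq> closed_np y"
    then obtain S' where "S' \<subseteq> S" "card S \<le> 2 * card S'" "y \<union> S' \<in> YS"
      using closed_np_half_openable by blast
    moreover have "y \<inter> S = {}" using y(2) by (auto simp: closed_np_def)
    ultimately show "\<exists>S'\<in>?I. y \<inter> S' = {} \<and> y \<union> S' \<in> YS" by blast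
  qed (use cond_fk_pos less_imp_le in blast)
  also have "\<dots> \<le> (\<Sum>S'\<in>?I. \<epsilon> ^ card S)"
  proof (rule sum_mono)
    fix S' assume S': "S' \<in> ?I"
    have finS': "finite S'" using S' assms(1) finite_subset by blast
    let ?A = "{y\<in>YS. y \<inter> S' = {} \<and> y \<union> S' \<in> YS}"
    have "(\<Sum>y\<in>?A. cond_fk y) \<le> (\<Sum>y\<in>?A. \<delta> ^ card S' * cond_fk (y \<union> S'))"
    proof (rule sum_mono)
      fix y assume "y \<in> ?A"
      then have "weight y \<le> \<delta> ^ card S' * weight (y \<union> S')"
        using finS' S' SE by (intro weight_open) (auto simp: YS_def)
      then show "cond_fk y \<le> \<delta> ^ card S' * cond_fk (y \<union> S')"
        unfolding cond_fk_def using cond_Z_pos by (simp add: divide_right_mono)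
    qed
    also have "\<dots> = \<delta> ^ card S' * (\<Sum>y\<in>?A. cond_fk (y \<union> S'))" by (simp add: sum_distrib_left)
    also have "(\<Sum>y\<in>?A. cond_fk (y \<union> S')) = (\<Sum>z\<in>(\<lambda>y. y \<union> S') ` ?A. cond_fk z)"
      by (subst sum.reindex) (auto simp: inj_on_def)
    also have "\<dots> \<le> (\<Sum>z\<in>YS. cond_fk z)"
      using finYS cond_fk_pos by (intro sum_mono2) (auto intro: less_imp_le)
    finally have "(\<Sum>y\<in>?A. cond_fk y) \<le> \<delta> ^ card S'"
      using theta_bounds(4) cond_fk_sum by simp
    also have "\<dots> \<le> (\<epsilon>\<^sup>2) ^ card S'" using assms theta_bounds(4) by (intro power_mono) auto
    also have "\<dots> = \<epsilon> ^ (2 * card S')" by (simp add: power_mult)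
    also have "\<dots> \<le> \<epsilon> ^ card S" using assms S' by (intro power_decreasing) auto
    finally show "(\<Sum>y\<in>?A. cond_fk y) \<le> \<epsilon> ^ card S" .
  qed
  also have "\<dots> = real (card ?I) * \<epsilon> ^ card S" by simp
  also have "\<dots> \<le> 2 ^ card S * \<epsilon> ^ card S"
  proof (rule mult_right_mono)
    have "card ?I \<le> card (Pow S)" using assms(1) by (intro card_mono) auto
    then have "card ?I \<le> 2 ^ card S" using assms(1) by (simp add: card_Pow)
    then have "real (card ?I) \<le> real (2 ^ card S)" by (simp only: of_nat_le_iff)
    then show "real (card ?I) \<le> 2 ^ card S" by simp
  qed (use assms in simp)
  finally show ?thesis by (simp add: power_mult_distrib)
qed

end

section \<open>Finite sequences of independent coins\<close>

fun traj :: "('c \<Rightarrow> 's \<Rightarrow> 's) \<Rightarrow> 's \<Rightarrow> (nat \<Rightarrow> 'c) \<Rightarrow> nat \<Rightarrow> 's" where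
  "traj f s \<xi> 0 = s"
| "traj f s \<xi> (Suc t) = f (\<xi> t) (traj f s \<xi> t)"

lemma traj_cong: "(\<And>i. i < t \<Longrightarrow> \<xi> i = \<xi>' i) \<Longrightarrow> traj f s \<xi> t = traj f s \<xi>' t"
  by (induction t) auto

lemma traj_fun_upd [simp]: "t \<le> n \<Longrightarrow> traj f s (\<xi>(n := c)) t = traj f s \<xi> t"
  by (rule traj_cong) auto

locale coin_weights =
  fixes C :: "'c set" and cw :: "'c \<Rightarrow> real"
  assumes finC: "finite C" and cw_nonneg: "\<And>c. c \<in> C \<Longrightarrow> 0 \<le> cw c" and cw_sum: "(\<Sum>c\<in>C. cw c) = 1"
begin

definition seqs :: "nat \<Rightarrow> (nat \<Rightarrow> 'c) set" where
  "seqs n = PiE {..<n} (\<lambda>_. C)"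

definition sw :: "nat \<Rightarrow> (nat \<Rightarrow> 'c) \<Rightarrow> real" where
  "sw n \<xi> = (\<Prod>i<n. cw (\<xi> i))"

definition expec :: "nat \<Rightarrow> ((nat \<Rightarrow> 'c) \<Rightarrow> real) \<Rightarrow> real" where
  "expec n F = (\<Sum>\<xi>\<in>seqs n. sw n \<xi> * F \<xi>)"

text \<open>The transition operator of the chain driven by the coins, acting on functions.\<close>

definition avg :: "('c \<Rightarrow> 's \<Rightarrow> 's) \<Rightarrow> ('s \<Rightarrow> real) \<Rightarrow> 's \<Rightarrow> real" where
  "avg f g s = (\<Sum>c\<in>C. cw c * g (f c s))"

lemma fin_seqs: "finite (seqs n)"
  unfolding seqs_def by (rule finite_PiE) (auto simp: finC)

lemma seqs_in: "\<xi> \<in> seqs n \<Longrightarrow> i < n \<Longrightarrow> \<xi> i \<in> C"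
  by (auto simp: seqs_def)

lemma sw_nonneg: "\<xi> \<in> seqs n \<Longrightarrow> 0 \<le> sw n \<xi>"
  unfolding sw_def by (rule prod_nonneg) (auto intro: cw_nonneg seqs_in)

lemma sw_fun_upd: "sw (Suc n) (\<xi>(n := c)) = cw c * sw n \<xi>"
  unfolding sw_def by (simp add: mult.commute)

lemma expec_Suc: "expec (Suc n) F = (\<Sum>c\<in>C. cw c * expec n (\<lambda>\<xi>. F (\<xi>(n := c))))"
proof -
  have eq: "seqs (Suc n) = (\<lambda>(c, \<xi>). \<xi>(n := c)) ` (C \<times> seqs n)"
    unfolding seqs_def lessThan_Suc by (rule PiE_insert_eq)
  have inj: "inj_on (\<lambda>(c, \<xi>). \<xi>(n := c)) (C \<times> seqs n)"
    unfolding seqs_def by (rule inj_combinator) simp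
  show ?thesis
    unfolding expec_def eq
    by (subst sum.reindex[OF inj])
      (simp add: sum.cartesian_product' sw_fun_upd sum_distrib_left mult_ac)
qed

lemma expec_Suc': "expec (Suc n) F = expec n (\<lambda>\<xi>. \<Sum>c\<in>C. cw c * F (\<xi>(n := c)))"
  unfolding expec_Suc unfolding expec_def sum_distrib_left
  by (subst sum.swap) (simp add: mult_ac)

lemma expec_prod: "expec n (\<lambda>\<xi>. \<Prod>i<n. \<phi> i (\<xi> i)) = (\<Prod>i<n. \<Sum>c\<in>C. cw c * \<phi> i c)"
  unfolding expec_def sw_def seqs_def prod.distrib[symmetric]
  by (subst prod_sum_PiE) (auto simp: finC)

lemma expec_restrict:
  assumes "\<And>\<xi> \<xi>'. (\<And>i. i < k \<Longrightarrow> \<xi> i = \<xi>' i) \<Longrightarrow> F \<xi> = F \<xi>'"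
  shows "expec (k + m) F = expec k F"
proof (induction m)
  case (Suc m)
  have "F (\<xi>(k + m := c)) = F \<xi>" for \<xi> c by (rule assms) auto
  then show ?case using Suc by (simp add: expec_Suc' sum_distrib_right[symmetric] cw_sum)
qed simp

lemma expec_traj: "expec n (\<lambda>\<xi>. g (traj f s \<xi> n)) = (avg f ^^ n) g s"
proof (induction n arbitrary: g)
  case (Suc n)
  show ?case by (simp add: expec_Suc' funpow_swap1 avg_def[symmetric] Suc)
qed (simp add: expec_def seqs_def sw_def)

text \<open>The Markov property at time \<open>a\<close>, which lets stationarity and reversibility
  act on events that involve two times.\<close>

lemma expec_traj2:
  "expec (a + b) (\<lambda>\<xi>. g (traj f s \<xi> a) * h (traj f s \<xi> (a + b)))
    = (avg f ^^ a) (\<lambda>s'. g s' * (avg f ^^ b) h s') s"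
proof (induction b arbitrary: h)
  case 0
  then show ?case using expec_traj[of a "\<lambda>s'. g s' * h s'"] by simp
next
  case (Suc b)
  have "expec (a + Suc b) (\<lambda>\<xi>. g (traj f s \<xi> a) * h (traj f s \<xi> (a + Suc b)))
      = expec (a + b) (\<lambda>\<xi>. g (traj f s \<xi> a) * avg f h (traj f s \<xi> (a + b)))"
    by (simp add: expec_Suc' avg_def sum_distrib_left mult_ac)
  then show ?case using Suc by (simp add: funpow_swap1)
qed

end

section \<open>The dynamics in terms of coins\<close>

context fk_box
begin

text \<open>The function \<open>theta\<close> only takes the values \<open>\<theta>1\<close> and \<open>\<theta>2\<close>, hence the update only depends on
  which of the intervals \<open>[0, \<theta>1)\<close>, \<open>[\<theta>1, \<theta>2)\<close>, \<open>[\<theta>2, 1]\<close> contains the uniform variable.\<close>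

definition "coins = E \<times> {0, 1, 2 :: nat}"
definition kw :: "nat \<Rightarrow> real" where
  "kw k = (if k = 0 then \<theta>1 else if k = 1 then \<theta>2 - \<theta>1 else 1 - \<theta>2)"
text \<open>The left endpoint stands for its whole interval: an edge opens for \<open>u\<close> at
  least \<open>theta\<close>, and the intervals are closed on the left.\<close>

definition uval :: "nat \<Rightarrow> real" where
  "uval k = (if k = 0 then 0 else if k = 1 then \<theta>1 else \<theta>2)"
definition "cw c = kw (snd c) / real (card E)"

abbreviation "N \<equiv> card E"

lemma N_pos: "0 < N"
  using finE E_ne by (simp add: card_gt_0_iff)

lemma kw_nonneg: "0 \<le> kw k"
  using theta_bounds by (simp add: kw_def)

lemma sum_coins: "(\<Sum>c\<in>coins. cw c * F c)
    = (\<Sum>e\<in>E. (\<theta>1 * F (e, 0) + (\<theta>2 - \<theta>1) * F (e, 1) + (1 - \<theta>2) * F (e, 2)) / N)"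
  unfolding coins_def sum.cartesian_product'
  by (simp add: cw_def kw_def add_divide_distrib add.assoc)

sublocale coin_weights coins cw
proof
  show "finite coins" by (simp add: coins_def finE)
  show "0 \<le> cw c" for c using kw_nonneg by (simp add: cw_def)
  show "(\<Sum>c\<in>coins. cw c) = 1"
    using sum_coins[of "\<lambda>_. 1"] N_pos by simp
qed

definition "cstep c = coupled_step V E T B p q (fst c) (uval (snd c))"
definition "ystep c y = (if uval (snd c) \<ge> th y (fst c) \<and> \<not> connects (insert (fst c) y) T B
  then insert (fst c) y else y - {fst c})"

lemma snd_cstep: "snd (cstep c s) = ystep c (snd s)"
  by (simp add: cstep_def coupled_step_def ystep_def Let_def)

lemma fst_cstep: "fst (cstep c s) =
    (if uval (snd c) \<ge> th (fst s) (fst c) then insert (fst c) (fst s) else fst s - {fst c})"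
  by (simp add: cstep_def coupled_step_def Let_def)

lemma ystep_YS:
  assumes "y \<in> YS" "c \<in> coins"
  shows "ystep c y \<in> YS"
  using assms connects_mono[of "y - {fst c}" y T B] by (auto simp: YS_def ystep_def coins_def)

abbreviation "CS \<equiv> coupled_states E T B"

lemma fin_CS: "finite CS"
  by (rule finite_subset[of _ "Pow E \<times> Pow E"]) (auto simp: coupled_states_def finE)

lemma CS_YS: "s \<in> CS \<Longrightarrow> snd s \<in> YS"
  by (auto simp: coupled_states_def YS_def)

lemma cstep_CS:
  assumes "s \<in> CS" "c \<in> coins"
  shows "cstep c s \<in> CS"
proof -
  have s: "fst s \<subseteq> E" "snd s \<subseteq> fst s" using assms by (auto simp: coupled_states_def)
  have e: "fst c \<in> E" using assms by (auto simp: coins_def)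
  have th: "th (fst s) (fst c) \<le> th (snd s) (fst c)" by (rule theta_antimono[OF e s(2,1)])
  have "snd (cstep c s) \<in> YS" using ystep_YS[OF CS_YS] assms by (simp add: snd_cstep)
  moreover have "snd (cstep c s) \<subseteq> fst (cstep c s)"
    unfolding snd_cstep fst_cstep ystep_def using s th by auto
  moreover have "fst (cstep c s) \<subseteq> E" unfolding fst_cstep using s e by auto
  ultimately show ?thesis by (auto simp: coupled_states_def YS_def split: prod.splits)
qed

lemma uval_cases:
  assumes "e \<in> E" "\<omega> \<subseteq> E"
  shows "0 \<le> u \<Longrightarrow> u < \<theta>1 \<Longrightarrow> (u \<ge> th \<omega> e) = (uval 0 \<ge> th \<omega> e)"
    and "\<theta>1 \<le> u \<Longrightarrow> u < \<theta>2 \<Longrightarrow> (u \<ge> th \<omega> e) = (uval 1 \<ge> th \<omega> e)"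
    and "\<theta>2 \<le> u \<Longrightarrow> (u \<ge> th \<omega> e) = (uval 2 \<ge> th \<omega> e)"
  using theta_bounds by (auto simp: theta_eq[OF assms] uval_def)

lemma coupled_kernel_coins:
  assumes "s \<in> CS"
  shows "coupled_kernel V E T B p q s s' = (\<Sum>c\<in>coins. cw c * of_bool (cstep c s = s'))"
proof -
  have s: "fst s \<subseteq> E" "snd s \<subseteq> E" using assms by (auto simp: coupled_states_def)
  have "measure lborel {u \<in> {0..1}. coupled_step V E T B p q e u s = s'}
      = \<theta>1 * of_bool (cstep (e, 0) s = s') + (\<theta>2 - \<theta>1) * of_bool (cstep (e, 1) s = s')
        + (1 - \<theta>2) * of_bool (cstep (e, 2) s = s')" if e: "e \<in> E" for e
  proof -
    have same: "coupled_step V E T B p q e u s = cstep (e, k) s"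
      if "(u \<ge> th (fst s) e) = (uval k \<ge> th (fst s) e)" "(u \<ge> th (snd s) e) = (uval k \<ge> th (snd s) e)"
      for u k using that unfolding cstep_def coupled_step_def Let_def by simp
    let ?A = "\<lambda>k (S :: real set). if cstep (e, k) s = s' then S else {}"
    have eq: "{u \<in> {0..1}. coupled_step V E T B p q e u s = s'}
        = (?A 0 {0..<\<theta>1} \<union> ?A 1 {\<theta>1..<\<theta>2}) \<union> ?A 2 {\<theta>2..1}" (is "?L = ?R")
    proof (rule set_eqI)
      fix u
      consider "u < 0 \<or> u > 1" | "0 \<le> u" "u < \<theta>1" | "\<theta>1 \<le> u" "u < \<theta>2" | "\<theta>2 \<le> u" "u \<le> 1" by linarith
      then show "u \<in> ?L \<longleftrightarrow> u \<in> ?R"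
      proof cases
        case 1 then show ?thesis using theta_bounds by auto
      next
        case 2
        then have "coupled_step V E T B p q e u s = cstep (e, 0) s"
          by (intro same) (use uval_cases(1)[OF e] s in blast)+
        then show ?thesis using 2 theta_bounds by auto
      next
        case 3
        then have "coupled_step V E T B p q e u s = cstep (e, 1) s"
          by (intro same) (use uval_cases(2)[OF e] s in blast)+
        then show ?thesis using 3 theta_bounds by auto
      next
        case 4
        then have "coupled_step V E T B p q e u s = cstep (e, 2) s"
          by (intro same) (use uval_cases(3)[OF e] s in blast)+
        then show ?thesis using 4 theta_bounds by auto
      qed
    qed
    have m: "?A k S \<in> fmeasurable lborel" if "S \<in> fmeasurable lborel" for k S
      using that by auto
    have fm: "{0..<\<theta>1} \<in> fmeasurable lborel" "{\<theta>1..<\<theta>2} \<in> fmeasurable lborel" "{\<theta>2..1} \<in> fmeasurable lborel"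
      using theta_bounds by (auto simp: fmeasurable_def)
    have mm: "measure lborel (?A k S) = measure lborel S * of_bool (cstep (e, k) s = s')" for k S by simp
    have "measure lborel ?R = measure lborel (?A 0 {0..<\<theta>1} \<union> ?A 1 {\<theta>1..<\<theta>2}) + measure lborel (?A 2 {\<theta>2..1})"
      by (rule measure_Un_AE[OF _ fmeasurable.Un[OF m[OF fm(1)] m[OF fm(2)]] m[OF fm(3)]])
        (rule AE_I2, use theta_bounds in auto)
    also have "measure lborel (?A 0 {0..<\<theta>1} \<union> ?A 1 {\<theta>1..<\<theta>2})
        = measure lborel (?A 0 {0..<\<theta>1}) + measure lborel (?A 1 {\<theta>1..<\<theta>2})"
      by (rule measure_Un_AE[OF _ m[OF fm(1)] m[OF fm(2)]]) (rule AE_I2, use theta_bounds in auto)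
    finally show ?thesis unfolding eq mm using theta_bounds by simp
  qed
  then show ?thesis
    unfolding coupled_kernel_def sum_coins by (simp add: sum_divide_distrib)
qed

section \<open>Stationarity, reversibility and the law of \<open>Y\<close>\<close>

lemma stationary_avg:
  assumes st: "stationary_dist V E T B p q \<mu>"
  shows "(\<Sum>s\<in>CS. \<mu> s * avg cstep g s) = (\<Sum>s\<in>CS. \<mu> s * g s)"
proof -
  have inv: "(\<Sum>s\<in>CS. \<mu> s * coupled_kernel V E T B p q s s') = \<mu> s'" if "s' \<in> CS" for s'
    using st that unfolding stationary_dist_def by presburger
  have "(\<Sum>s\<in>CS. \<mu> s * avg cstep g s)
      = (\<Sum>s\<in>CS. \<mu> s * (\<Sum>c\<in>coins. cw c * (\<Sum>s'\<in>CS. of_bool (cstep c s = s') * g s')))"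
    unfolding avg_def
  proof (intro sum.cong refl arg_cong2[where f = "(*)"])
    fix s c assume "s \<in> CS" "c \<in> coins"
    then have "cstep c s \<in> CS" by (rule cstep_CS)
    then show "g (cstep c s) = (\<Sum>s'\<in>CS. of_bool (cstep c s = s') * g s')"
      using fin_CS by (simp add: of_bool_def if_distrib if_distribR cong: if_cong)
  qed
  also have "\<dots> = (\<Sum>s\<in>CS. \<Sum>s'\<in>CS. \<mu> s * ((\<Sum>c\<in>coins. cw c * of_bool (cstep c s = s')) * g s'))"
    by (simp add: sum_distrib_left sum_distrib_right mult.assoc) (simp add: sum.swap[of _ coins CS])
  also have "\<dots> = (\<Sum>s\<in>CS. \<Sum>s'\<in>CS. \<mu> s * (coupled_kernel V E T B p q s s' * g s'))"
    by (simp add: coupled_kernel_coins)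
  also have "\<dots> = (\<Sum>s'\<in>CS. (\<Sum>s\<in>CS. \<mu> s * coupled_kernel V E T B p q s s') * g s')"
    by (subst sum.swap) (simp add: sum_distrib_right mult.assoc)
  also have "\<dots> = (\<Sum>s'\<in>CS. \<mu> s' * g s')"
    by (intro sum.cong refl) (simp add: inv)
  finally show ?thesis .
qed

lemma stationary_avg_pow:
  assumes "stationary_dist V E T B p q \<mu>"
  shows "(\<Sum>s\<in>CS. \<mu> s * (avg cstep ^^ n) g s) = (\<Sum>s\<in>CS. \<mu> s * g s)"
  by (induction n) (use stationary_avg[OF assms] in simp_all)

lemma avg_snd: "(avg cstep ^^ n) (\<lambda>s. g (snd s)) = (\<lambda>s. (avg ystep ^^ n) g (snd s))"
proof (induction n)
  case (Suc n)
  have "avg cstep (\<lambda>s. h (snd s)) = (\<lambda>s. avg ystep h (snd s))" for h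
    by (rule ext) (simp add: avg_def snd_cstep)
  then show ?case by (simp add: Suc)
qed simp

lemma theta_balance:
  assumes "e \<in> E" "\<omega> \<subseteq> E"
  shows "weight (insert e \<omega>) * th \<omega> e = weight (\<omega> - {e}) * (1 - th \<omega> e)"
proof -
  define Z where "Z = (\<Sum>\<eta>\<in>Pow E. weight \<eta>)"
  have Z: "Z > 0" unfolding Z_def using finE by (intro sum_pos) (auto simp: weight_pos)
  define a where "a = weight (insert e \<omega>)"
  define b where "b = weight (\<omega> - {e})"
  have ab: "a > 0" "b > 0" by (simp_all add: a_def b_def weight_pos)
  have "th \<omega> e = (b / Z) / (a / Z + b / Z)"
    unfolding theta_def fk_measure_def Z_def a_def b_def ..
  also have "\<dots> = b / (a + b)" using Z ab by (simp add: field_simps)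
  finally have t: "th \<omega> e = b / (a + b)" .
  show ?thesis unfolding a_def[symmetric] b_def[symmetric] t using ab by (simp add: field_simps)
qed

lemma theta_remove: "th (\<omega> - {e}) e = th \<omega> e"
  by (simp add: theta_def)

definition "edge_avg g y e = \<theta>1 * g (ystep (e, 0) y) + (\<theta>2 - \<theta>1) * g (ystep (e, 1) y)
  + (1 - \<theta>2) * g (ystep (e, 2) y)"

lemma edge_avg_eq:
  assumes "e \<in> E" "y \<subseteq> E"
  shows "edge_avg g y e = (if connects (insert e y) T B then g (y - {e})
    else th y e * g (y - {e}) + (1 - th y e) * g (insert e y))"
  using theta_bounds(1-3)
  by (auto simp: edge_avg_def ystep_def uval_def theta_eq[OF assms] algebra_simps)

lemma avg_ystep_eq: "avg ystep g y = (\<Sum>e\<in>E. edge_avg g y e) / N"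
  unfolding avg_def sum_coins edge_avg_def by (simp add: sum_divide_distrib)

text \<open>Detailed balance for the update of a single edge. A refused opening leaves a
  configuration of \<open>YS\<close> as it is, so the only moves are between \<open>y\<close> and
  \<open>y - {e}\<close> with both in \<open>YS\<close>, where \<open>theta_balance\<close>
  applies.\<close>

lemma edge_avg_self_adjoint:
  assumes e: "e \<in> E"
  shows "(\<Sum>y\<in>YS. cond_fk y * (f y * edge_avg g y e)) = (\<Sum>y\<in>YS. cond_fk y * (edge_avg f y e * g y))"
proof -
  define K where "K y y' = edge_avg (\<lambda>z. of_bool (z = y')) y e" for y y'
  have inYS: "ystep (e, k) y \<in> YS" if "y \<in> YS" "k \<in> {0, 1, 2}" for y k
    using that e by (intro ystep_YS) (auto simp: coins_def)
  have expand: "edge_avg g y e = (\<Sum>y'\<in>YS. K y y' * g y')" if "y \<in> YS" for g y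
  proof -
    have pick: "g z = (\<Sum>y'\<in>YS. of_bool (z = y') * g y')" if "z \<in> YS" for z
      using that finYS by (simp add: of_bool_def if_distrib if_distribR cong: if_cong)
    show ?thesis
      unfolding K_def edge_avg_def
      by (subst pick[OF inYS[OF that, of 0]], simp, subst pick[OF inYS[OF that, of 1]], simp,
          subst pick[OF inYS[OF that, of 2]], simp)
        (simp add: sum_distrib_left sum.distrib[symmetric] algebra_simps)
  qed
  have bal1: "cond_fk y * K y y' = cond_fk y' * K y' y" if y: "y \<in> YS" "e \<in> y" and y': "y' = y - {e}" for y y'
  proof -
    have yE: "y \<subseteq> E" "\<not> connects y T B" using y by (auto simp: YS_def)
    have ins: "insert e y = y" "insert e y' = y" "y' - {e} = y'" using y(2) y' by auto
    have ne: "y' \<noteq> y" "y \<noteq> y'" using y(2) y' by auto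
    have y'E: "y' \<subseteq> E" using yE(1) y' by auto
    have "K y y' = th y e"
      unfolding K_def edge_avg_eq[OF e yE(1)] ins y'[symmetric] using yE(2) ne by simp
    moreover have "K y' y = 1 - th y' e"
      unfolding K_def edge_avg_eq[OF e y'E] ins using yE(2) ne by simp
    moreover have "th y' e = th y e" unfolding y' by (rule theta_remove)
    moreover have "cond_fk y * th y e = cond_fk y' * (1 - th y e)"
    proof -
      have "weight y * th y e = weight y' * (1 - th y e)"
        using theta_balance[OF e yE(1)] unfolding ins y'[symmetric] .
      then show ?thesis unfolding cond_fk_def times_divide_eq_left by (simp only:)
    qed
    ultimately show ?thesis by simp
  qed
  have bal: "cond_fk y * K y y' = cond_fk y' * K y' y" if y: "y \<in> YS" "y' \<in> YS" for y y'
  proof -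
    consider "y = y'" | "e \<in> y" "y' = y - {e}" | "e \<in> y'" "y = y' - {e}"
      | "y \<noteq> y'" "\<not> (e \<in> y \<and> y' = y - {e})" "\<not> (e \<in> y' \<and> y = y' - {e})" by blast
    then show ?thesis
    proof cases
      case 2 then show ?thesis using bal1 y by blast
    next
      case 3 then show ?thesis using bal1[of y' y] y by simp
    next
      case 4
      have yE: "y \<subseteq> E" "y' \<subseteq> E" using y by (auto simp: YS_def)
      have "y - {e} \<noteq> y'" using 4(1,2) by (cases "e \<in> y") auto
      moreover have "insert e y \<noteq> y'" using 4(1,3) by (cases "e \<in> y") (auto simp: insert_absorb)
      moreover have "y' - {e} \<noteq> y" using 4(1,3) by (cases "e \<in> y'") auto
      moreover have "insert e y' \<noteq> y" using 4(1,2) by (cases "e \<in> y'") (auto simp: insert_absorb)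
      ultimately have "K y y' = 0" "K y' y = 0"
        unfolding K_def edge_avg_eq[OF e yE(1)] edge_avg_eq[OF e yE(2)] by auto
      then show ?thesis by simp
    qed simp
  qed
  have "(\<Sum>y\<in>YS. cond_fk y * (f y * edge_avg g y e)) = (\<Sum>y\<in>YS. \<Sum>y'\<in>YS. cond_fk y * K y y' * (f y * g y'))"
    by (intro sum.cong refl) (simp add: expand sum_distrib_left mult_ac)
  also have "\<dots> = (\<Sum>y\<in>YS. \<Sum>y'\<in>YS. cond_fk y' * K y' y * (f y * g y'))"
    by (intro sum.cong refl) (simp add: bal)
  also have "\<dots> = (\<Sum>y'\<in>YS. \<Sum>y\<in>YS. cond_fk y' * K y' y * (f y * g y'))" by (rule sum.swap)
  also have "\<dots> = (\<Sum>y'\<in>YS. cond_fk y' * (edge_avg f y' e * g y'))"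
    by (intro sum.cong refl) (simp add: expand sum_distrib_left sum_distrib_right mult_ac)
  finally show ?thesis .
qed

lemma avg_ystep_self_adjoint:
  "(\<Sum>y\<in>YS. cond_fk y * (f y * avg ystep g y)) = (\<Sum>y\<in>YS. cond_fk y * (avg ystep f y * g y))"
proof -
  have "(\<Sum>y\<in>YS. cond_fk y * (f y * avg ystep g y))
      = (\<Sum>e\<in>E. \<Sum>y\<in>YS. cond_fk y * (f y * edge_avg g y e)) / N"
    unfolding avg_ystep_eq
    by (subst sum.swap) (simp add: sum_distrib_left sum_divide_distrib)
  also have "\<dots> = (\<Sum>e\<in>E. \<Sum>y\<in>YS. cond_fk y * (edge_avg f y e * g y)) / N"
    by (simp add: edge_avg_self_adjoint)
  also have "\<dots> = (\<Sum>y\<in>YS. cond_fk y * (avg ystep f y * g y))"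
    unfolding avg_ystep_eq
    by (subst sum.swap) (simp add: sum_distrib_left sum_distrib_right sum_divide_distrib)
  finally show ?thesis .
qed

lemma avg_ystep_pow_self_adjoint:
  "(\<Sum>y\<in>YS. cond_fk y * (f y * (avg ystep ^^ n) g y)) = (\<Sum>y\<in>YS. cond_fk y * ((avg ystep ^^ n) f y * g y))"
proof (induction n arbitrary: g)
  case (Suc n)
  have "(\<Sum>y\<in>YS. cond_fk y * (f y * (avg ystep ^^ Suc n) g y))
      = (\<Sum>y\<in>YS. cond_fk y * (f y * (avg ystep ^^ n) (avg ystep g) y))"
    by (simp add: funpow_swap1)
  also have "\<dots> = (\<Sum>y\<in>YS. cond_fk y * ((avg ystep ^^ n) f y * avg ystep g y))" by (rule Suc)
  also have "\<dots> = (\<Sum>y\<in>YS. cond_fk y * ((avg ystep ^^ Suc n) f y * g y))"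
    by (simp add: avg_ystep_self_adjoint)
  finally show ?case .
qed simp

lemma ystep_close: "e \<in> E \<Longrightarrow> y \<subseteq> E \<Longrightarrow> ystep (e, 0) y = y - {e}"
  using theta_bounds by (auto simp: ystep_def uval_def theta_eq)

text \<open>Maximum principle: the coin \<open>(e, 0)\<close> always closes \<open>e\<close> and has
  positive weight, so a maximum propagates along closings down to \<open>{}\<close>. Applied to
  \<open>h\<close> and to \<open>- h\<close> this shows that harmonic functions are
  constant.\<close>

lemma harmonic_le_empty:
  assumes h: "\<And>y. y \<in> YS \<Longrightarrow> avg ystep h y = h y"
  assumes "y \<in> YS"
  shows "h y \<le> h {}"
proof -
  define M where "M = Max (h ` YS)"
  have le: "h z \<le> M" if "z \<in> YS" for z unfolding M_def using finYS that by simp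
  have "h {} = M" if "z \<in> YS" "h z = M" for z
    using that
  proof (induction "card z" arbitrary: z rule: less_induct)
    case less
    show ?case
    proof (cases "z = {}")
      case True then show ?thesis using less.prems by simp
    next
      case False
      then obtain e where ez: "e \<in> z" by blast
      have zE: "z \<subseteq> E" using less.prems by (simp add: YS_def)
      then have eE: "e \<in> E" using ez by blast
      have c0: "(e, 0) \<in> coins" using eE by (simp add: coins_def)
      have st: "ystep (e, 0) z = z - {e}" by (rule ystep_close[OF eE zE])
      have ze: "z - {e} \<in> YS" using ystep_YS[OF less.prems(1) c0] st by simp
      have "h (z - {e}) = M"
      proof (rule ccontr)
        assume "h (z - {e}) \<noteq> M"
        then have lt: "h (z - {e}) < M" using le[OF ze] by simp
        have "avg ystep h z < (\<Sum>c\<in>coins. cw c * M)"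
          unfolding avg_def
        proof (rule sum_strict_mono_ex1[OF finC])
          show "\<forall>c\<in>coins. cw c * h (ystep c z) \<le> cw c * M"
            using cw_nonneg le ystep_YS[OF less.prems(1)] by (auto intro: mult_left_mono)
          show "\<exists>c\<in>coins. cw c * h (ystep c z) < cw c * M"
          proof
            have "cw (e, 0) > 0" using theta_bounds N_pos by (simp add: cw_def kw_def)
            then show "cw (e, 0) * h (ystep (e, 0) z) < cw (e, 0) * M" using lt st by simp
          qed (rule c0)
        qed
        also have "\<dots> = M" by (simp add: sum_distrib_right[symmetric] cw_sum)
        finally show False using h[OF less.prems(1)] less.prems(2) by simp
      qed
      moreover have "card (z - {e}) < card z"
        using ez zE finE by (meson card_Diff1_less finite_subset)
      ultimately show ?thesis using less.hyps ze by blast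
    qed
  qed
  moreover have "M \<in> h ` YS" unfolding M_def using finYS assms(2) by (intro Max_in) auto
  ultimately have "h {} = M" by auto
  then show ?thesis using le[OF assms(2)] by simp
qed

text \<open>The density \<open>h\<close> of the second marginal of \<open>\<mu>\<close> with respect
  to \<open>cond_fk\<close> is harmonic, by invariance of the marginal and self-adjointness of the
  operator, hence constant. It gives access to the law of \<open>Y\<close> although
  \<open>\<mu>\<close> itself is not explicit.\<close>

lemma Y_marginal:
  assumes st: "stationary_dist V E T B p q \<mu>"
  shows "(\<Sum>s\<in>CS. \<mu> s * g (snd s)) = (\<Sum>y\<in>YS. cond_fk y * g y)"
proof -
  define \<nu> where "\<nu> y = (\<Sum>s\<in>{s\<in>CS. snd s = y}. \<mu> s)" for y
  have push: "(\<Sum>s\<in>CS. \<mu> s * g (snd s)) = (\<Sum>y\<in>YS. \<nu> y * g y)" for g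
  proof -
    have "(\<Sum>y\<in>YS. \<nu> y * g y) = (\<Sum>y\<in>YS. \<Sum>s\<in>{s\<in>CS. snd s = y}. \<mu> s * g (snd s))"
      unfolding \<nu>_def by (simp add: sum_distrib_right)
    also have "\<dots> = (\<Sum>s\<in>CS. \<mu> s * g (snd s))"
      by (rule sum.group[OF fin_CS finYS]) (use CS_YS in auto)
    finally show ?thesis by simp
  qed
  define h where "h y = \<nu> y / cond_fk y" for y
  have nuh: "\<nu> y = cond_fk y * h y" for y using cond_fk_pos[of y] by (simp add: h_def)
  have harm: "avg ystep h y' = h y'" if y': "y' \<in> YS" for y'
  proof -
    have "(\<Sum>y\<in>YS. cond_fk y * (avg ystep h y * of_bool (y = y')))
        = (\<Sum>y\<in>YS. cond_fk y * (h y * avg ystep (\<lambda>z. of_bool (z = y')) y))"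
      by (rule avg_ystep_self_adjoint[symmetric])
    also have "\<dots> = (\<Sum>s\<in>CS. \<mu> s * avg ystep (\<lambda>z. of_bool (z = y')) (snd s))"
      by (simp add: push nuh mult.assoc)
    also have "\<dots> = (\<Sum>s\<in>CS. \<mu> s * avg cstep (\<lambda>s. of_bool (snd s = y')) s)"
      using avg_snd[of 1 "\<lambda>z. of_bool (z = y')"] by simp
    also have "\<dots> = (\<Sum>s\<in>CS. \<mu> s * of_bool (snd s = y'))" by (rule stationary_avg[OF st])
    also have "\<dots> = (\<Sum>y\<in>YS. \<nu> y * of_bool (y = y'))" by (rule push)
    finally have "cond_fk y' * avg ystep h y' = cond_fk y' * h y'"
      using y' finYS by (simp add: nuh of_bool_def if_distrib cong: if_cong)
    then show ?thesis using cond_fk_pos[of y'] by simp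
  qed
  have "avg ystep (\<lambda>y. - h y) y = - h y" if "y \<in> YS" for y
    using harm[OF that] by (simp add: avg_def sum_negf)
  then have "h y = h {}" if "y \<in> YS" for y
    using harmonic_le_empty[of h, OF harm that] harmonic_le_empty[of "\<lambda>y. - h y", OF _ that] by force
  then have nu: "\<nu> y = cond_fk y * h {}" if "y \<in> YS" for y using nuh that by simp
  have "(\<Sum>s\<in>CS. \<mu> s) = 1" using st unfolding stationary_dist_def by blast
  then have "1 = (\<Sum>s\<in>CS. \<mu> s)" by simp
  also have "\<dots> = (\<Sum>y\<in>YS. \<nu> y)" using push[of "\<lambda>_. 1"] by simp
  also have "\<dots> = h {}" by (simp add: nu sum_distrib_right[symmetric] cond_fk_sum)
  finally have "h {} = 1" by simp
  then show ?thesis by (simp add: push nu)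
qed

section \<open>Rare coin patterns\<close>

text \<open>\<open>j\<close> numbers the blocks of \<open>L\<close> consecutive times. Coins 0 and 1
  are the only ones that can close an edge which is not pivotal, while coin 2 always opens
  it.\<close>

definition "bad_coin \<xi> a j L n \<longleftrightarrow> (\<exists>i<n. i div L = j \<and> fst (\<xi> i) = a \<and> snd (\<xi> i) < (2::nat))"
definition "no_good_coin \<xi> a j L n \<longleftrightarrow> (\<forall>i<n. i div L = j \<longrightarrow> \<xi> i \<noteq> (a, 2 :: nat))"

text \<open>An exponential Markov inequality. Distinct edges compete for the same time steps, so the
  events are not independent; but the product over time of the test functions
  \<open>\<phi> i\<close> has an expectation that factorizes, and the bound is of the same form as
  for independent sites.\<close>

lemma coin_pattern_prob:
  assumes K: "0 < K" and L: "L = K * N"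
    and S1: "finite S1" "S1 \<subseteq> E \<times> UNIV" and S2: "finite S2" "S2 \<subseteq> E \<times> UNIV"
    and full: "\<And>a j. (a, j) \<in> S2 \<Longrightarrow> Suc j * L \<le> n"
  shows "(\<Sum>\<xi>\<in>{\<xi>\<in>seqs n. (\<forall>(a, j)\<in>S1. bad_coin \<xi> a j L n) \<and> (\<forall>(a, j)\<in>S2. no_good_coin \<xi> a j L n)}. sw n \<xi>)
    \<le> (3 * real K * \<delta>) ^ card S1 * exp (- ((1 - \<theta>2) * real K)) ^ card S2"
proof -
  have Lpos: "0 < L" using K L N_pos by simp
  \<comment> \<open>With this reward each site of \<open>S1\<close> adds at most
    \<open>L * M * \<theta>2 / N \<le> 1\<close> to the exponent, so the price per site is
    \<open>exp 1 / M\<close>, and \<open>exp 1 \<le> 3\<close>.\<close>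
  define M where "M = 1 / (real K * \<delta>)"
  have M: "M > 0" using K theta_bounds(4) by (simp add: M_def)
  define good where "good \<xi> \<longleftrightarrow> (\<forall>(a, j)\<in>S1. bad_coin \<xi> a j L n) \<and> (\<forall>(a, j)\<in>S2. no_good_coin \<xi> a j L n)" for \<xi>
  define \<phi> where "\<phi> i c = (if (fst c, i div L) \<in> S1 \<and> snd c < 2 then 1 + M else 1)
      * (if (fst c, i div L) \<in> S2 \<and> snd c = 2 then 0 else 1)" for i :: nat and c :: "('d \<Rightarrow> int) set \<times> nat"
  have phi_nn: "0 \<le> \<phi> i c" for i c using M by (simp add: \<phi>_def)
  \<comment> \<open>Different sites of \<open>S1\<close> are hit at different times, since the time
    determines the block and the coin the edge. Each of these factors is \<open>1 + M\<close>, and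
    the others are at least 1 because no factor 0 occurs on \<open>good\<close>.\<close>
  have ind: "M ^ card S1 \<le> (\<Prod>i<n. \<phi> i (\<xi> i))" if "\<xi> \<in> seqs n" "good \<xi>" for \<xi>
  proof -
    have "\<forall>\<sigma>\<in>S1. \<exists>i<n. i div L = snd \<sigma> \<and> fst (\<xi> i) = fst \<sigma> \<and> snd (\<xi> i) < 2"
      using that(2) by (auto simp: good_def bad_coin_def)
    then obtain I where I: "\<And>\<sigma>. \<sigma> \<in> S1 \<Longrightarrow> I \<sigma> < n \<and> I \<sigma> div L = snd \<sigma> \<and> fst (\<xi> (I \<sigma>)) = fst \<sigma> \<and> snd (\<xi> (I \<sigma>)) < 2"
      by metis
    have inj: "inj_on I S1"
      by (rule inj_onI) (metis I prod_eqI)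
    have no2: "\<not> ((fst (\<xi> i), i div L) \<in> S2 \<and> snd (\<xi> i) = 2)" if "i < n" for i
    proof
      assume a: "(fst (\<xi> i), i div L) \<in> S2 \<and> snd (\<xi> i) = 2"
      then have "no_good_coin \<xi> (fst (\<xi> i)) (i div L) L n" using \<open>good \<xi>\<close> unfolding good_def by blast
      then have "\<xi> i \<noteq> (fst (\<xi> i), 2)" using that unfolding no_good_coin_def by blast
      then show False using a by (simp add: prod_eq_iff)
    qed
    have one: "1 \<le> \<phi> i (\<xi> i)" if "i < n" for i using no2[OF that] M by (auto simp: \<phi>_def)
    have "M ^ card S1 = (\<Prod>i\<in>I ` S1. M)" by (simp add: card_image[OF inj])
    also have "\<dots> \<le> (\<Prod>i\<in>I ` S1. \<phi> i (\<xi> i))"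
    proof (rule prod_mono)
      fix i assume "i \<in> I ` S1"
      then obtain \<sigma> where \<sigma>: "\<sigma> \<in> S1" "i = I \<sigma>" by auto
      have "\<phi> i (\<xi> i) = 1 + M" using I[OF \<sigma>(1)] \<sigma> no2[of i] by (auto simp: \<phi>_def)
      then show "0 \<le> M \<and> M \<le> \<phi> i (\<xi> i)" using M by simp
    qed
    also have "\<dots> \<le> (\<Prod>i<n. \<phi> i (\<xi> i))"
      by (rule prod_mono2) (use I one phi_nn in auto)
    finally show ?thesis .
  qed
  define n1 where "n1 j = real (card {a \<in> E. (a, j) \<in> S1})" for j
  define n2 where "n2 j = real (card {a \<in> E. (a, j) \<in> S2})" for j
  have single: "(\<Sum>c\<in>coins. cw c * \<phi> i c) \<le> exp ((M * \<theta>2 * n1 (i div L) - (1 - \<theta>2) * n2 (i div L)) / N)" for i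
  proof -
    have summand: "(\<theta>1 * \<phi> i (e, 0) + (\<theta>2 - \<theta>1) * \<phi> i (e, 1) + (1 - \<theta>2) * \<phi> i (e, 2)) / N
        = (1 + M * \<theta>2 * of_bool ((e, i div L) \<in> S1) - (1 - \<theta>2) * of_bool ((e, i div L) \<in> S2)) / N" for e
      by (simp add: \<phi>_def algebra_simps)
    have n1s: "n1 j = (\<Sum>e\<in>E. of_bool ((e, j) \<in> S1))" and n2s: "n2 j = (\<Sum>e\<in>E. of_bool ((e, j) \<in> S2))" for j
      using finE by (simp_all add: n1_def n2_def of_bool_def sum.inter_filter[symmetric])
    have "(\<Sum>c\<in>coins. cw c * \<phi> i c)
        = (\<Sum>e\<in>E. (1 + M * \<theta>2 * of_bool ((e, i div L) \<in> S1) - (1 - \<theta>2) * of_bool ((e, i div L) \<in> S2)) / N)"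
      unfolding sum_coins summand ..
    also have "\<dots> = (N + M * \<theta>2 * n1 (i div L) - (1 - \<theta>2) * n2 (i div L)) / N"
      unfolding n1s n2s sum_divide_distrib[symmetric] sum_subtractf sum.distrib sum_distrib_left by simp
    also have "\<dots> = 1 + (M * \<theta>2 * n1 (i div L) - (1 - \<theta>2) * n2 (i div L)) / N"
      using N_pos by (simp add: field_simps)
    also have "\<dots> \<le> exp ((M * \<theta>2 * n1 (i div L) - (1 - \<theta>2) * n2 (i div L)) / N)" by (rule exp_ge_add_one_self)
    finally show ?thesis .
  qed
  have count: "(\<Sum>i<n. real (card {a \<in> E. (a, i div L) \<in> S})) = (\<Sum>\<sigma>\<in>S. real (card {i. i < n \<and> i div L = snd \<sigma>}))"
    if S: "finite S" "S \<subseteq> E \<times> UNIV" for S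
  proof -
    have "real (card {a \<in> E. (a, i div L) \<in> S}) = (\<Sum>\<sigma>\<in>S. of_bool (i div L = snd \<sigma>))" for i
    proof -
      have "{a \<in> E. (a, i div L) \<in> S} = fst ` {\<sigma>\<in>S. i div L = snd \<sigma>}" using S(2) by force
      moreover have "inj_on fst {\<sigma>\<in>S. i div L = snd \<sigma>}" by (rule inj_onI) (auto simp: prod_eq_iff)
      ultimately have "card {a \<in> E. (a, i div L) \<in> S} = card {\<sigma>\<in>S. i div L = snd \<sigma>}" by (simp add: card_image)
      then show ?thesis using S(1) by (simp add: of_bool_def sum.inter_filter[symmetric])
    qed
    then have "(\<Sum>i<n. real (card {a \<in> E. (a, i div L) \<in> S})) = (\<Sum>i<n. \<Sum>\<sigma>\<in>S. of_bool (i div L = snd \<sigma>))" by simp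
    also have "\<dots> = (\<Sum>\<sigma>\<in>S. \<Sum>i<n. of_bool (i div L = snd \<sigma>))" by (rule sum.swap)
    also have "\<dots> = (\<Sum>\<sigma>\<in>S. real (card {i. i < n \<and> i div L = snd \<sigma>}))"
      by (simp add: of_bool_def sum.inter_filter[symmetric] lessThan_def)
    finally show ?thesis .
  qed
  have div_iff: "i div L = j \<longleftrightarrow> i \<in> {j * L..<Suc j * L}" for i j
  proof -
    have "i div L = j \<longleftrightarrow> j \<le> i div L \<and> i div L < Suc j" by auto
    then show ?thesis
      unfolding less_eq_div_iff_mult_less_eq[OF Lpos] div_less_iff_less_mult[OF Lpos] by simp
  qed
  have c1: "(\<Sum>i<n. n1 (i div L)) \<le> L * card S1"
  proof -
    have "card {i. i < n \<and> i div L = j} \<le> L" for j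
    proof -
      have "{i. i < n \<and> i div L = j} \<subseteq> {j * L..<Suc j * L}" using div_iff by blast
      then show ?thesis using card_mono[of "{j * L..<Suc j * L}" "{i. i < n \<and> i div L = j}"] by simp
    qed
    then have "(\<Sum>\<sigma>\<in>S1. real (card {i. i < n \<and> i div L = snd \<sigma>})) \<le> (\<Sum>\<sigma>\<in>S1. real L)"
      by (intro sum_mono) simp
    then show ?thesis unfolding n1_def count[OF S1] by (simp add: mult.commute)
  qed
  \<comment> \<open>\<open>n2\<close> enters the exponent with a minus sign, so its sum must be
    bounded from below; this is why \<open>full\<close> asks for complete blocks.\<close>
  have c2: "(\<Sum>i<n. n2 (i div L)) = L * card S2"
  proof -
    have "{i. i < n \<and> i div L = snd \<sigma>} = {snd \<sigma> * L..<Suc (snd \<sigma>) * L}" if "\<sigma> \<in> S2" for \<sigma>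
      using full[of "fst \<sigma>" "snd \<sigma>"] that unfolding div_iff by auto
    then have "(\<Sum>\<sigma>\<in>S2. real (card {i. i < n \<and> i div L = snd \<sigma>})) = (\<Sum>\<sigma>\<in>S2. real L)"
      by (intro sum.cong refl) simp
    then show ?thesis unfolding n2_def count[OF S2] by (simp add: mult.commute)
  qed
  have "(\<Sum>\<xi>\<in>{\<xi>\<in>seqs n. good \<xi>}. sw n \<xi>) * M ^ card S1 = (\<Sum>\<xi>\<in>{\<xi>\<in>seqs n. good \<xi>}. sw n \<xi> * M ^ card S1)"
    by (simp add: sum_distrib_right)
  also have "\<dots> \<le> (\<Sum>\<xi>\<in>{\<xi>\<in>seqs n. good \<xi>}. sw n \<xi> * (\<Prod>i<n. \<phi> i (\<xi> i)))"
    using ind sw_nonneg by (intro sum_mono mult_left_mono) auto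
  also have "\<dots> \<le> (\<Sum>\<xi>\<in>seqs n. sw n \<xi> * (\<Prod>i<n. \<phi> i (\<xi> i)))"
    by (intro sum_mono2 mult_nonneg_nonneg prod_nonneg sw_nonneg fin_seqs phi_nn) auto
  also have "\<dots> = (\<Prod>i<n. \<Sum>c\<in>coins. cw c * \<phi> i c)"
    using expec_prod[of n \<phi>] by (simp add: expec_def)
  also have "\<dots> \<le> (\<Prod>i<n. exp ((M * \<theta>2 * n1 (i div L) - (1 - \<theta>2) * n2 (i div L)) / N))"
    by (intro prod_mono conjI sum_nonneg mult_nonneg_nonneg cw_nonneg phi_nn single)
  also have "\<dots> = exp ((M * \<theta>2 * (\<Sum>i<n. n1 (i div L)) - (1 - \<theta>2) * (\<Sum>i<n. n2 (i div L))) / N)"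
    by (simp add: exp_sum[symmetric] sum_subtractf sum_distrib_left sum_divide_distrib diff_divide_distrib)
  also have "\<dots> \<le> exp (real (card S1) - (1 - \<theta>2) * K * card S2)"
  proof -
    have "M * \<theta>2 * (\<Sum>i<n. n1 (i div L)) \<le> M * \<delta> * (L * card S1)"
      using M theta_bounds c1 by (intro mult_mono) (auto intro!: sum_nonneg simp: n1_def)
    also have "\<dots> = N * card S1" using theta_bounds(4) K by (simp add: M_def L)
    finally have "(M * \<theta>2 * (\<Sum>i<n. n1 (i div L)) - (1 - \<theta>2) * (\<Sum>i<n. n2 (i div L))) / N
        \<le> (N * card S1 - (1 - \<theta>2) * (L * card S2)) / N"
      unfolding c2 using N_pos by (intro divide_right_mono) auto
    also have "\<dots> = card S1 - (1 - \<theta>2) * K * card S2" using N_pos by (simp add: L field_simps)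
    finally show ?thesis by simp
  qed
  also have "\<dots> = exp 1 ^ card S1 * exp (- ((1 - \<theta>2) * real K)) ^ card S2"
    by (simp add: exp_of_nat_mult[symmetric] exp_add[symmetric] algebra_simps)
  also have "\<dots> \<le> 3 ^ card S1 * exp (- ((1 - \<theta>2) * real K)) ^ card S2"
    by (intro mult_right_mono power_mono exp_le) auto
  finally have "(\<Sum>\<xi>\<in>{\<xi>\<in>seqs n. good \<xi>}. sw n \<xi>) * M ^ card S1 * (real K * \<delta>) ^ card S1
      \<le> 3 ^ card S1 * exp (- ((1 - \<theta>2) * real K)) ^ card S2 * (real K * \<delta>) ^ card S1"
    using K theta_bounds(4) by (intro mult_right_mono) auto
  moreover have "M ^ card S1 * (real K * \<delta>) ^ card S1 = 1"
    using K theta_bounds(4) by (simp add: power_mult_distrib[symmetric] M_def)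
  ultimately have "(\<Sum>\<xi>\<in>{\<xi>\<in>seqs n. good \<xi>}. sw n \<xi>)
      \<le> 3 ^ card S1 * exp (- ((1 - \<theta>2) * real K)) ^ card S2 * (real K * \<delta>) ^ card S1"
    by (simp add: mult.assoc)
  also have "\<dots> = (3 * real K * \<delta>) ^ card S1 * exp (- ((1 - \<theta>2) * real K)) ^ card S2"
    by (simp add: power_mult_distrib mult_ac)
  finally show ?thesis unfolding good_def .
qed

end

section \<open>Geometry of pivotal edges and of the interface\<close>

definition clear :: "('d::finite \<Rightarrow> int) \<Rightarrow> nat \<Rightarrow> ('d \<Rightarrow> int) set set \<Rightarrow> bool" where
  "clear x0 R F \<longleftrightarrow> (\<forall>f\<in>F. R \<le> edge_radius x0 f)"

lemma walks_star_radius: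
  "xs \<in> walks star e n \<Longrightarrow> a \<in> set xs \<Longrightarrow> edge_radius x0 a \<le> edge_radius x0 e + 2 * n"
proof (induction n arbitrary: e xs)
  case 0
  then show ?case by (simp add: walks_0)
next
  case (Suc n)
  then obtain b ys where b: "star e b" "xs = e # ys" "ys \<in> walks star b n"
    by (auto simp: walks_Suc)
  show ?case
  proof (cases "a = e")
    case False
    then have "edge_radius x0 a \<le> edge_radius x0 b + 2 * n" using Suc b by auto
    then show ?thesis using edge_radius_star[OF b(1), of x0] by simp
  qed simp
qed

context fk_box
begin

abbreviation "dead \<equiv> lattice_edges - E"

definition "y_closed y A \<longleftrightarrow> (\<forall>u v. {u, v} \<in> y \<longrightarrow> u \<in> A \<longrightarrow> v \<in> A)"

lemma E_lattice: "E \<subseteq> lattice_edges"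
  by (auto simp: E_eq)

lemma E_edgeE:
  assumes "e \<in> E"
  obtains x y where "e = {x, y}" "lattice_adj x y"
  using assms by (auto simp: E_eq elim: lattice_edgeE)

lemma in_E_of_clear: "clear x0 R dead \<Longrightarrow> f \<in> lattice_edges \<Longrightarrow> edge_radius x0 f < R \<Longrightarrow> f \<in> E"
  unfolding clear_def by (meson DiffI not_le)

text \<open>A vertex of \<open>T \<union> B\<close> has a neighbour outside \<open>V\<close> and
  hence belongs to an edge of \<open>dead\<close>.\<close>

lemma TB_outside:
  assumes "clear x0 R dead" "t \<in> T \<union> B"
  shows "R \<le> l1dist x0 t"
proof -
  obtain w where w: "lattice_adj t w" "w \<notin> V" using assms(2) TB by (auto simp: vboundary_def)
  have "{t, w} \<in> dead" using w by (auto simp: lattice_edge_iff E_eq)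
  then have "R \<le> edge_radius x0 {t, w}" using assms(1) by (auto simp: clear_def)
  also have "\<dots> \<le> l1dist x0 t" by (rule edge_radius_le) (use w in \<open>auto simp: lattice_edge_iff\<close>)
  finally show ?thesis .
qed

lemma y_closed_reach: "y_closed y (reach y A)"
  unfolding y_closed_def using reach_step[of _ y A] by blast

lemma y_closed_bd:
  assumes "y_closed y A" "f \<in> edge_bd A"
  shows "f \<notin> y"
  using assms unfolding y_closed_def edge_bd_def by blast

lemma y_closed_path:
  assumes "y_closed y A" "y \<subseteq> E" "x \<in> reach y D"
  shows "\<exists>z\<in>D. (x, z) \<in> {(u, v). lattice_adj u v \<and> (u \<in> A) = (v \<in> A)}\<^sup>*"
proof -
  obtain z where z: "z \<in> D" "(z, x) \<in> (open_rel y)\<^sup>*" using assms(3) by (auto simp: reach_def)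
  have sub: "open_rel y \<subseteq> {(u, v). lattice_adj u v \<and> (u \<in> A) = (v \<in> A)}"
  proof (clarify, intro conjI)
    fix u v assume "(u, v) \<in> open_rel y"
    then have uv: "{u, v} \<in> y" "{v, u} \<in> y" by (auto simp: open_rel_def insert_commute)
    then show "lattice_adj u v" using assms(2) E_lattice lattice_edge_iff by blast
    show "(u \<in> A) = (v \<in> A)" using uv assms(1) unfolding y_closed_def by blast
  qed
  have "(x, z) \<in> (open_rel y)\<^sup>*" using z(2) sym_rtrancl[OF sym_open_rel] by (meson symD)
  then show ?thesis using z(1) rtrancl_mono[OF sub] by blast
qed

text \<open>The edge joins the cluster of \<open>T\<close> to that of \<open>B\<close>. From its
  endpoints open paths lead to \<open>T\<close> and to \<open>B\<close>, both outside the ball,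
  without crossing the boundary of the cluster of \<open>T\<close>, so
  \<open>bd_comp_exits_ball\<close> applies.\<close>

lemma pivotal_bd:
  assumes "y \<in> YS" "h \<in> piv y"
  shows "h \<in> edge_bd (reach y T)"
    and "clear x0 R dead \<Longrightarrow> \<exists>f\<in>bd_comp (reach y T) h. R \<le> edge_radius x0 f"
proof -
  have hE: "h \<in> E" using assms(2) by (simp add: pivotal_def)
  then obtain a b where ab: "h = {a, b}" "lattice_adj a b" by (rule E_edgeE)
  have yE: "y \<subseteq> E" "\<not> connects y T B" using assms(1) by (auto simp: YS_def)
  have disj: "reach y T \<inter> reach y B = {}" using yE connects_iff_reach by blast
  obtain u v where uv: "h = {u, v}" "lattice_adj u v" "u \<in> reach y T" "v \<in> reach y B"
  proof -
    consider "a \<in> reach y T" "b \<in> reach y B" | "b \<in> reach y T" "a \<in> reach y B"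
      using piv_iff[OF assms(1)] hE ab assms(2) by blast
    then show ?thesis
    proof cases
      case 1
      then show ?thesis using that[of a b] ab by blast
    next
      case 2
      then show ?thesis using that[of b a] ab lattice_adj_commute[of a b] by (simp add: insert_commute)
    qed
  qed
  have vn: "v \<notin> reach y T" using uv disj by blast
  show "h \<in> edge_bd (reach y T)" unfolding uv(1) edge_bd_iff[OF uv(2)] using uv(3) vn by simp
  assume cl: "clear x0 R dead"
  obtain t where t: "t \<in> T" "(u, t) \<in> {(u, v). lattice_adj u v \<and> (u \<in> reach y T) = (v \<in> reach y T)}\<^sup>*"
    using y_closed_path[OF y_closed_reach yE(1) uv(3), of T] by blast
  obtain b where b: "b \<in> B" "(v, b) \<in> {(u, v). lattice_adj u v \<and> (u \<in> reach y T) = (v \<in> reach y T)}\<^sup>*"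
    using y_closed_path[OF y_closed_reach yE(1) uv(4), of T] by blast
  have "(u \<in> reach y T) \<noteq> (v \<in> reach y T)" using uv(3) vn by simp
  then show "\<exists>f\<in>bd_comp (reach y T) h. R \<le> edge_radius x0 f"
    unfolding uv(1)
    by (rule bd_comp_exits_ball[OF dim uv(2) _ t(2) TB_outside[OF cl] b(2) TB_outside[OF cl]])
      (use t(1) b(1) in auto)
qed

lemma rtrancl_of_bd_comp:
  "f \<in> bd_comp A e \<Longrightarrow> (e, f) \<in> {(u, v). star u v \<and> u \<in> edge_bd A \<and> v \<in> edge_bd A}\<^sup>*"
  by (simp add: bd_comp_def)

lemma isolated_pivotal_walk:
  assumes y: "y \<in> YS" and e: "e \<in> piv y" "x0 \<in> e"
    and cl: "clear x0 R (dead \<union> piv y - {e})" and R: "2 * m + 3 \<le> R"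
  shows "\<exists>a\<in>{a. star e a}. \<exists>xs\<in>walks star a m. distinct xs \<and> set xs \<subseteq> closed_np y"
proof -
  let ?A = "reach y T"
  have eE: "e \<in> E" using e by (simp add: pivotal_def)
  then have eL: "e \<in> lattice_edges" using E_lattice by blast
  have r0: "edge_radius x0 e = 0" using edge_radius_le[OF eL e(2), of x0] by simp
  have cld: "clear x0 R dead" using cl eE unfolding clear_def by blast
  obtain f where f: "f \<in> bd_comp ?A e" "R \<le> edge_radius x0 f" using pivotal_bd(2)[OF y e(1) cld] by blast
  \<comment> \<open>One step more than wanted, because \<open>e\<close> itself is pivotal and will
    be dropped. Radii stay at most \<open>2 * m + 2\<close>, hence below \<open>R\<close>, so the
    later edges lie in \<open>E\<close> and are not pivotal.\<close>
  have "\<exists>xs\<in>walks star e (Suc m). distinct xs \<and> set xs \<subseteq> edge_bd ?A"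
  proof (rule distinct_walk_of_rtrancl[OF rtrancl_of_bd_comp[OF f(1)] pivotal_bd(1)[OF y e(1)]])
    show "edge_radius x0 v div 2 \<le> edge_radius x0 u div 2 + 1" if "star u v" for u v
      using edge_radius_star[OF that, of x0] by linarith
    show "edge_radius x0 e div 2 = 0" using r0 by simp
    show "Suc m \<le> edge_radius x0 f div 2" using f(2) R by linarith
  qed
  then obtain xs where xs: "xs \<in> walks star e (Suc m)" "distinct xs" "set xs \<subseteq> edge_bd ?A" by blast
  then obtain a ys where ys: "star e a" "xs = e # ys" "ys \<in> walks star a m" by (auto simp: walks_Suc)
  have "b \<in> closed_np y" if "b \<in> set ys" for b
  proof -
    have b: "b \<in> set xs" "b \<noteq> e" "b \<in> edge_bd ?A" using that xs ys by auto
    have bl: "b \<in> lattice_edges" using b(3) edge_bd_lattice by blast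
    have lt: "edge_radius x0 b < R" using walks_star_radius[OF xs(1) b(1), of x0] r0 R by simp
    have "b \<in> E" by (rule in_E_of_clear[OF cld bl lt])
    moreover have "b \<notin> y" by (rule y_closed_bd[OF y_closed_reach b(3)])
    moreover have "b \<notin> piv y" using cl lt b(2) unfolding clear_def by (meson DiffI UnI2 not_le singletonD)
    ultimately show ?thesis by (simp add: closed_np_def)
  qed
  then show ?thesis using ys xs by auto
qed

section \<open>Histories of closed edges and new pivotal edges\<close>

lemma ystep_other: "a \<noteq> fst c \<Longrightarrow> a \<in> ystep c y \<longleftrightarrow> a \<in> y"
  by (auto simp: ystep_def)

lemma ystep_closes_nonpivotal:
  assumes "y \<in> YS" "c \<in> coins" "fst c \<notin> piv y" "fst c \<notin> ystep c y"
  shows "snd c < 2" "ystep c y = y - {fst c}" "\<not> uval (snd c) \<ge> th y (fst c)"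
proof -
  have e: "fst c \<in> E" "snd c \<in> {0, 1, 2}" using assms(2) by (auto simp: coins_def)
  have nc: "\<not> connects (insert (fst c) y) T B" using assms(3) e by (simp add: pivotal_def)
  show u: "\<not> uval (snd c) \<ge> th y (fst c)" using assms(4) nc by (auto simp: ystep_def)
  then show "ystep c y = y - {fst c}" by (simp add: ystep_def)
  show "snd c < 2"
  proof (rule ccontr)
    assume "\<not> snd c < 2"
    then have "snd c = 2" using e by auto
    then show False using u theta_le[OF e(1), of y] assms(1) by (simp add: uval_def YS_def)
  qed
qed

lemma traj_YS: "y0 \<in> YS \<Longrightarrow> (\<And>i. i < n \<Longrightarrow> \<xi> i \<in> coins) \<Longrightarrow> t \<le> n \<Longrightarrow> traj ystep y0 \<xi> t \<in> YS"
  by (induction t) (auto intro: ystep_YS)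

text \<open>The last update of \<open>a\<close> in the time window closed it while it was not
  pivotal, hence with a rare coin; without any update, \<open>a\<close> was closed at time
  \<open>k\<close> already.\<close>

lemma closed_history:
  assumes y0: "y0 \<in> YS" and \<xi>: "\<And>i. i < n \<Longrightarrow> \<xi> i \<in> coins" and t: "t \<le> n" and k: "k \<le> t"
    and np: "\<And>s. s < t \<Longrightarrow> a \<notin> piv (traj ystep y0 \<xi> s)" and a: "a \<notin> traj ystep y0 \<xi> t"
  shows "(\<exists>i\<in>{k..<t}. fst (\<xi> i) = a \<and> snd (\<xi> i) < 2) \<or>
    (a \<notin> traj ystep y0 \<xi> k \<and> (\<forall>i\<in>{k..<t}. fst (\<xi> i) \<noteq> a))"
  using k t np a
proof (induction t rule: dec_induct)
  case (step t)
  let ?Y = "traj ystep y0 \<xi>"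
  have tY: "?Y t \<in> YS" using traj_YS[OF y0 \<xi>] step.prems(1) by simp
  show ?case
  proof (cases "fst (\<xi> t) = a")
    case True
    have "snd (\<xi> t) < 2"
      by (rule ystep_closes_nonpivotal(1)[OF tY]) (use step.prems \<xi> True in auto)
    then show ?thesis using True step.hyps by auto
  next
    case False
    then have "a \<notin> ?Y t" using step.prems(3) ystep_other[of a "\<xi> t"] by simp
    then have "(\<exists>i\<in>{k..<t}. fst (\<xi> i) = a \<and> snd (\<xi> i) < 2) \<or>
      (a \<notin> ?Y k \<and> (\<forall>i\<in>{k..<t}. fst (\<xi> i) \<noteq> a))"
      using step.IH step.prems by simp
    then show ?thesis using False by (auto simp: less_Suc_eq)
  qed
qed simp

text \<open>Being pivotal is monotone in the configuration, so closing an edge cannot create a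
  pivotal edge. Consequently whatever is closed right after such a birth was closed right before
  it.\<close>

lemma ystep_piv_birth:
  assumes "a \<in> piv (ystep c y)" "a \<notin> piv y"
  shows "y \<subseteq> ystep c y"
proof (rule ccontr)
  assume "\<not> y \<subseteq> ystep c y"
  then have "ystep c y = y - {fst c}" by (auto simp: ystep_def split: if_splits)
  then have "insert a (ystep c y) \<subseteq> insert a y" by auto
  moreover have "connects (insert a (ystep c y)) T B" using assms(1) by (simp add: pivotal_def)
  ultimately have "connects (insert a y) T B" by (rule connects_mono)
  then show False using assms by (simp add: pivotal_def)
qed

text \<open>Considering the first time at which each edge is pivotal guarantees that every edge on the walk is
  either closed and not pivotal at time \<open>0\<close> or was closed by a rare coin.\<close>

lemma new_pivotal_walk:
  assumes y0: "y0 \<in> YS" and \<xi>: "\<And>i. i < n \<Longrightarrow> \<xi> i \<in> coins"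
    and h: "h \<in> piv (traj ystep y0 \<xi> n)" "x0 \<in> h"
    and cl: "clear x0 R (dead \<union> piv y0)" and R: "2 * m + 2 \<le> R"
  shows "\<exists>xs\<in>walks star h m. distinct xs \<and>
    set xs \<subseteq> closed_np y0 \<union> {a\<in>E. \<exists>i<n. fst (\<xi> i) = a \<and> snd (\<xi> i) < 2}"
proof -
  define Y where "Y t = traj ystep y0 \<xi> t" for t
  define Bad where "Bad = closed_np y0 \<union> {a\<in>E. \<exists>i<n. fst (\<xi> i) = a \<and> snd (\<xi> i) < 2}"
  have YYS: "Y t \<in> YS" if "t \<le> n" for t unfolding Y_def by (rule traj_YS[OF y0 \<xi> that])
  have cld: "clear x0 R dead" using cl by (auto simp: clear_def)
  have hE: "h \<in> E" using h by (simp add: pivotal_def)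
  then have hL: "h \<in> lattice_edges" using E_lattice by blast
  have r0: "edge_radius x0 h = 0" using edge_radius_le[OF hL h(2), of x0] by simp
  have bad1: "a \<in> Bad" if "a \<in> E" "t \<le> n" "a \<notin> Y t" "\<And>s. s \<le> t \<Longrightarrow> a \<notin> piv (Y s)" for a t
  proof -
    have "(\<exists>i\<in>{0..<t}. fst (\<xi> i) = a \<and> snd (\<xi> i) < 2) \<or> (a \<notin> Y 0 \<and> (\<forall>i\<in>{0..<t}. fst (\<xi> i) \<noteq> a))"
      unfolding Y_def by (rule closed_history[OF y0 \<xi> that(2)]) (use that in \<open>auto simp: Y_def\<close>)
    then show ?thesis
    proof
      assume "\<exists>i\<in>{0..<t}. fst (\<xi> i) = a \<and> snd (\<xi> i) < 2"
      then show ?thesis using that(1,2) by (auto simp: Bad_def)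
    next
      assume "a \<notin> Y 0 \<and> (\<forall>i\<in>{0..<t}. fst (\<xi> i) \<noteq> a)"
      then show ?thesis using that(1) that(4)[of 0] by (auto simp: Bad_def closed_np_def Y_def)
    qed
  qed
  have birth: "Y t \<subseteq> Y (Suc t)" if "a \<in> piv (Y (Suc t))" "a \<notin> piv (Y t)" for a t
    using ystep_piv_birth[of a "\<xi> t" "Y t"] that by (simp add: Y_def)
  have not0: "a \<notin> piv (Y 0)" if "edge_radius x0 a < R" for a
    using that cl by (force simp: clear_def Y_def)
  \<comment> \<open>At its first pivotal time \<open>Suc r\<close> the edge is closed because it is
    pivotal; by \<open>birth\<close> it was closed at time \<open>r\<close> as well, up to which it
    had never been pivotal, so \<open>bad1\<close> applies at time \<open>r\<close>.\<close>
  have bad2: "a \<in> Bad" if a: "a \<in> piv (Y t)" "t \<le> n" "edge_radius x0 a < R" for a t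
  proof -
    define s where "s = (LEAST s. a \<in> piv (Y s))"
    have s: "a \<in> piv (Y s)" unfolding s_def by (rule LeastI) (rule a(1))
    have st: "s \<le> t" unfolding s_def by (rule Least_le) (rule a(1))
    have least: "a \<notin> piv (Y r)" if "r < s" for r using not_less_Least that unfolding s_def by blast
    have "s \<noteq> 0" using s not0[OF a(3)] by metis
    then obtain r where r: "s = Suc r" using not0_implies_Suc by blast
    have "a \<notin> Y s" using piv_closed[OF YYS s] st a(2) by simp
    then have "a \<notin> Y r" using birth[of a r] s least[of r] r by auto
    then show ?thesis using s st a(2) r least by (intro bad1[of a r]) (auto simp: pivotal_def)
  qed
  have hBad: "h \<in> Bad" by (rule bad2[of h n]) (use h r0 R in \<open>auto simp: Y_def\<close>)
  define Cc where "Cc = {f. (h, f) \<in> {(u, v). star u v \<and> u \<in> Bad \<and> v \<in> Bad}\<^sup>*}"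
  have CBad: "f \<in> Bad" if "f \<in> Cc" for f using that hBad unfolding Cc_def by (auto elim: rtranclE)
  have Cstep: "f' \<in> Cc" if "f \<in> Cc" "star f f'" "f' \<in> Bad" for f f'
    using that CBad[OF that(1)] unfolding Cc_def by (auto intro: rtrancl_into_rtrancl)
  have "\<exists>f\<in>Cc. 2 * m \<le> edge_radius x0 f"
  proof (rule ccontr)
    assume "\<not> ?thesis"
    then have small: "edge_radius x0 f < 2 * m" if "f \<in> Cc" for f using that by (meson not_le)
    \<comment> \<open>The first time at which some edge \<open>a\<close> of the cluster
      \<open>Cc\<close> is pivotal. The boundary component through \<open>a\<close> then leaves the
      ball, yet each of its edges reached from \<open>Cc\<close> is bad and thus joins
      \<open>Cc\<close>, which was assumed to stay small.\<close>
    define t0 where "t0 = (LEAST t. \<exists>a\<in>Cc. a \<in> piv (Y t))"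
    have hC: "h \<in> Cc" by (simp add: Cc_def)
    have ex: "\<exists>a\<in>Cc. a \<in> piv (Y n)" using hC h by (auto simp: Y_def)
    have "\<exists>a\<in>Cc. a \<in> piv (Y t0)" unfolding t0_def by (rule LeastI) (rule ex)
    then obtain a where a: "a \<in> Cc" "a \<in> piv (Y t0)" by blast
    have t0n: "t0 \<le> n" unfolding t0_def by (rule Least_le) (rule ex)
    have least: "f \<notin> piv (Y s)" if "s < t0" "f \<in> Cc" for f s
      using not_less_Least[of s "\<lambda>t. \<exists>a\<in>Cc. a \<in> piv (Y t)"] that unfolding t0_def by blast
    have "edge_radius x0 a < R" using small[OF a(1)] R by linarith
    then have "t0 \<noteq> 0" using a(2) not0[of a] by metis
    then obtain t where t: "t0 = Suc t" using not0_implies_Suc by blast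
    have sub: "Y t \<subseteq> Y t0" using birth[of a t] a(2) least[of t a] a(1) t by simp
    let ?A = "reach (Y t0) T"
    have YS0: "Y t0 \<in> YS" by (rule YYS[OF t0n])
    have "f \<in> Cc" if "f \<in> bd_comp ?A a" for f
      using that
    proof (induction rule: bd_comp_induct)
      case base
      then show ?case by (rule a(1))
    next
      case (step f f')
      have fl: "f' \<in> lattice_edges" using step(4) edge_bd_lattice by blast
      have lt: "edge_radius x0 f' < R"
        using edge_radius_star[OF step(2), of x0] small[OF step(5)] R by linarith
      have fE: "f' \<in> E" by (rule in_E_of_clear[OF cld fl lt])
      have "f' \<notin> Y t0" by (rule y_closed_bd[OF y_closed_reach step(4)])
      then have cl_t: "f' \<notin> Y t" using sub by blast
      have "f' \<in> Bad"
      proof (cases "\<exists>s\<le>t. f' \<in> piv (Y s)")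
        case True
        then show ?thesis using bad2 lt t t0n by (meson Suc_leD le_trans)
      next
        case False
        then show ?thesis using bad1[OF fE _ cl_t] t t0n by auto
      qed
      then show ?case by (rule Cstep[OF step(5) step(2)])
    qed
    moreover obtain f where "f \<in> bd_comp ?A a" "R \<le> edge_radius x0 f"
      using pivotal_bd(2)[OF YS0 a(2) cld] by blast
    ultimately have "f \<in> Cc" "R \<le> edge_radius x0 f" by blast+
    then show False using small[of f] R by linarith
  qed
  then obtain f where f: "f \<in> Cc" "2 * m \<le> edge_radius x0 f" by blast
  have "\<exists>xs\<in>walks star h m. distinct xs \<and> set xs \<subseteq> Bad"
  proof (rule distinct_walk_of_rtrancl[of h f star Bad "\<lambda>a. edge_radius x0 a div 2"])
    show "(h, f) \<in> {(u, v). star u v \<and> u \<in> Bad \<and> v \<in> Bad}\<^sup>*" using f by (simp add: Cc_def)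
    show "edge_radius x0 v div 2 \<le> edge_radius x0 u div 2 + 1" if "star u v" for u v
      using edge_radius_star[OF that, of x0] by linarith
  qed (use hBad r0 f in auto)
  then show ?thesis by (simp add: Bad_def)
qed

section \<open>Entrance into the interface\<close>

lemma ext_rel_of_open_rel: "(u, v) \<in> (open_rel \<omega>)\<^sup>* \<Longrightarrow> (Inl u, Inl v) \<in> (ext_rel T B \<omega>)\<^sup>*"
proof (induction rule: rtrancl_induct)
  case (step v w)
  then have "(Inl v, Inl w) \<in> ext_rel T B \<omega>" by (auto simp: open_rel_def ext_rel_def)
  then show ?case using step(3) by (rule rtrancl_into_rtrancl[rotated])
qed simp

text \<open>The potential of the component is constant on \<open>T \<union> B\<close>, which lies
  outside the ball, so it extends to the two extra vertices. It differs at the endpoints of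
  \<open>a\<close>; hence a wired path between them in \<open>\<omega>\<close> must use an edge of
  the component.\<close>

lemma joined_crosses_bd:
  assumes a: "a \<in> edge_bd A" and X: "\<omega> \<subseteq> E" and j: "joined \<omega> a"
    and cl: "clear x0 R dead"
    and inside: "\<And>f. f \<in> bd_comp A a \<Longrightarrow> edge_radius x0 f < R"
  shows "\<exists>f\<in>bd_comp A a. f \<in> \<omega>"
proof (rule ccontr)
  assume none: "\<not> ?thesis"
  obtain g :: "('d \<Rightarrow> int) \<Rightarrow> bool" where
    "(\<forall>u v. lattice_adj u v \<longrightarrow> (g u \<noteq> g v) = ({u, v} \<in> bd_comp A a)) \<and>
     (\<forall>u v. R \<le> l1dist x0 u \<longrightarrow> R \<le> l1dist x0 v \<longrightarrow> g u = g v)"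
    using bd_comp_inside_potential[OF dim a inside] by (rule exE)
  note g = this[THEN conjunct1, rule_format] and out = this[THEN conjunct2, rule_format]
  have "a \<in> lattice_edges" using a edge_bd_lattice by blast
  then obtain x y where xy: "a = {x, y}" "lattice_adj x y" by (rule lattice_edgeE)
  \<comment> \<open>If \<open>T \<union> B\<close> is empty then \<open>t0\<close> is arbitrary; the
    extra vertices are then isolated and their value is immaterial.\<close>
  define t0 where "t0 = (SOME t. t \<in> T \<union> B)"
  define G where "G w = (case w of Inl u \<Rightarrow> g u | Inr (_::bool) \<Rightarrow> g t0)" for w
  have TBg: "g t = g t0" if "t \<in> T \<union> B" for t
  proof -
    have "t0 \<in> T \<union> B" unfolding t0_def by (rule someI[of "\<lambda>t. t \<in> T \<union> B", OF that])
    then show ?thesis using out[OF TB_outside[OF cl that] TB_outside[OF cl]] by blast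
  qed
  have edge: "g u = g v" if "{u, v} \<in> \<omega>" for u v
  proof -
    have "lattice_adj u v" using that X E_lattice lattice_edge_iff by blast
    moreover have "{u, v} \<notin> bd_comp A a" using that none by blast
    ultimately show ?thesis using g by blast
  qed
  have "G w = G (Inl x)" if "(Inl x, w) \<in> (ext_rel T B \<omega>)\<^sup>*" for w
    using that
  proof (induction rule: rtrancl_induct)
    case (step w w')
    have "G w = G w'" using step(2) edge TBg unfolding ext_rel_def G_def by auto
    then show ?case using step(3) by simp
  qed simp
  then have "G (Inl y) = G (Inl x)" using j unfolding xy(1) joined_pair by blast
  then have "g x = g y" by (simp add: G_def)
  then show False using g[OF xy(2)] bd_comp_self[of a A] xy(1) by blast
qed

abbreviation "intf \<equiv> interface E"

lemma intf_iff: "s \<in> CS \<Longrightarrow> a \<in> intf (fst s) (snd s) \<longleftrightarrow> a \<in> fst s \<and> a \<notin> snd s"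
  by (auto simp: interface_def coupled_states_def)

text \<open>The same uniform variable opens \<open>a\<close> in \<open>X\<close> and closes it in
  \<open>Y\<close>, so the two closing probabilities differ: the endpoints of \<open>a\<close> are
  joined in \<open>X - {a}\<close> but not in \<open>Y - {a}\<close>. With \<open>A\<close> the
  cluster of one endpoint in \<open>Y - {a}\<close>, the connection in \<open>X\<close> must cross
  the boundary component of \<open>a\<close> at an edge that is closed in \<open>Y\<close>, that is,
  at an edge of the old interface.\<close>

lemma interface_entry:
  assumes s: "s \<in> CS" and c: "c \<in> coins"
    and a: "a \<in> intf (fst (cstep c s)) (snd (cstep c s))" "a \<notin> intf (fst s) (snd s)"
    and np: "a \<notin> piv (snd s)" and cl: "clear x0 R dead"
  shows "\<exists>A. a \<in> edge_bd A \<and> y_closed (snd (cstep c s)) A \<and>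
    ((\<forall>f\<in>bd_comp A a. edge_radius x0 f < R) \<longrightarrow> (\<exists>f\<in>bd_comp A a. f \<in> intf (fst s) (snd s)))"
proof -
  let ?X = "fst s" and ?Y = "snd s"
  have XY: "?X \<subseteq> E" "?Y \<subseteq> E" "?Y \<in> YS" using s CS_YS[OF s] by (auto simp: coupled_states_def)
  have s': "cstep c s \<in> CS" by (rule cstep_CS[OF s c])
  have a': "a \<in> fst (cstep c s)" "a \<notin> ystep c ?Y"
    using a(1) intf_iff[OF s', of a] by (simp_all add: snd_cstep)
  have a0: "\<not> (a \<in> ?X \<and> a \<notin> ?Y)" using a(2) by (simp add: intf_iff[OF s])
  have fc: "fst c = a"
  proof (rule ccontr)
    assume n: "fst c \<noteq> a"
    then have "a \<notin> ?Y" using a'(2) ystep_other[of a c] by blast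
    moreover have "a \<in> ?X" using a'(1) n by (auto simp: fst_cstep split: if_splits)
    ultimately show False using a0 by blast
  qed
  have aE: "a \<in> E" using c fc by (auto simp: coins_def)
  note cy = ystep_closes_nonpivotal[OF XY(3) c, unfolded fc, OF np a'(2)]
  have ux: "uval (snd c) \<ge> th ?X a" using a'(1) fc by (auto simp: fst_cstep split: if_splits)
  have "th ?X a < th ?Y a" using ux cy(3) by linarith
  then have jX: "joined (?X - {a}) a" and jY: "\<not> joined (?Y - {a}) a"
    using theta_bounds(2) by (auto simp: theta_eq[OF aE XY(1)] theta_eq[OF aE XY(2)] split: if_splits)
  obtain x y where xy: "a = {x, y}" "lattice_adj x y" using aE by (rule E_edgeE)
  let ?Y' = "?Y - {a}"
  define A where "A = reach ?Y' {y}"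
  have "x \<notin> A"
  proof
    assume "x \<in> A"
    then have "(y, x) \<in> (open_rel ?Y')\<^sup>*" by (simp add: A_def reach_def)
    then have "(Inl y, Inl x) \<in> (ext_rel T B ?Y')\<^sup>*" by (rule ext_rel_of_open_rel)
    then have "joined ?Y' {y, x}" by (simp only: joined_pair)
    then show False using jY xy(1) by (simp add: insert_commute)
  qed
  moreover have "y \<in> A" using reach_start[of "{y}" ?Y'] by (auto simp: A_def)
  ultimately have abd: "a \<in> edge_bd A" unfolding xy(1) edge_bd_iff[OF xy(2)] by simp
  have yc: "y_closed ?Y' A" unfolding A_def by (rule y_closed_reach)
  have "\<exists>f\<in>bd_comp A a. f \<in> intf ?X ?Y" if ins: "\<forall>f\<in>bd_comp A a. edge_radius x0 f < R"
  proof -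
    have "\<exists>f\<in>bd_comp A a. f \<in> ?X - {a}"
      by (rule joined_crosses_bd[OF abd _ jX cl]) (use XY(1) ins in auto)
    then obtain f where f: "f \<in> bd_comp A a" "f \<in> ?X" "f \<noteq> a" by blast
    have "f \<in> edge_bd A" using f(1) bd_comp_subset[OF abd] by blast
    then have "f \<notin> ?Y'" by (rule y_closed_bd[OF yc])
    then have "f \<notin> ?Y" using f(3) by blast
    then show ?thesis using f by (auto simp: intf_iff[OF s])
  qed
  moreover have "snd (cstep c s) = ?Y'" using cy(2) by (simp add: snd_cstep)
  ultimately show ?thesis using abd yc by auto
qed

section \<open>Bad space-time sites and the history of the interface\<close>

definition "bad_site \<xi> L n \<sigma> \<longleftrightarrow> fst \<sigma> \<in> E \<and> Suc (snd \<sigma>) * L \<le> n \<and>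
  (bad_coin \<xi> (fst \<sigma>) (snd \<sigma>) L n \<or> no_good_coin \<xi> (fst \<sigma>) (snd \<sigma>) L n)"

text \<open>A closed edge is charged to the block of the current time or to the preceding one, and
  one step back in time may lower the block by one more; hence the tolerance 2.\<close>

definition site_adj :: "('d \<Rightarrow> int) set \<times> nat \<Rightarrow> ('d \<Rightarrow> int) set \<times> nat \<Rightarrow> bool" where
  "site_adj \<sigma> \<tau> \<longleftrightarrow> star (fst \<sigma>) (fst \<tau>) \<and> snd \<sigma> \<le> snd \<tau> + 2 \<and> snd \<tau> \<le> snd \<sigma> + 2"

lemma snd_traj: "snd (traj cstep s \<xi> t) = traj ystep (snd s) \<xi> t"
  by (induction t) (simp_all add: snd_cstep)

lemma traj_CS: "s \<in> CS \<Longrightarrow> (\<And>i. i < n \<Longrightarrow> \<xi> i \<in> coins) \<Longrightarrow> t \<le> n \<Longrightarrow> traj cstep s \<xi> t \<in> CS"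
  by (induction t) (auto intro: cstep_CS)

text \<open>The current block may be only partly elapsed, so the history is traced to the start of
  the previous one: either a rare coin has hit \<open>a\<close> since then, or \<open>a\<close> was
  not drawn during the whole previous block.\<close>

lemma closed_bad_site:
  assumes y0: "y0 \<in> YS" and \<xi>: "\<And>i. i < n \<Longrightarrow> \<xi> i \<in> coins" and L: "0 < L" and n: "n = W * L"
    and t: "t < n" "1 \<le> t div L" and aE: "a \<in> E"
    and np: "\<And>s. s \<le> n \<Longrightarrow> a \<notin> piv (traj ystep y0 \<xi> s)" and a: "a \<notin> traj ystep y0 \<xi> (Suc t)"
  shows "\<exists>j\<in>{t div L, t div L - 1}. bad_site \<xi> L n (a, j)"
proof -
  define j where "j = t div L"
  define k where "k = (j - 1) * L"
  have jt: "j * L \<le> t" unfolding j_def by (rule div_times_less_eq_dividend)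
  have tj: "t < Suc j * L" unfolding j_def using dividend_less_div_times[OF L, of t] by (simp add: add.commute)
  have j1: "Suc (j - 1) = j" using t(2) by (simp add: j_def)
  have k: "k + L = j * L" unfolding k_def using j1 by (metis mult_Suc add.commute)
  have jW: "Suc j \<le> W" using jt t(1) n by (metis Suc_leI le_less_trans mult_less_cancel2)
  then have full: "Suc j * L \<le> n" unfolding n by (rule mult_le_mono1)
  then have full': "Suc (j - 1) * L \<le> n" unfolding j1 by simp
  have "(\<exists>i\<in>{k..<Suc t}. fst (\<xi> i) = a \<and> snd (\<xi> i) < 2) \<or>
      (a \<notin> traj ystep y0 \<xi> k \<and> (\<forall>i\<in>{k..<Suc t}. fst (\<xi> i) \<noteq> a))"
    by (rule closed_history[OF y0 \<xi>]) (use t(1) k jt np a in auto)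
  then show ?thesis
  proof
    assume "\<exists>i\<in>{k..<Suc t}. fst (\<xi> i) = a \<and> snd (\<xi> i) < 2"
    then obtain i where i: "k \<le> i" "i \<le> t" "fst (\<xi> i) = a" "snd (\<xi> i) < 2" by auto
    have "i div L \<le> j" unfolding j_def by (rule div_le_mono[OF i(2)])
    moreover have "j - 1 \<le> i div L"
      using i(1) unfolding k_def less_eq_div_iff_mult_less_eq[OF L] .
    ultimately have "i div L = j \<or> i div L = j - 1" by linarith
    moreover have "bad_coin \<xi> a (i div L) L n" unfolding bad_coin_def using i t(1) by (intro exI[of _ i]) auto
    ultimately show ?thesis unfolding bad_site_def j_def[symmetric] using aE full full' by auto
  next
    assume none: "a \<notin> traj ystep y0 \<xi> k \<and> (\<forall>i\<in>{k..<Suc t}. fst (\<xi> i) \<noteq> a)"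
    have "no_good_coin \<xi> a (j - 1) L n"
      unfolding no_good_coin_def
    proof (intro allI impI)
      fix i assume i: "i < n" "i div L = j - 1"
      have "k \<le> i" unfolding k_def using i(2) div_times_less_eq_dividend[of i L] by simp
      moreover have "i < Suc (j - 1) * L" using i(2) dividend_less_div_times[OF L, of i] by (simp add: add.commute)
      ultimately have "i \<in> {k..<Suc t}" using jt j1 by auto
      then have "fst (\<xi> i) \<noteq> a" using none by blast
      then show "\<xi> i \<noteq> (a, 2)" by auto
    qed
    then show ?thesis unfolding bad_site_def j_def[symmetric] using aE full full' by auto
  qed
qed

text \<open>The cluster \<open>Cc\<close> of bad sites around the final occurrence of
  \<open>e\<close> must reach far in space or far back in time. Otherwise there is an earliest time
  at which an edge of the cluster, at a site of that time, is in the interface; going back one step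
  with this edge or, by \<open>interface_entry\<close>, with another edge of its boundary component
  contradicts minimality.\<close>

lemma interface_walk:
  assumes s0: "s0 \<in> CS" and \<xi>: "\<And>i. i < n \<Longrightarrow> \<xi> i \<in> coins" and L: "0 < L" and n: "n = W * L"
    and e: "e \<in> intf (fst (traj cstep s0 \<xi> n)) (snd (traj cstep s0 \<xi> n))" "x0 \<in> e"
    and cl: "\<And>t. t \<le> n \<Longrightarrow> clear x0 R (dead \<union> piv (traj ystep (snd s0) \<xi> t))"
    and R: "2 * m + 2 \<le> R" and W: "2 * m + 4 \<le> W"
  shows "\<exists>j\<in>{W - 1, W - 2}. \<exists>xs\<in>walks site_adj (e, j) m. distinct xs \<and> set xs \<subseteq> {\<sigma>. bad_site \<xi> L n \<sigma>}"
proof -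
  define S where "S t = traj cstep s0 \<xi> t" for t
  define I where "I t = intf (fst (S t)) (snd (S t))" for t
  have SCS: "S t \<in> CS" if "t \<le> n" for t unfolding S_def by (rule traj_CS[OF s0 \<xi> that])
  have y0: "snd s0 \<in> YS" by (rule CS_YS[OF s0])
  have cld: "clear x0 R dead" using cl[of 0] by (auto simp: clear_def)
  have npiv: "a \<notin> piv (traj ystep (snd s0) \<xi> t)" if "t \<le> n" "edge_radius x0 a < R" for a t
    using cl[OF that(1)] that(2) by (force simp: clear_def)
  have Iclosed: "a \<notin> snd (S t)" "a \<in> E" if "a \<in> I t" "t \<le> n" for a t
    using that intf_iff[OF SCS[OF that(2)], of a] by (auto simp: I_def interface_def)
  have site: "\<exists>j\<in>{t div L, t div L - 1}. bad_site \<xi> L n (a, j)"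
    if "t < n" "1 \<le> t div L" "a \<in> E" "edge_radius x0 a < R" "a \<notin> snd (S (Suc t))" for a t
    by (rule closed_bad_site[OF y0 \<xi> L n that(1,2,3)])
      (use that npiv in \<open>simp_all add: S_def snd_cstep snd_traj\<close>)
  have npos: "0 < n" using n L W by simp
  have eE: "e \<in> E" using e(1) by (simp add: interface_def)
  have r0: "edge_radius x0 e = 0" using edge_radius_le[of e x0 x0] eE E_lattice e(2) by auto
  have nW: "(n - 1) div L = W - 1"
  proof -
    have "n = L * Suc (W - 1)" using n W by simp
    moreover have "L * Suc (W - 1) = L * (W - 1) + L" by simp
    ultimately show ?thesis using L by (intro div_nat_eqI) linarith+
  qed
  have "\<exists>j\<in>{W - 1, W - 1 - 1}. bad_site \<xi> L n (e, j)"
    using site[of "n - 1" e] npos nW W r0 R eE Iclosed[of e n] e(1) by (simp add: I_def S_def)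
  then obtain j0 where j0: "j0 \<in> {W - 1, W - 2}" "bad_site \<xi> L n (e, j0)" by (auto simp: numeral_2_eq_2)
  define Bad where "Bad = {\<sigma>. bad_site \<xi> L n \<sigma>}"
  \<comment> \<open>The distance covered in space or in time, whichever is larger, halved since
    \<open>site_adj\<close> may change both radius and block by 2.\<close>
  define \<psi> where "\<psi> \<sigma> = max (edge_radius x0 (fst \<sigma>) div 2) ((W - 1 - snd \<sigma>) div 2)" for \<sigma> :: "('d \<Rightarrow> int) set \<times> nat"
  define Cc where "Cc = {\<sigma>. ((e, j0), \<sigma>) \<in> {(u, v). site_adj u v \<and> u \<in> Bad \<and> v \<in> Bad}\<^sup>*}"
  have start: "(e, j0) \<in> Bad" using j0 by (simp add: Bad_def)
  have CBad: "\<sigma> \<in> Bad" if "\<sigma> \<in> Cc" for \<sigma> using that start unfolding Cc_def by (auto elim: rtranclE)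
  have Cstep: "\<tau> \<in> Cc" if "\<sigma> \<in> Cc" "site_adj \<sigma> \<tau>" "\<tau> \<in> Bad" for \<sigma> \<tau>
    using that CBad[OF that(1)] unfolding Cc_def mem_Collect_eq
    by (elim rtrancl_into_rtrancl) simp
  have "\<exists>\<sigma>\<in>Cc. m \<le> \<psi> \<sigma>"
  proof (rule ccontr)
    assume "\<not> ?thesis"
    then have small: "\<psi> \<sigma> < m" if "\<sigma> \<in> Cc" for \<sigma> using that by (meson not_le)
    \<comment> \<open>The bound on the block gives \<open>3 \<le> t div L\<close>, so that after one
      further step back there still is a complete preceding block, as \<open>site\<close>
      requires.\<close>
    have rad: "edge_radius x0 a < 2 * m" and lev: "3 \<le> j" if "(a, j) \<in> Cc" for a j
      using small[OF that] W by (auto simp: \<psi>_def)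
    define P where "P t \<longleftrightarrow> t < n \<and> (\<exists>a\<in>I (Suc t). \<exists>j\<in>{t div L, t div L - 1}. (a, j) \<in> Cc)" for t
    have "(e, j0) \<in> Cc" "j0 \<in> {W - 1, W - 1 - 1}" "e \<in> I (Suc (n - 1))"
      using j0(1) e(1) npos by (auto simp: Cc_def I_def S_def)
    then have "P (n - 1)" unfolding P_def nW using npos by auto
    define t where "t = (LEAST t. P t)"
    have "P t" unfolding t_def by (rule LeastI) (rule \<open>P (n - 1)\<close>)
    then obtain a j where tn: "t < n" and a: "a \<in> I (Suc t)" "j \<in> {t div L, t div L - 1}" "(a, j) \<in> Cc"
      unfolding P_def by blast
    have tdiv: "3 \<le> t div L" using lev[OF a(3)] a(2) by auto
    then have "t \<noteq> 0" by (metis div_0 not_numeral_le_zero)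
    then obtain t' where t': "t = Suc t'" using not0_implies_Suc by blast
    have least: "\<not> P t'" using not_less_Least[of t' P] t' unfolding t_def by simp
    have div': "t div L \<le> t' div L + 1" "t' div L \<le> t div L"
    proof -
      have "t div L \<le> (t' + L) div L" using t' L by (intro div_le_mono) simp
      then show "t div L \<le> t' div L + 1" using L by simp
      show "t' div L \<le> t div L" using t' by (intro div_le_mono) simp
    qed
    have no_earlier: False if b: "b \<in> I t" "i \<in> {t div L, t div L - 1}" "(b, i) \<in> Cc" for b i
    proof -
      have bE: "b \<in> E" "b \<notin> snd (S (Suc t'))" using Iclosed[OF b(1)] tn t' by auto
      have "\<exists>i'\<in>{t' div L, t' div L - 1}. bad_site \<xi> L n (b, i')"
        by (rule site) (use tn t' tdiv div' bE rad[OF b(3)] R in auto)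
      then obtain i' where i': "i' \<in> {t' div L, t' div L - 1}" "(b, i') \<in> Bad" by (auto simp: Bad_def)
      have "star b b" using bE E_lattice by (intro star_refl) auto
      moreover have "i \<le> i' + 2" "i' \<le> i + 2" using b(2) i'(1) div' by auto
      ultimately have "(b, i') \<in> Cc" by (intro Cstep[OF b(3) _ i'(2)]) (simp add: site_adj_def)
      then have "P t'" unfolding P_def using i'(1) b(1) t' tn by auto
      then show False using least by simp
    qed
    show False
    proof (cases "a \<in> I t")
      case True
      then show False using no_earlier a by blast
    next
      case False
      have St: "S (Suc t) = cstep (\<xi> t) (S t)" by (simp add: S_def)
      have a_lt: "edge_radius x0 a < R" using rad[OF a(3)] R by linarith
      have "\<exists>A. a \<in> edge_bd A \<and> y_closed (snd (cstep (\<xi> t) (S t))) A \<and>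
          ((\<forall>f\<in>bd_comp A a. edge_radius x0 f < R) \<longrightarrow> (\<exists>f\<in>bd_comp A a. f \<in> intf (fst (S t)) (snd (S t))))"
      proof (rule interface_entry)
        show "S t \<in> CS" using SCS tn by simp
        show "\<xi> t \<in> coins" using \<xi> tn by simp
        show "a \<in> intf (fst (cstep (\<xi> t) (S t))) (snd (cstep (\<xi> t) (S t)))" using a(1) unfolding I_def St .
        show "a \<notin> intf (fst (S t)) (snd (S t))" using False unfolding I_def .
        show "a \<notin> piv (snd (S t))" using npiv[of t a] a_lt tn by (simp add: S_def snd_traj)
        show "clear x0 R dead" by (rule cld)
      qed
      then obtain A where A: "a \<in> edge_bd A" "y_closed (snd (S (Suc t))) A"
        and cross: "(\<forall>f\<in>bd_comp A a. edge_radius x0 f < R) \<Longrightarrow> \<exists>f\<in>bd_comp A a. f \<in> I t"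
        unfolding St I_def by blast
      have inC: "\<exists>i\<in>{t div L, t div L - 1}. (f, i) \<in> Cc" if "f \<in> bd_comp A a" for f
        using that
      proof (induction rule: bd_comp_induct)
        case base
        then show ?case using a by blast
      next
        case (step f f')
        then obtain i where i: "i \<in> {t div L, t div L - 1}" "(f, i) \<in> Cc" by blast
        have fl: "f' \<in> lattice_edges" using step(4) edge_bd_lattice by blast
        have lt: "edge_radius x0 f' < R"
          using edge_radius_star[OF step(2), of x0] rad[OF i(2)] R by linarith
        have fE: "f' \<in> E" by (rule in_E_of_clear[OF cld fl lt])
        have "f' \<notin> snd (S (Suc t))" by (rule y_closed_bd[OF A(2) step(4)])
        then have "\<exists>i'\<in>{t div L, t div L - 1}. bad_site \<xi> L n (f', i')"
          using site[OF tn _ fE lt] tdiv by simp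
        then obtain i' where i': "i' \<in> {t div L, t div L - 1}" "(f', i') \<in> Bad" by (auto simp: Bad_def)
        have "i \<le> i' + 2" "i' \<le> i + 2" using i(1) i'(1) by auto
        then have "(f', i') \<in> Cc" using step(2) by (intro Cstep[OF i(2) _ i'(2)]) (simp add: site_adj_def)
        then show ?case using i'(1) by blast
      qed
      have "\<forall>f\<in>bd_comp A a. edge_radius x0 f < R"
      proof
        fix f assume "f \<in> bd_comp A a"
        then obtain i where "(f, i) \<in> Cc" using inC by blast
        then show "edge_radius x0 f < R" using rad[of f i] R by linarith
      qed
      then obtain f where f: "f \<in> bd_comp A a" "f \<in> I t" using cross by blast
      then obtain i where "i \<in> {t div L, t div L - 1}" "(f, i) \<in> Cc" using inC by blast
      then show False using no_earlier[OF f(2)] by blast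
    qed
  qed
  then obtain \<sigma> where \<sigma>: "\<sigma> \<in> Cc" "m \<le> \<psi> \<sigma>" by blast
  have "\<exists>xs\<in>walks site_adj (e, j0) m. distinct xs \<and> set xs \<subseteq> Bad"
  proof (rule distinct_walk_of_rtrancl[of "(e, j0)" \<sigma> site_adj Bad \<psi>])
    show "((e, j0), \<sigma>) \<in> {(u, v). site_adj u v \<and> u \<in> Bad \<and> v \<in> Bad}\<^sup>*" using \<sigma> by (simp add: Cc_def)
    show "\<psi> v \<le> \<psi> u + 1" if "site_adj u v" for u v
    proof -
      have "edge_radius x0 (fst v) \<le> edge_radius x0 (fst u) + 2"
        using that edge_radius_star by (auto simp: site_adj_def)
      then have 1: "edge_radius x0 (fst v) div 2 \<le> edge_radius x0 (fst u) div 2 + 1" by linarith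
      have "W - 1 - snd v \<le> (W - 1 - snd u) + 2" using that by (auto simp: site_adj_def)
      then have 2: "(W - 1 - snd v) div 2 \<le> (W - 1 - snd u) div 2 + 1" by linarith
      show ?thesis unfolding \<psi>_def
        by (rule max.boundedI) (rule order.trans[OF 1], simp, rule order.trans[OF 2], simp)
    qed
    show "\<psi> (e, j0) = 0" using r0 j0(1) by (auto simp: \<psi>_def)
  qed (use start \<sigma> in auto)
  then show ?thesis using j0(1) unfolding Bad_def by blast
qed

end

section \<open>Probability estimates\<close>

definition ctr :: "'a set \<Rightarrow> 'a" where
  "ctr e = (SOME x. x \<in> e)"

lemma ctr_in: "e \<in> lattice_edges \<Longrightarrow> ctr e \<in> e"
  unfolding ctr_def using lattice_edge_nonempty some_in_eq by blast

lemma sum_Pow_split: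
  fixes a b :: real
  assumes "finite S"
  shows "(\<Sum>S'\<in>Pow S. a ^ card S' * b ^ card (S - S')) = (a + b) ^ card S"
  using prod_add[OF assms, of "\<lambda>_. a" "\<lambda>_. b"] by simp

lemma sum_filter_Times:
  fixes f :: "'a \<Rightarrow> real" and g :: "'b \<Rightarrow> real"
  shows "(\<Sum>\<omega>\<in>{\<omega>\<in>A \<times> B. P (fst \<omega>) \<and> Q (snd \<omega>)}. f (fst \<omega>) * g (snd \<omega>))
    = (\<Sum>x\<in>{x\<in>A. P x}. f x) * (\<Sum>y\<in>{y\<in>B. Q y}. g y)"
proof -
  have eq: "{\<omega>\<in>A \<times> B. P (fst \<omega>) \<and> Q (snd \<omega>)} = {x\<in>A. P x} \<times> {y\<in>B. Q y}" by auto
  show ?thesis unfolding eq sum_product sum.cartesian_product' by simp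
qed

context fk_box
begin

lemma site_adj_degree: "finite {\<tau>. site_adj \<sigma> \<tau>}" "card {\<tau>. site_adj \<sigma> \<tau>} \<le> 5 * (25 ^ CARD('d))"
proof -
  let ?J = "{snd \<sigma> - 2..snd \<sigma> + 2}"
  have sub: "{\<tau>. site_adj \<sigma> \<tau>} \<subseteq> {b. star (fst \<sigma>) b} \<times> ?J"
    by (auto simp: site_adj_def)
  have fin: "finite ({b. star (fst \<sigma>) b} \<times> ?J)" using star_degree(1) by auto
  then show "finite {\<tau>. site_adj \<sigma> \<tau>}" using sub by (rule finite_subset[rotated])
  have "card {\<tau>. site_adj \<sigma> \<tau>} \<le> card {b. star (fst \<sigma>) b} * card ?J"
    using card_mono[OF fin sub] by (simp add: card_cartesian_product)
  also have "\<dots> \<le> (25 ^ CARD('d)) * 5" by (rule mult_le_mono[OF star_degree(2)]) simp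
  finally show "card {\<tau>. site_adj \<sigma> \<tau>} \<le> 5 * (25 ^ CARD('d))" by simp
qed

lemma Y_marginal_event:
  assumes "stationary_dist V E T B p q \<mu>"
  shows "(\<Sum>s\<in>{s\<in>CS. Q (snd s)}. \<mu> s) = (\<Sum>y\<in>{y\<in>YS. Q y}. cond_fk y)"
proof -
  have "(\<Sum>s\<in>{s\<in>CS. Q (snd s)}. \<mu> s) = (\<Sum>s\<in>CS. \<mu> s * of_bool (Q (snd s)))"
    using fin_CS by (simp add: sum.inter_filter of_bool_def if_distrib cong: if_cong)
  also have "\<dots> = (\<Sum>y\<in>YS. cond_fk y * of_bool (Q y))" by (rule Y_marginal[OF assms])
  also have "\<dots> = (\<Sum>y\<in>{y\<in>YS. Q y}. cond_fk y)"
    using finYS by (simp add: sum.inter_filter of_bool_def if_distrib cong: if_cong)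
  finally show ?thesis .
qed

lemma isolated_pivotal_prob:
  assumes st: "stationary_dist V E T B p q \<mu>" and \<epsilon>: "0 \<le> \<epsilon>" "\<epsilon> \<le> 1" "\<delta> \<le> \<epsilon>\<^sup>2" and R: "2 * m + 3 \<le> R"
  shows "(\<Sum>s\<in>{s\<in>CS. \<exists>e\<in>piv (snd s). clear (ctr e) R (dead \<union> piv (snd s) - {e})}. \<mu> s)
    \<le> real N * (real ((25::nat) ^ CARD('d)) * (2 * \<epsilon>)) ^ Suc m"
proof -
  \<comment> \<open>The walk starts at a neighbour of the pivotal edge. Choosing this neighbour
    costs one more degree factor, which brings the power of the degree from \<open>m\<close> to
    \<open>Suc m\<close>.\<close>
  let ?I = "Sigma E (\<lambda>e. {a. star e a})"
  have finI: "finite ?I" using finE star_degree(1) by auto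
  have cn: "0 \<le> cond_fk y" for y using cond_fk_pos[of y] by simp
  have "(\<Sum>s\<in>{s\<in>CS. \<exists>e\<in>piv (snd s). clear (ctr e) R (dead \<union> piv (snd s) - {e})}. \<mu> s)
      = (\<Sum>y\<in>{y\<in>YS. \<exists>e\<in>piv y. clear (ctr e) R (dead \<union> piv y - {e})}. cond_fk y)"
    by (rule Y_marginal_event[OF st])
  also have "\<dots> \<le> (\<Sum>i\<in>?I. \<Sum>y\<in>{y\<in>YS. \<exists>xs\<in>walks star (snd i) m. distinct xs \<and> set xs \<subseteq> closed_np y}. cond_fk y)"
  proof (rule sum_union_bound[OF finYS finI cn])
    fix y assume y: "y \<in> YS" "\<exists>e\<in>piv y. clear (ctr e) R (dead \<union> piv y - {e})"
    then obtain e where e: "e \<in> piv y" "clear (ctr e) R (dead \<union> piv y - {e})" by blast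
    have eE: "e \<in> E" using e by (simp add: pivotal_def)
    then have "ctr e \<in> e" using E_lattice ctr_in by blast
    then show "\<exists>i\<in>?I. \<exists>xs\<in>walks star (snd i) m. distinct xs \<and> set xs \<subseteq> closed_np y"
      using isolated_pivotal_walk[OF y(1) e(1) _ e(2) R] eE by force
  qed
  also have "\<dots> \<le> (\<Sum>i\<in>?I. real ((25::nat) ^ CARD('d)) ^ m * (2 * \<epsilon>) ^ Suc m)"
    by (rule sum_mono, rule walk_union_bound[OF finYS cn star_degree closed_np_prob])
      (use \<epsilon> in auto)
  also have "\<dots> = real (card ?I) * (real ((25::nat) ^ CARD('d)) ^ m * (2 * \<epsilon>) ^ Suc m)" by simp
  also have "\<dots> \<le> real (N * (25 ^ CARD('d))) * (real ((25::nat) ^ CARD('d)) ^ m * (2 * \<epsilon>) ^ Suc m)"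
  proof (rule mult_right_mono)
    have "card ?I = (\<Sum>e\<in>E. card {a. star e a})" by (rule card_SigmaI) (use finE star_degree(1) in auto)
    also have "\<dots> \<le> (\<Sum>e\<in>E. (25 ^ CARD('d)))" by (rule sum_mono) (rule star_degree(2))
    finally have "card ?I \<le> N * (25 ^ CARD('d))" by simp
    then show "real (card ?I) \<le> real (N * (25 ^ CARD('d)))" by (simp only: of_nat_le_iff)
  qed (use \<epsilon> in auto)
  also have "\<dots> = real N * (real ((25::nat) ^ CARD('d)) * (2 * \<epsilon>)) ^ Suc m"
    by (simp add: power_mult_distrib mult_ac)
  finally show ?thesis .
qed

text \<open>The initial state and the coins are independent, so \<open>S\<close> is split into a
  part that is closed at time 0 and a part hit by rare coins; summing over all splittings gives the
  binomial formula. As \<open>n \<le> L\<close>, the whole run lies in block 0.\<close>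

lemma speed_bad_prob:
  assumes K: "0 < K" and L: "L = K * N" and n: "n \<le> L" and \<epsilon>: "0 \<le> \<epsilon>" "\<epsilon> \<le> 1" "\<delta> \<le> \<epsilon>\<^sup>2" and S: "finite S"
  shows "(\<Sum>\<omega>\<in>{\<omega>\<in>YS \<times> seqs n. S \<subseteq> closed_np (fst \<omega>) \<union> {a\<in>E. \<exists>i<n. fst (snd \<omega> i) = a \<and> snd (snd \<omega> i) < 2}}.
      cond_fk (fst \<omega>) * sw n (snd \<omega>)) \<le> (2 * \<epsilon> + 3 * real K * \<delta>) ^ card S"
proof -
  define H where "H \<xi> = {a\<in>E. \<exists>i<n. fst (\<xi> i) = a \<and> snd (\<xi> i) < (2::nat)}" for \<xi> :: "nat \<Rightarrow> ('d \<Rightarrow> int) set \<times> nat"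
  have cn: "0 \<le> cond_fk y" for y using cond_fk_pos[of y] by simp
  have coin: "(\<Sum>\<xi>\<in>{\<xi>\<in>seqs n. S' \<subseteq> H \<xi>}. sw n \<xi>) \<le> (3 * real K * \<delta>) ^ card S'" if S': "finite S'" for S'
  proof (cases "S' \<subseteq> E")
    case False
    then have "{\<xi>\<in>seqs n. S' \<subseteq> H \<xi>} = {}" by (auto simp: H_def)
    then show ?thesis using theta_bounds(4) by (simp only: sum.empty) simp
  next
    case True
    have "i div L = 0" if "i < n" for i using that n by simp
    then have bc: "bad_coin \<xi> a 0 L n \<longleftrightarrow> (\<exists>i<n. fst (\<xi> i) = a \<and> snd (\<xi> i) < 2)" for \<xi> a
      unfolding bad_coin_def by blast
    have "S' \<subseteq> H \<xi> \<longleftrightarrow> (\<forall>a\<in>S'. bad_coin \<xi> a 0 L n)" for \<xi>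
      unfolding H_def bc using True by blast
    then have eq: "{\<xi>\<in>seqs n. S' \<subseteq> H \<xi>} = {\<xi>\<in>seqs n. (\<forall>(a, j)\<in>S' \<times> {0}. bad_coin \<xi> a j L n) \<and>
        (\<forall>(a, j)\<in>{}. no_good_coin \<xi> a j L n)}"
      by auto
    have "(\<Sum>\<xi>\<in>{\<xi>\<in>seqs n. S' \<subseteq> H \<xi>}. sw n \<xi>)
        \<le> (3 * real K * \<delta>) ^ card (S' \<times> {0::nat}) * exp (- ((1 - \<theta>2) * real K)) ^ card ({} :: (('d \<Rightarrow> int) set \<times> nat) set)"
      unfolding eq by (rule coin_pattern_prob[OF K L]) (use S' True in auto)
    then show ?thesis by (simp add: card_cartesian_product)
  qed
  have "(\<Sum>\<omega>\<in>{\<omega>\<in>YS \<times> seqs n. S \<subseteq> closed_np (fst \<omega>) \<union> H (snd \<omega>)}. cond_fk (fst \<omega>) * sw n (snd \<omega>))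
      \<le> (\<Sum>S'\<in>Pow S. \<Sum>\<omega>\<in>{\<omega>\<in>YS \<times> seqs n. S' \<subseteq> closed_np (fst \<omega>) \<and> S - S' \<subseteq> H (snd \<omega>)}.
          cond_fk (fst \<omega>) * sw n (snd \<omega>))"
  proof (rule sum_union_bound)
    show "finite (YS \<times> seqs n)" using finYS fin_seqs by auto
    show "finite (Pow S)" using S by simp
    show "0 \<le> cond_fk (fst \<omega>) * sw n (snd \<omega>)" if "\<omega> \<in> YS \<times> seqs n" for \<omega>
      using that cn sw_nonneg by auto
    show "\<exists>S'\<in>Pow S. S' \<subseteq> closed_np (fst \<omega>) \<and> S - S' \<subseteq> H (snd \<omega>)"
      if "S \<subseteq> closed_np (fst \<omega>) \<union> H (snd \<omega>)" for \<omega>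
      using that by (intro bexI[of _ "S \<inter> closed_np (fst \<omega>)"]) auto
  qed
  also have "\<dots> \<le> (\<Sum>S'\<in>Pow S. (2 * \<epsilon>) ^ card S' * (3 * real K * \<delta>) ^ card (S - S'))"
  proof (rule sum_mono)
    fix S' assume "S' \<in> Pow S"
    then have fin: "finite S'" "finite (S - S')" using S finite_subset by auto
    show "(\<Sum>\<omega>\<in>{\<omega>\<in>YS \<times> seqs n. S' \<subseteq> closed_np (fst \<omega>) \<and> S - S' \<subseteq> H (snd \<omega>)}. cond_fk (fst \<omega>) * sw n (snd \<omega>))
        \<le> (2 * \<epsilon>) ^ card S' * (3 * real K * \<delta>) ^ card (S - S')"
      unfolding sum_filter_Times[where f = cond_fk and g = "sw n" and A = YS and B = "seqs n"
          and P = "\<lambda>y. S' \<subseteq> closed_np y" and Q = "\<lambda>\<xi>. S - S' \<subseteq> H \<xi>"]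
      by (rule mult_mono[OF closed_np_prob[OF fin(1) \<epsilon>] coin[OF fin(2)]])
        (use \<epsilon> sw_nonneg in \<open>auto intro!: sum_nonneg\<close>)
  qed
  also have "\<dots> = (2 * \<epsilon> + 3 * real K * \<delta>) ^ card S" by (rule sum_Pow_split[OF S])
  finally show ?thesis unfolding H_def .
qed

text \<open>Self-adjointness reverses time: \<open>h\<close> pivotal first and its surroundings
  clear later is as likely as clear surroundings first and \<open>h\<close> pivotal later, and the
  latter forces the walk of \<open>new_pivotal_walk\<close>.\<close>

lemma speed_prob:
  assumes K: "0 < K" and L: "L = K * N" and n: "n \<le> L" and \<epsilon>: "0 \<le> \<epsilon>" "\<epsilon> \<le> 1" "\<delta> \<le> \<epsilon>\<^sup>2"
    and R: "2 * m + 2 \<le> R" and h: "x0 \<in> h"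
  shows "(\<Sum>y\<in>YS. cond_fk y * (of_bool (h \<in> piv y) * (avg ystep ^^ n) (\<lambda>y'. of_bool (clear x0 R (dead \<union> piv y'))) y))
    \<le> real ((25::nat) ^ CARD('d)) ^ m * (2 * \<epsilon> + 3 * real K * \<delta>) ^ Suc m"
proof -
  define H where "H \<omega> = closed_np (fst \<omega>) \<union> {a\<in>E. \<exists>i<n. fst (snd \<omega> i) = a \<and> snd (snd \<omega> i) < 2}"
    for \<omega> :: "('d \<Rightarrow> int) set set \<times> (nat \<Rightarrow> ('d \<Rightarrow> int) set \<times> nat)"
  let ?\<Omega> = "YS \<times> seqs n" and ?w = "\<lambda>\<omega>. cond_fk (fst \<omega>) * sw n (snd \<omega>)"
  have fin: "finite ?\<Omega>" using finYS fin_seqs by auto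
  have wn: "0 \<le> ?w \<omega>" if "\<omega> \<in> ?\<Omega>" for \<omega>
    using that cond_fk_pos[of "fst \<omega>"] sw_nonneg[of "snd \<omega>" n] by auto
  let ?ev = "\<lambda>\<omega>. clear x0 R (dead \<union> piv (fst \<omega>)) \<and> h \<in> piv (traj ystep (fst \<omega>) (snd \<omega>) n)"
  have "(\<Sum>y\<in>YS. cond_fk y * (of_bool (h \<in> piv y) * (avg ystep ^^ n) (\<lambda>y'. of_bool (clear x0 R (dead \<union> piv y'))) y))
      = (\<Sum>y\<in>YS. cond_fk y * ((avg ystep ^^ n) (\<lambda>y. of_bool (h \<in> piv y)) y * of_bool (clear x0 R (dead \<union> piv y))))"
    by (rule avg_ystep_pow_self_adjoint)
  also have "\<dots> = (\<Sum>y\<in>YS. \<Sum>\<xi>\<in>seqs n. if ?ev (y, \<xi>) then ?w (y, \<xi>) else 0)"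
    unfolding expec_traj[symmetric] expec_def
    by (intro sum.cong refl) (auto simp: sum_distrib_left of_bool_def intro!: sum.cong)
  also have "\<dots> = (\<Sum>\<omega>\<in>{\<omega>\<in>?\<Omega>. ?ev \<omega>}. ?w \<omega>)"
    using fin by (simp add: sum.inter_filter sum.cartesian_product')
  also have "\<dots> \<le> (\<Sum>\<omega>\<in>{\<omega>\<in>?\<Omega>. \<exists>xs\<in>walks star h m. distinct xs \<and> set xs \<subseteq> H \<omega>}. ?w \<omega>)"
  proof (rule sum_event_mono[OF fin wn])
    fix \<omega> assume o: "\<omega> \<in> ?\<Omega>" "?ev \<omega>"
    show "\<exists>xs\<in>walks star h m. distinct xs \<and> set xs \<subseteq> H \<omega>"
      unfolding H_def
      by (rule new_pivotal_walk[of "fst \<omega>" n "snd \<omega>" h x0 R m]) (use o h R seqs_in[of "snd \<omega>" n] in auto)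
  qed
  also have "\<dots> \<le> real ((25::nat) ^ CARD('d)) ^ m * (2 * \<epsilon> + 3 * real K * \<delta>) ^ Suc m"
  proof (rule walk_union_bound[OF fin wn star_degree])
    fix S :: "('d \<Rightarrow> int) set set" assume "finite S"
    then show "(\<Sum>\<omega>\<in>{\<omega>\<in>?\<Omega>. S \<subseteq> H \<omega>}. ?w \<omega>) \<le> (2 * \<epsilon> + 3 * real K * \<delta>) ^ card S"
      unfolding H_def by (rule speed_bad_prob[OF K L n \<epsilon>])
  qed (use \<epsilon> theta_bounds(4) in auto)
  finally show ?thesis .
qed

lemma bad_site_prob:
  assumes K: "0 < K" and L: "L = K * N" and S: "finite S"
  shows "(\<Sum>\<xi>\<in>{\<xi>\<in>seqs n. S \<subseteq> {\<sigma>. bad_site \<xi> L n \<sigma>}}. sw n \<xi>)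
    \<le> (3 * real K * \<delta> + exp (- ((1 - \<theta>2) * real K))) ^ card S"
proof (cases "\<forall>\<sigma>\<in>S. fst \<sigma> \<in> E \<and> Suc (snd \<sigma>) * L \<le> n")
  case False
  then have "{\<xi>\<in>seqs n. S \<subseteq> {\<sigma>. bad_site \<xi> L n \<sigma>}} = {}" by (auto simp: bad_site_def)
  then show ?thesis using theta_bounds(4) by (simp only: sum.empty) simp
next
  case True
  let ?ev = "\<lambda>S' \<xi>. (\<forall>(a, j)\<in>S'. bad_coin \<xi> a j L n) \<and> (\<forall>(a, j)\<in>S - S'. no_good_coin \<xi> a j L n)"
  have "(\<Sum>\<xi>\<in>{\<xi>\<in>seqs n. S \<subseteq> {\<sigma>. bad_site \<xi> L n \<sigma>}}. sw n \<xi>) \<le> (\<Sum>S'\<in>Pow S. \<Sum>\<xi>\<in>{\<xi>\<in>seqs n. ?ev S' \<xi>}. sw n \<xi>)"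
  proof (rule sum_union_bound[OF fin_seqs _ sw_nonneg])
    show "finite (Pow S)" using S by simp
    fix \<xi> assume "S \<subseteq> {\<sigma>. bad_site \<xi> L n \<sigma>}"
    then show "\<exists>S'\<in>Pow S. ?ev S' \<xi>"
      by (intro bexI[of _ "{\<sigma>\<in>S. bad_coin \<xi> (fst \<sigma>) (snd \<sigma>) L n}"]) (auto simp: bad_site_def)
  qed
  also have "\<dots> \<le> (\<Sum>S'\<in>Pow S. (3 * real K * \<delta>) ^ card S' * exp (- ((1 - \<theta>2) * real K)) ^ card (S - S'))"
  proof (rule sum_mono)
    fix S' assume S': "S' \<in> Pow S"
    then have fin: "finite S'" "finite (S - S')" using S finite_subset by auto
    show "(\<Sum>\<xi>\<in>{\<xi>\<in>seqs n. ?ev S' \<xi>}. sw n \<xi>)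
        \<le> (3 * real K * \<delta>) ^ card S' * exp (- ((1 - \<theta>2) * real K)) ^ card (S - S')"
      by (rule coin_pattern_prob[OF K L fin(1) _ fin(2)]) (use S' True in force)+
  qed
  also have "\<dots> = (3 * real K * \<delta> + exp (- ((1 - \<theta>2) * real K))) ^ card S" by (rule sum_Pow_split[OF S])
  finally show ?thesis .
qed

lemma bad_site_walk_prob:
  assumes K: "0 < K" and L: "L = K * N"
  shows "(\<Sum>\<xi>\<in>{\<xi>\<in>seqs n. \<exists>xs\<in>walks site_adj \<sigma> m. distinct xs \<and> set xs \<subseteq> {\<sigma>. bad_site \<xi> L n \<sigma>}}. sw n \<xi>)
    \<le> real (5 * (25::nat) ^ CARD('d)) ^ m * (3 * real K * \<delta> + exp (- ((1 - \<theta>2) * real K))) ^ Suc m"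
  by (rule walk_union_bound[OF fin_seqs sw_nonneg site_adj_degree bad_site_prob[OF K L]])
    (use theta_bounds(4) in auto)

end

section \<open>Propagation over many blocks\<close>

lemma edge_radius_shift:
  assumes h: "h \<in> lattice_edges" "c \<in> h" and f: "f \<in> lattice_edges"
  shows "edge_radius x0 f \<le> edge_radius x0 h + 1 + edge_radius c f"
proof -
  obtain v where v: "v \<in> f" "l1dist c v = edge_radius c f" using edge_radius_obtain[OF f] .
  obtain u where u: "u \<in> h" "l1dist x0 u = edge_radius x0 h" using edge_radius_obtain[OF h(1)] .
  have "edge_radius x0 f \<le> l1dist x0 v" by (rule edge_radius_le[OF f v(1)])
  also have "\<dots> \<le> l1dist x0 u + l1dist u v" by (rule l1dist_triangle)
  also have "l1dist u v \<le> l1dist u c + l1dist c v" by (rule l1dist_triangle)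
  finally show ?thesis using u v lattice_edge_diam[OF h(1) u(1) h(2)] by linarith
qed

lemma power_exp_bound:
  fixes x \<eta> D :: real
  assumes "0 \<le> x" "x \<le> \<eta>" "1 \<le> D" "D * \<eta> \<le> exp (- 1)"
  shows "D ^ m * x ^ Suc m \<le> exp (- real m)"
proof -
  have "\<eta> \<le> D * \<eta>" using assms by (simp add: mult_le_cancel_right1)
  also have "\<dots> \<le> 1" using assms(4) by (rule order.trans) simp
  finally have x1: "x \<le> 1" using assms(2) by simp
  have "D ^ m * x ^ Suc m = (D * x) ^ m * x" by (simp add: power_mult_distrib)
  also have "\<dots> \<le> exp (- 1) ^ m * 1"
  proof (rule mult_mono)
    have "D * x \<le> D * \<eta>" using assms by (intro mult_left_mono) auto
    then have "D * x \<le> exp (- 1)" using assms(4) by linarith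
    then show "(D * x) ^ m \<le> exp (- 1) ^ m" by (rule power_mono) (use assms in auto)
  qed (use assms x1 in auto)
  finally show ?thesis using exp_of_nat_mult[of m "- 1 :: real"] by simp
qed

context fk_box
begin

text \<open>Each block costs \<open>l + 1\<close>, where 1 is the diameter of an edge: a pivotal
  edge inside the reduced ball would have everything in \<open>dead \<union> piv\<close> at a time
  at most one block later at distance at least \<open>l\<close>, which \<open>slow\<close>
  forbids.\<close>

lemma clear_backwards:
  assumes slow: "\<And>t1 t2 h. t1 \<le> t2 \<Longrightarrow> t2 \<le> n \<Longrightarrow> t2 - t1 \<le> L \<Longrightarrow> h \<in> piv (Y t1) \<Longrightarrow>
      \<not> clear (ctr h) l (dead \<union> piv (Y t2))"
    and cl: "clear x0 R (dead \<union> piv (Y n))" and t: "t \<le> n" "n - t \<le> j * L"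
  shows "clear x0 (R - j * (l + 1)) (dead \<union> piv (Y t))"
  using t
proof (induction j arbitrary: t)
  case 0
  then show ?case using cl by simp
next
  case (Suc j)
  \<comment> \<open>At most one block after \<open>t\<close>; the maximum covers the case that
    \<open>t\<close> is already in the range of the induction hypothesis.\<close>
  let ?t = "max t (n - j * L)"
  have IH: "clear x0 (R - j * (l + 1)) (dead \<union> piv (Y ?t))"
    by (rule Suc.IH) (use Suc.prems in auto)
  have dl: "f \<in> lattice_edges" if "f \<in> dead \<union> piv y" for f y
    using that E_lattice by (auto simp: pivotal_def)
  show ?case
    unfolding clear_def
  proof
    fix f assume f: "f \<in> dead \<union> piv (Y t)"
    show "R - Suc j * (l + 1) \<le> edge_radius x0 f"
    proof (cases "f \<in> dead")
      case True
      then have "R - j * (l + 1) \<le> edge_radius x0 f" using IH unfolding clear_def by blast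
      then show ?thesis by simp
    next
      case False
      then have fp: "f \<in> piv (Y t)" using f by blast
      show ?thesis
      proof (rule ccontr)
        assume less: "\<not> ?thesis"
        have fL: "f \<in> lattice_edges" using dl[OF f] .
        have "clear (ctr f) l (dead \<union> piv (Y ?t))"
          unfolding clear_def
        proof
          fix g assume g: "g \<in> dead \<union> piv (Y ?t)"
          have "R - j * (l + 1) \<le> edge_radius x0 g" using IH g unfolding clear_def by blast
          also have "\<dots> \<le> edge_radius x0 f + 1 + edge_radius (ctr f) g"
            by (rule edge_radius_shift[OF fL ctr_in[OF fL] dl[OF g]])
          finally show "l \<le> edge_radius (ctr f) g" using less by simp
        qed
        moreover have "?t - t \<le> L" using Suc.prems by auto
        ultimately show False using slow[of t ?t f] fp Suc.prems by auto
      qed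
    qed
  qed
qed

text \<open>Coins after \<open>t2\<close> integrate out, the Markov property separates the two
  times, stationarity moves \<open>t1\<close> to 0, and \<open>Y_marginal\<close> passes to
  \<open>cond_fk\<close>, where \<open>speed_prob\<close> applies with \<open>t2 - t1\<close>
  steps.\<close>

lemma pair_prob:
  assumes st: "stationary_dist V E T B p q \<mu>"
    and K: "0 < K" and L: "L = K * N" and \<epsilon>: "0 \<le> \<epsilon>" "\<epsilon> \<le> 1" "\<delta> \<le> \<epsilon>\<^sup>2"
    and t: "t1 \<le> t2" "t2 \<le> n" "t2 - t1 \<le> L" and h: "h \<in> E" and R: "2 * m + 2 \<le> R"
  shows "(\<Sum>\<omega>\<in>{\<omega>\<in>CS \<times> seqs n. h \<in> piv (snd (traj cstep (fst \<omega>) (snd \<omega>) t1)) \<and>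
        clear (ctr h) R (dead \<union> piv (snd (traj cstep (fst \<omega>) (snd \<omega>) t2)))}. \<mu> (fst \<omega>) * sw n (snd \<omega>))
    \<le> real ((25::nat) ^ CARD('d)) ^ m * (2 * \<epsilon> + 3 * real K * \<delta>) ^ Suc m"
proof -
  define f where "f y = (of_bool (h \<in> piv y) :: real)" for y
  define g where "g y = (of_bool (clear (ctr h) R (dead \<union> piv y)) :: real)" for y
  let ?P = "\<lambda>s \<xi>. h \<in> piv (snd (traj cstep s \<xi> t1)) \<and> clear (ctr h) R (dead \<union> piv (snd (traj cstep s \<xi> t2)))"
  let ?F = "\<lambda>s \<xi>. f (snd (traj cstep s \<xi> t1)) * g (snd (traj cstep s \<xi> t2))"
  obtain b where b: "t2 = t1 + b" using t(1) le_Suc_ex by blast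
  have bL: "b \<le> L" using t(3) b by simp
  have "(\<Sum>\<omega>\<in>{\<omega>\<in>CS \<times> seqs n. ?P (fst \<omega>) (snd \<omega>)}. \<mu> (fst \<omega>) * sw n (snd \<omega>))
      = (\<Sum>\<omega>\<in>CS \<times> seqs n. if ?P (fst \<omega>) (snd \<omega>) then \<mu> (fst \<omega>) * sw n (snd \<omega>) else 0)"
    by (rule sum.inter_filter) (use fin_CS fin_seqs in auto)
  also have "\<dots> = (\<Sum>s\<in>CS. \<mu> s * expec n (?F s))"
    unfolding sum.cartesian_product' expec_def sum_distrib_left
    by (intro sum.cong refl) (simp add: f_def g_def)
  also have "\<dots> = (\<Sum>s\<in>CS. \<mu> s * expec t2 (?F s))"
  proof (intro sum.cong refl arg_cong2[where f = "(*)"])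
    fix s
    have "expec (t2 + (n - t2)) (?F s) = expec t2 (?F s)"
    proof (rule expec_restrict)
      fix \<xi> \<xi>' :: "nat \<Rightarrow> ('d \<Rightarrow> int) set \<times> nat" assume "\<And>i. i < t2 \<Longrightarrow> \<xi> i = \<xi>' i"
      then have "traj cstep s \<xi> t1 = traj cstep s \<xi>' t1" "traj cstep s \<xi> t2 = traj cstep s \<xi>' t2"
        using t(1) by (auto intro!: traj_cong)
      then show "?F s \<xi> = ?F s \<xi>'" by simp
    qed
    then show "expec n (?F s) = expec t2 (?F s)" using t(2) by simp
  qed
  also have "\<dots> = (\<Sum>s\<in>CS. \<mu> s * (avg cstep ^^ t1) (\<lambda>s'. f (snd s') * (avg cstep ^^ b) (\<lambda>s. g (snd s)) s') s)"
    unfolding b by (intro sum.cong refl arg_cong2[where f = "(*)"] expec_traj2)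
  also have "\<dots> = (\<Sum>s\<in>CS. \<mu> s * (f (snd s) * (avg cstep ^^ b) (\<lambda>s. g (snd s)) s))"
    by (rule stationary_avg_pow[OF st])
  also have "\<dots> = (\<Sum>s\<in>CS. \<mu> s * (f (snd s) * (avg ystep ^^ b) g (snd s)))"
    unfolding avg_snd ..
  also have "\<dots> = (\<Sum>y\<in>YS. cond_fk y * (f y * (avg ystep ^^ b) g y))"
    by (rule Y_marginal[OF st])
  also have "\<dots> \<le> real ((25::nat) ^ CARD('d)) ^ m * (2 * \<epsilon> + 3 * real K * \<delta>) ^ Suc m"
    unfolding f_def g_def
    by (rule speed_prob[OF K L bL \<epsilon> R]) (use h E_lattice ctr_in in blast)
  finally show ?thesis .
qed

text \<open>For an interface edge the stationary chain is run for \<open>n = W * L\<close> steps and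
  observed at the end, which provides a past to explore. In the last factor, the square counts pairs
  of times between which pivotal edges may spread too fast, and 3 is 1 for isolated pivotal edges
  plus 2 for the blocks in which a walk of bad sites may start.\<close>

lemma far_edge_prob:
  fixes m K :: nat
  assumes st: "stationary_dist V E T B p q \<mu>"
    and K: "0 < K" and \<epsilon>: "0 \<le> \<epsilon>" "\<epsilon> \<le> 1" "\<delta> \<le> \<epsilon>\<^sup>2"
    and small: "5 * 25 ^ CARD('d) * (2 * \<epsilon> + 3 * real K * \<delta> + exp (- ((1 - \<theta>2) * real K))) \<le> exp (- 1)"
    and R: "(2 * m + 5) * (2 * m + 3) \<le> R"
  shows "(\<Sum>s\<in>{s\<in>CS. \<exists>e\<in>piv (snd s) \<union> intf (fst s) (snd s). clear (ctr e) R (dead \<union> piv (snd s) - {e})}. \<mu> s)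
    \<le> real N * exp (- real m) * (3 + (real ((2 * m + 4) * (K * N)) + 1)\<^sup>2)"
proof -
  define W where "W = 2 * m + 4"
  define L where "L = K * N"
  define n where "n = W * L"
  define D :: real where "D = 25 ^ CARD('d)"
  define \<eta> where "\<eta> = 2 * \<epsilon> + 3 * real K * \<delta> + exp (- ((1 - \<theta>2) * real K))"
  have D1: "1 \<le> D" unfolding D_def by simp
  have \<eta>0: "0 \<le> \<eta>" using \<epsilon> theta_bounds(4) by (simp add: \<eta>_def)
  have D5: "5 * D * \<eta> \<le> exp (- 1)" using small by (simp add: D_def \<eta>_def)
  have "D * \<eta> \<le> 5 * D * \<eta>" using D1 \<eta>0 by simp
  then have D\<eta>: "D * \<eta> \<le> exp (- 1)" using D5 by linarith
  have Lpos: "0 < L" using K N_pos by (simp add: L_def)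
  have \<mu>: "\<And>s. 0 \<le> \<mu> s" "(\<Sum>s\<in>CS. \<mu> s) = 1" using st unfolding stationary_dist_def by blast+
  define ev1 where "ev1 s \<longleftrightarrow> (\<exists>e\<in>piv (snd s). clear (ctr e) R (dead \<union> piv (snd s) - {e}))"
    for s :: "('d \<Rightarrow> int) set set \<times> ('d \<Rightarrow> int) set set"
  define ev2 where "ev2 s \<longleftrightarrow> (\<exists>e\<in>intf (fst s) (snd s). clear (ctr e) R (dead \<union> piv (snd s)))"
    for s :: "('d \<Rightarrow> int) set set \<times> ('d \<Rightarrow> int) set set"
  have "(\<Sum>s\<in>{s\<in>CS. \<exists>e\<in>piv (snd s) \<union> intf (fst s) (snd s). clear (ctr e) R (dead \<union> piv (snd s) - {e})}. \<mu> s)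
      \<le> (\<Sum>s\<in>{s\<in>CS. ev1 s}. \<mu> s) + (\<Sum>s\<in>{s\<in>CS. ev2 s}. \<mu> s)"
  proof (rule sum_event_Un[OF fin_CS \<mu>(1)])
    fix s assume "\<exists>e\<in>piv (snd s) \<union> intf (fst s) (snd s). clear (ctr e) R (dead \<union> piv (snd s) - {e})"
    then obtain e where e: "e \<in> piv (snd s) \<union> intf (fst s) (snd s)" "clear (ctr e) R (dead \<union> piv (snd s) - {e})"
      by blast
    show "ev1 s \<or> ev2 s"
    proof (cases "e \<in> piv (snd s)")
      case True
      then show ?thesis using e by (auto simp: ev1_def)
    next
      case False
      \<comment> \<open>An interface edge that is not pivotal does not belong to
        \<open>dead \<union> piv (snd s)\<close> at all, so deleting \<open>{e}\<close> changes
        nothing.\<close>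
      then have "e \<in> intf (fst s) (snd s)" "e \<notin> dead \<union> piv (snd s)" using e by (auto simp: interface_def)
      then show ?thesis using e(2) by (auto simp: ev2_def)
    qed
  qed
  moreover have "(\<Sum>s\<in>{s\<in>CS. ev1 s}. \<mu> s) \<le> real N * exp (- real m)"
  proof -
    have "2 * m + 3 \<le> R" using R by (rule order.trans[rotated]) simp
    then have "(\<Sum>s\<in>{s\<in>CS. ev1 s}. \<mu> s) \<le> real N * (real ((25::nat) ^ CARD('d)) * (2 * \<epsilon>)) ^ Suc m"
      unfolding ev1_def by (rule isolated_pivotal_prob[OF st \<epsilon>])
    also have "\<dots> \<le> real N * exp (- 1) ^ Suc m"
    proof (intro mult_left_mono power_mono)
      have "2 * \<epsilon> \<le> \<eta>" using theta_bounds(4) by (simp add: \<eta>_def)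
      then have "D * (2 * \<epsilon>) \<le> D * \<eta>" using D1 by (intro mult_left_mono) auto
      then have "D * (2 * \<epsilon>) \<le> exp (- 1)" using D\<eta> by linarith
      then show "real ((25::nat) ^ CARD('d)) * (2 * \<epsilon>) \<le> exp (- 1)" by (simp add: D_def)
    qed (use \<epsilon> in auto)
    also have "exp (- 1 :: real) ^ Suc m \<le> exp (- real m)"
      using exp_of_nat_mult[of m "- 1 :: real"] by (simp add: mult_left_le_one_le)
    finally show ?thesis by (simp add: mult_left_mono)
  qed
  moreover have "(\<Sum>s\<in>{s\<in>CS. ev2 s}. \<mu> s) \<le> real N * exp (- real m) * (2 + (real n + 1)\<^sup>2)"
  proof -
    let ?\<Omega> = "CS \<times> seqs n" and ?w = "\<lambda>\<omega>. \<mu> (fst \<omega>) * sw n (snd \<omega>)"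
    have fin: "finite ?\<Omega>" using fin_CS fin_seqs by auto
    have wn: "0 \<le> ?w \<omega>" if "\<omega> \<in> ?\<Omega>" for \<omega> using that \<mu>(1)[of "fst \<omega>"] sw_nonneg[of "snd \<omega>" n] by auto
    define pairbad where "pairbad i \<omega> \<longleftrightarrow> fst i \<in> piv (snd (traj cstep (fst \<omega>) (snd \<omega>) (fst (snd i)))) \<and>
        clear (ctr (fst i)) (2 * m + 2) (dead \<union> piv (snd (traj cstep (fst \<omega>) (snd \<omega>) (snd (snd i)))))"
      for i and \<omega> :: "(('d \<Rightarrow> int) set set \<times> ('d \<Rightarrow> int) set set) \<times> (nat \<Rightarrow> ('d \<Rightarrow> int) set \<times> nat)"
    define I1 where "I1 = {i \<in> E \<times> ({..n} \<times> {..n}). fst (snd i) \<le> snd (snd i) \<and> snd (snd i) - fst (snd i) \<le> L}"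
    define I2 where "I2 = E \<times> {W - 1, W - 2}"
    define walkbad where "walkbad \<sigma> \<xi> \<longleftrightarrow> (\<exists>xs\<in>walks site_adj \<sigma> m. distinct xs \<and> set xs \<subseteq> {\<sigma>. bad_site \<xi> L n \<sigma>})"
      for \<sigma> \<xi>
    have "(\<Sum>s\<in>{s\<in>CS. ev2 s}. \<mu> s) = (\<Sum>s\<in>CS. \<mu> s * of_bool (ev2 s))"
      using fin_CS by (simp add: sum.inter_filter of_bool_def if_distrib cong: if_cong)
    also have "\<dots> = (\<Sum>s\<in>CS. \<mu> s * expec n (\<lambda>\<xi>. of_bool (ev2 (traj cstep s \<xi> n))))"
      unfolding expec_traj[where g = "\<lambda>s. of_bool (ev2 s)"] by (rule stationary_avg_pow[OF st, symmetric])
    also have "\<dots> = (\<Sum>\<omega>\<in>?\<Omega>. if ev2 (traj cstep (fst \<omega>) (snd \<omega>) n) then ?w \<omega> else 0)"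
      unfolding sum.cartesian_product' expec_def sum_distrib_left
      by (intro sum.cong refl) simp
    also have "\<dots> = (\<Sum>\<omega>\<in>{\<omega>\<in>?\<Omega>. ev2 (traj cstep (fst \<omega>) (snd \<omega>) n)}. ?w \<omega>)"
      by (rule sum.inter_filter[symmetric]) (rule fin)
    also have "\<dots> \<le> (\<Sum>\<omega>\<in>{\<omega>\<in>?\<Omega>. \<exists>i\<in>I1. pairbad i \<omega>}. ?w \<omega>) + (\<Sum>\<omega>\<in>{\<omega>\<in>?\<Omega>. \<exists>\<sigma>\<in>I2. walkbad \<sigma> (snd \<omega>)}. ?w \<omega>)"
    proof (rule sum_event_Un[OF fin wn])
      fix \<omega> assume o: "\<omega> \<in> ?\<Omega>" "ev2 (traj cstep (fst \<omega>) (snd \<omega>) n)"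
      obtain s \<xi> where \<omega>: "\<omega> = (s, \<xi>)" by (cases \<omega>)
      have s: "s \<in> CS" and \<xi>: "\<And>i. i < n \<Longrightarrow> \<xi> i \<in> coins" using o(1) \<omega> seqs_in by auto
      define Y where "Y t = traj ystep (snd s) \<xi> t" for t
      obtain e where e: "e \<in> intf (fst (traj cstep s \<xi> n)) (snd (traj cstep s \<xi> n))"
        and cl: "clear (ctr e) R (dead \<union> piv (Y n))"
        using o(2) by (auto simp: ev2_def \<omega> Y_def snd_traj)
      have eE: "e \<in> E" using e by (simp add: interface_def)
      show "(\<exists>i\<in>I1. pairbad i \<omega>) \<or> (\<exists>\<sigma>\<in>I2. walkbad \<sigma> (snd \<omega>))"
      proof (cases "\<exists>i\<in>I1. pairbad i \<omega>")
        case False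
        have slow: "\<not> clear (ctr h) (2 * m + 2) (dead \<union> piv (Y t2))"
          if "t1 \<le> t2" "t2 \<le> n" "t2 - t1 \<le> L" "h \<in> piv (Y t1)" for t1 t2 h
        proof
          assume "clear (ctr h) (2 * m + 2) (dead \<union> piv (Y t2))"
          then have "pairbad (h, t1, t2) \<omega>" using that by (simp add: pairbad_def \<omega> Y_def snd_traj)
          moreover have "(h, t1, t2) \<in> I1" using that by (auto simp: I1_def pivotal_def)
          ultimately show False using False by blast
        qed
        have "clear (ctr e) (2 * m + 2) (dead \<union> piv (Y t))" if "t \<le> n" for t
        proof -
          have "clear (ctr e) (R - W * (2 * m + 2 + 1)) (dead \<union> piv (Y t))"
            by (rule clear_backwards[where Y = Y and n = n and L = L, OF slow cl that]) (simp_all add: n_def)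
          \<comment> \<open>The \<open>W = 2 * m + 4\<close> blocks cost \<open>2 * m + 3\<close>
            each, and \<open>R\<close> holds one such amount in reserve, enough for the radius that
            \<open>interface_walk\<close> requires.\<close>
          moreover have "2 * m + 2 \<le> R - W * (2 * m + 2 + 1)"
          proof -
            have "(2 * m + 5) * (2 * m + 3) = W * (2 * m + 2 + 1) + (2 * m + 3)" by (simp add: W_def algebra_simps)
            then show ?thesis using R by linarith
          qed
          ultimately show ?thesis unfolding clear_def by (meson order.trans)
        qed
        then have "\<exists>j\<in>{W - 1, W - 2}. \<exists>xs\<in>walks site_adj (e, j) m. distinct xs \<and> set xs \<subseteq> {\<sigma>. bad_site \<xi> L n \<sigma>}"
          using eE E_lattice ctr_in
          by (intro interface_walk[OF s \<xi> Lpos n_def e, of "ctr e" "2 * m + 2"]) (auto simp: Y_def W_def)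
        then have "\<exists>\<sigma>\<in>I2. walkbad \<sigma> \<xi>" using eE unfolding I2_def walkbad_def by blast
        then show ?thesis by (simp add: \<omega>)
      qed blast
    qed
    also have "(\<Sum>\<omega>\<in>{\<omega>\<in>?\<Omega>. \<exists>i\<in>I1. pairbad i \<omega>}. ?w \<omega>) \<le> real N * (real n + 1)\<^sup>2 * exp (- real m)"
    proof -
      have finI1: "finite I1" using finE by (simp add: I1_def)
      have "(\<Sum>\<omega>\<in>{\<omega>\<in>?\<Omega>. \<exists>i\<in>I1. pairbad i \<omega>}. ?w \<omega>) \<le> (\<Sum>i\<in>I1. \<Sum>\<omega>\<in>{\<omega>\<in>?\<Omega>. pairbad i \<omega>}. ?w \<omega>)"
        by (rule sum_union_bound[OF fin finI1 wn]) auto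
      also have "\<dots> \<le> (\<Sum>i\<in>I1. exp (- real m))"
      proof (rule sum_mono)
        fix i assume i: "i \<in> I1"
        have "(\<Sum>\<omega>\<in>{\<omega>\<in>?\<Omega>. pairbad i \<omega>}. ?w \<omega>)
            \<le> real ((25::nat) ^ CARD('d)) ^ m * (2 * \<epsilon> + 3 * real K * \<delta>) ^ Suc m"
          unfolding pairbad_def by (rule pair_prob[OF st K L_def \<epsilon>]) (use i in \<open>auto simp: I1_def\<close>)
        also have "\<dots> = D ^ m * (2 * \<epsilon> + 3 * real K * \<delta>) ^ Suc m" by (simp add: D_def)
        also have "\<dots> \<le> exp (- real m)"
          by (rule power_exp_bound[OF _ _ D1 D\<eta>]) (use \<epsilon> theta_bounds(4) in \<open>auto simp: \<eta>_def\<close>)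
        finally show "(\<Sum>\<omega>\<in>{\<omega>\<in>?\<Omega>. pairbad i \<omega>}. ?w \<omega>) \<le> exp (- real m)" .
      qed
      also have "\<dots> = real (card I1) * exp (- real m)" by simp
      also have "\<dots> \<le> real (N * ((n + 1) * (n + 1))) * exp (- real m)"
      proof (rule mult_right_mono)
        have "card I1 \<le> card (E \<times> ({..n} \<times> {..n}))" using finE by (intro card_mono) (auto simp: I1_def)
        then have "card I1 \<le> N * ((n + 1) * (n + 1))" by (simp add: card_cartesian_product)
        then show "real (card I1) \<le> real (N * ((n + 1) * (n + 1)))" by (simp only: of_nat_le_iff)
      qed simp
      also have "real (N * ((n + 1) * (n + 1))) = real N * (real n + 1)\<^sup>2"
        unfolding power2_eq_square of_nat_mult of_nat_add of_nat_1 ..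
      finally show ?thesis .
    qed
    also have "(\<Sum>\<omega>\<in>{\<omega>\<in>?\<Omega>. \<exists>\<sigma>\<in>I2. walkbad \<sigma> (snd \<omega>)}. ?w \<omega>) \<le> 2 * real N * exp (- real m)"
    proof -
      have finI2: "finite I2" using finE by (simp add: I2_def)
      have "(\<Sum>\<omega>\<in>{\<omega>\<in>?\<Omega>. \<exists>\<sigma>\<in>I2. walkbad \<sigma> (snd \<omega>)}. ?w \<omega>)
          \<le> (\<Sum>\<sigma>\<in>I2. \<Sum>\<omega>\<in>{\<omega>\<in>?\<Omega>. walkbad \<sigma> (snd \<omega>)}. ?w \<omega>)"
        by (rule sum_union_bound[OF fin finI2 wn]) auto
      also have "\<dots> \<le> (\<Sum>\<sigma>\<in>I2. exp (- real m))"
      proof (rule sum_mono)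
        fix \<sigma>
        have "(\<Sum>\<omega>\<in>{\<omega>\<in>?\<Omega>. walkbad \<sigma> (snd \<omega>)}. ?w \<omega>) = (\<Sum>\<xi>\<in>{\<xi>\<in>seqs n. walkbad \<sigma> \<xi>}. sw n \<xi>)"
          using sum_filter_Times[where f = \<mu> and g = "sw n" and A = CS and B = "seqs n"
              and P = "\<lambda>_. True" and Q = "walkbad \<sigma>"] \<mu>(2) by simp
        also have "\<dots> \<le> real (5 * (25::nat) ^ CARD('d)) ^ m * (3 * real K * \<delta> + exp (- ((1 - \<theta>2) * real K))) ^ Suc m"
          unfolding walkbad_def by (rule bad_site_walk_prob[OF K L_def])
        also have "\<dots> = (5 * D) ^ m * (3 * real K * \<delta> + exp (- ((1 - \<theta>2) * real K))) ^ Suc m" by (simp add: D_def)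
        also have "\<dots> \<le> exp (- real m)"
          by (rule power_exp_bound[OF _ _ _ D5]) (use \<epsilon> theta_bounds(4) D1 in \<open>auto simp: \<eta>_def\<close>)
        finally show "(\<Sum>\<omega>\<in>{\<omega>\<in>?\<Omega>. walkbad \<sigma> (snd \<omega>)}. ?w \<omega>) \<le> exp (- real m)" .
      qed
      also have "\<dots> = real (card I2) * exp (- real m)" by simp
      also have "card I2 = N * 2" by (simp add: I2_def card_cartesian_product W_def)
      finally show ?thesis by simp
    qed
    finally show ?thesis by (simp add: algebra_simps)
  qed
  ultimately have "(\<Sum>s\<in>{s\<in>CS. \<exists>e\<in>piv (snd s) \<union> intf (fst s) (snd s). clear (ctr e) R (dead \<union> piv (snd s) - {e})}. \<mu> s)
      \<le> real N * exp (- real m) * (3 + (real n + 1)\<^sup>2)"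
    by (simp add: algebra_simps)
  then show ?thesis by (simp add: n_def W_def L_def)
qed

end

section \<open>Conclusion\<close>

text \<open>Orthonormal rows of a square matrix give orthonormal columns, so \<open>x j\<close> is
  recovered from the frame coordinates of \<open>x\<close>, which are bounded by \<open>r\<close>,
  with coefficients bounded by 1.\<close>

lemma finite_box_V:
  fixes u :: "'d::finite \<Rightarrow> 'd \<Rightarrow> real"
  assumes "orthonormal_frame u"
  shows "finite (box_V u r)"
proof -
  define U :: "real ^ 'd ^ 'd" where "U = (\<chi> i j. u i j)"
  have row: "(\<Sum>j\<in>UNIV. u i j * u k j) = (if i = k then 1 else 0)" for i k
    using assms by (simp add: orthonormal_frame_def)
  have "U ** transpose U = mat 1"
    by (simp add: vec_eq_iff U_def matrix_matrix_mult_def transpose_def mat_def row)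
  then have "transpose U ** U = mat 1" by (simp add: matrix_left_right_inverse)
  then have "(transpose U ** U) $ j $ k = mat 1 $ j $ k" for j k by simp
  then have col: "(\<Sum>i\<in>UNIV. u i j * u i k) = (if j = k then 1 else 0)" for j k
    by (simp add: U_def matrix_matrix_mult_def transpose_def mat_def)
  have u1: "\<bar>u i j\<bar> \<le> 1" for i j
  proof -
    have "u i j * u i j \<le> (\<Sum>j\<in>UNIV. u i j * u i j)" by (rule member_le_sum) auto
    then have "(u i j)\<^sup>2 \<le> 1" using row[of i i] by (simp add: power2_eq_square)
    then show ?thesis by (simp add: abs_square_le_1)
  qed
  define M where "M = \<lceil>real CARD('d) * r\<rceil>"
  have "x \<in> PiE UNIV (\<lambda>_. {- M..M})" if x: "x \<in> box_V u r" for x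
  proof (rule PiE_I)
    fix j
    have "real_of_int (x j) = (\<Sum>k\<in>UNIV. (if j = k then 1 else 0) * real_of_int (x k))"
      by (simp add: if_distrib if_distribR cong: if_cong)
    also have "\<dots> = (\<Sum>k\<in>UNIV. \<Sum>i\<in>UNIV. u i j * (u i k * real_of_int (x k)))"
      by (simp add: col[symmetric] sum_distrib_right mult.assoc)
    also have "\<dots> = (\<Sum>i\<in>UNIV. u i j * (\<Sum>k\<in>UNIV. u i k * real_of_int (x k)))"
      by (subst sum.swap) (simp add: sum_distrib_left)
    finally have eq: "real_of_int (x j) = (\<Sum>i\<in>UNIV. u i j * (\<Sum>k\<in>UNIV. u i k * real_of_int (x k)))" .
    have "\<bar>real_of_int (x j)\<bar> \<le> (\<Sum>i\<in>UNIV. \<bar>u i j * (\<Sum>k\<in>UNIV. u i k * real_of_int (x k))\<bar>)"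
      unfolding eq by (rule sum_abs)
    also have "\<dots> \<le> (\<Sum>i\<in>(UNIV :: 'd set). r)"
    proof (rule sum_mono)
      fix i
      have "\<bar>\<Sum>k\<in>UNIV. u i k * real_of_int (x k)\<bar> \<le> r" using x by (simp add: box_V_def)
      then have "\<bar>u i j\<bar> * \<bar>\<Sum>k\<in>UNIV. u i k * real_of_int (x k)\<bar> \<le> 1 * r"
        using u1[of i j] by (intro mult_mono) auto
      then show "\<bar>u i j * (\<Sum>k\<in>UNIV. u i k * real_of_int (x k))\<bar> \<le> r" by (simp add: abs_mult)
    qed
    finally have "\<bar>real_of_int (x j)\<bar> \<le> real_of_int M" unfolding M_def by simp linarith
    then show "x j \<in> {- M..M}" by (simp add: abs_le_iff)
  qed auto
  then have "box_V u r \<subseteq> PiE UNIV (\<lambda>_. {- M..M})" by blast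
  moreover have "finite (PiE UNIV (\<lambda>_::'d. {- M..M}))" by (rule finite_PiE) auto
  ultimately show ?thesis by (rule finite_subset)
qed

lemma clear_of_set_edge_dist:
  assumes e: "e \<in> lattice_edges" and F: "F \<subseteq> lattice_edges" and R: "R \<le> set_edge_dist e F"
  shows "clear (ctr e) R F"
  unfolding clear_def
proof
  fix f assume f: "f \<in> F"
  then have fl: "f \<in> lattice_edges" using F by blast
  have "R \<le> edge_dist e f"
    using R cINF_lower[of "edge_dist e" F f] f unfolding set_edge_dist_def by simp
  moreover have "edge_dist e f \<le> l1dist (ctr e) y" if "y \<in> f" for y
    unfolding edge_dist_def
  proof (rule Min_le)
    have "{l1dist x y |x y. x \<in> e \<and> y \<in> f} = (\<lambda>(x, y). l1dist x y) ` (e \<times> f)" by auto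
    then show "finite {l1dist x y |x y. x \<in> e \<and> y \<in> f}"
      using lattice_edge_finite[OF e] lattice_edge_finite[OF fl] by simp
    show "l1dist (ctr e) y \<in> {l1dist x y |x y. x \<in> e \<and> y \<in> f}" using ctr_in[OF e] that by blast
  qed
  ultimately show "R \<le> edge_radius (ctr e) f" unfolding le_edge_radius_iff[OF fl] by (meson order.trans)
qed

text \<open>Half of the decay \<open>exp (- real m)\<close> absorbs the square of
  \<open>2 * m + 6\<close>. The other half must beat \<open>576 * K\<^sup>2\<close> times the power
  \<open>3 + c\<close> of \<open>N\<close>: one factor \<open>N\<close> for the edge, two for the
  pair of times, and \<open>c\<close> for the claim. As \<open>3 + c \<le> 4 * c\<close> and
  \<open>c * ln N \<ge> 1\<close>, this explains \<open>A\<close>.\<close>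

lemma tail_estimate:
  fixes K N :: nat and c :: real
  assumes K: "1 \<le> K" and N: "3 \<le> N" and c: "1 \<le> c"
  defines "A \<equiv> 2 * (ln (576 * (real K)\<^sup>2) + 4)"
  defines "m \<equiv> nat \<lceil>A * (c * ln (real N))\<rceil>"
  shows "real N * exp (- real m) * (3 + (real ((2 * m + 4) * (K * N)) + 1)\<^sup>2) \<le> 1 / real N powr c"
    and "real ((2 * m + 5) * (2 * m + 3)) \<le> (2 * A + 7)\<^sup>2 * c\<^sup>2 * (ln (real N))\<^sup>2"
proof -
  define l where "l = ln (real N)"
  define x where "x = c * l"
  define a where "a = ln (576 * (real K)\<^sup>2)"
  have l1: "1 \<le> l"
  proof -
    have "exp 1 \<le> real N" using exp_le N by simp
    then show ?thesis unfolding l_def using N by (subst ln_ge_iff) auto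
  qed
  have x1: "1 \<le> x" unfolding x_def using c l1 mult_mono[of 1 c 1 l] by simp
  have k1: "1 \<le> (real K)\<^sup>2" using K by simp
  then have a0: "0 \<le> a" unfolding a_def by (intro ln_ge_zero) linarith
  have A: "A = 2 * (a + 4)" by (simp add: A_def a_def)
  have mge: "A * x \<le> real m" unfolding m_def x_def l_def by linarith
  have Ax0: "0 \<le> A * x" using A a0 x1 by simp
  have mle: "real m \<le> A * x + 1" using Ax0 unfolding m_def x_def l_def by linarith
  show "real ((2 * m + 5) * (2 * m + 3)) \<le> (2 * A + 7)\<^sup>2 * c\<^sup>2 * (ln (real N))\<^sup>2"
  proof -
    \<comment> \<open>The constant 7 is 5 plus twice the rounding error of \<open>m\<close>,
      absorbed into the product by \<open>x \<ge> 1\<close>.\<close>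
    have 1: "2 * real m + 5 \<le> (2 * A + 7) * x" using mle x1 by (simp add: algebra_simps)
    have 2: "2 * real m + 3 \<le> (2 * A + 7) * x" using 1 by simp
    have "(2 * real m + 5) * (2 * real m + 3) \<le> ((2 * A + 7) * x) * ((2 * A + 7) * x)"
      by (rule mult_mono[OF 1 2]) (use 1 in auto)
    then show ?thesis by (simp add: x_def l_def power2_eq_square mult_ac)
  qed
  have KN: "1 \<le> real (K * N)" using K N by (metis le_trans mult_le_mono nat_mult_1 numeral_le_one_iff of_nat_1 of_nat_mono one_le_numeral)
  have sq: "3 + (real ((2 * m + 4) * (K * N)) + 1)\<^sup>2 \<le> (2 * real m + 6)\<^sup>2 * (real (K * N))\<^sup>2"
  proof -
    have "real ((2 * m + 4) * (K * N)) + 1 \<le> (2 * real m + 5) * real (K * N)"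
      using KN by (simp add: algebra_simps)
    then have "(real ((2 * m + 4) * (K * N)) + 1)\<^sup>2 \<le> ((2 * real m + 5) * real (K * N))\<^sup>2"
      by (rule power_mono) simp
    moreover have "((2 * real m + 5) * real (K * N))\<^sup>2 = (2 * real m + 5)\<^sup>2 * (real (K * N))\<^sup>2"
      by (rule power_mult_distrib)
    moreover have "3 \<le> 3 * (real (K * N))\<^sup>2" using one_le_power[OF KN, of 2] by linarith
    ultimately have "3 + (real ((2 * m + 4) * (K * N)) + 1)\<^sup>2 \<le> ((2 * real m + 5)\<^sup>2 + 3) * (real (K * N))\<^sup>2"
      unfolding distrib_right by linarith
    also have "\<dots> \<le> (2 * real m + 6)\<^sup>2 * (real (K * N))\<^sup>2"
      by (rule mult_right_mono) (simp_all add: power2_eq_square algebra_simps)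
    finally show ?thesis .
  qed
  have ex: "(2 * real m + 6)\<^sup>2 \<le> 576 * exp (real m / 2)"
  proof -
    \<comment> \<open>The square of \<open>exp s\<close> is \<open>exp (m / 2)\<close> up to the
      factor \<open>exp (3 / 2) \<le> 9\<close>, and 576 is 64 times 9.\<close>
    define s where "s = (real m + 3) / 4"
    have "s \<le> exp s" using exp_ge_add_one_self[of s] by linarith
    then have "s\<^sup>2 \<le> (exp s)\<^sup>2" by (rule power_mono) (simp add: s_def)
    also have "(exp s)\<^sup>2 = exp (real m / 2 + 3 / 2)" by (simp add: s_def exp_double[symmetric] field_simps)
    also have "\<dots> = exp (real m / 2) * exp (3 / 2)" by (rule exp_add)
    also have "exp (3 / 2 :: real) \<le> 9"
    proof -
      have "exp (3 / 2 :: real) \<le> exp (1 + 1)" by simp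
      also have "\<dots> = exp 1 * exp 1" by (rule exp_add)
      also have "\<dots> \<le> 3 * 3" by (rule mult_mono[OF exp_le exp_le]) auto
      finally show ?thesis by simp
    qed
    finally have "s\<^sup>2 \<le> exp (real m / 2) * 9" by simp
    moreover have "(2 * real m + 6)\<^sup>2 = 64 * s\<^sup>2" by (simp add: s_def power2_eq_square field_simps)
    ultimately show ?thesis by simp
  qed
  have Npos: "0 < real N" using N by simp
  have "real N * exp (- real m) * (3 + (real ((2 * m + 4) * (K * N)) + 1)\<^sup>2)
      \<le> real N * exp (- real m) * ((576 * exp (real m / 2)) * (real (K * N))\<^sup>2)"
    by (rule mult_left_mono[OF order.trans[OF sq mult_right_mono[OF ex]]]) auto
  also have "\<dots> = (576 * (real K)\<^sup>2) * real N ^ 3 * (exp (- real m) * exp (real m / 2))"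
    by (simp add: power2_eq_square power3_eq_cube mult_ac)
  also have "exp (- real m) * exp (real m / 2) = exp (- (real m / 2))"
    by (simp add: exp_add[symmetric])
  also have "\<dots> \<le> exp (- (a + (3 + c) * l))"
  proof -
    have "a + (3 + c) * l \<le> a * x + 4 * x"
    proof (rule add_mono)
      show "a \<le> a * x" using a0 x1 by (simp add: mult_le_cancel_left1)
      have "(3 + c) * l \<le> (4 * c) * l" using c l1 by (intro mult_right_mono) auto
      then show "(3 + c) * l \<le> 4 * x" by (simp add: x_def)
    qed
    also have "\<dots> = A * x / 2" by (simp add: A algebra_simps)
    finally show ?thesis using mge by simp
  qed
  also have "exp (- (a + (3 + c) * l)) = inverse (576 * (real K)\<^sup>2) * real N powr (- (3 + c))"
  proof -
    have "exp (- (a + (3 + c) * l)) = exp (- a) * exp (- (3 + c) * l)" by (simp add: exp_add[symmetric] algebra_simps)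
    moreover have "exp (- a) = inverse (576 * (real K)\<^sup>2)" unfolding a_def using K by (simp add: exp_minus)
    moreover have "exp (- (3 + c) * l) = real N powr (- (3 + c))" using Npos by (simp add: powr_def l_def)
    ultimately show ?thesis by simp
  qed
  finally have "real N * exp (- real m) * (3 + (real ((2 * m + 4) * (K * N)) + 1)\<^sup>2)
      \<le> (576 * (real K)\<^sup>2) * real N ^ 3 * (inverse (576 * (real K)\<^sup>2) * real N powr (- (3 + c)))"
    by (simp add: mult_left_mono)
  also have "\<dots> = real N ^ 3 * real N powr (- (3 + c))" using K by simp
  also have "\<dots> = real N powr 3 * real N powr (- (3 + c))" using Npos by (simp add: powr_numeral)
  also have "\<dots> = real N powr (- c)" unfolding powr_add[symmetric] by simp
  also have "\<dots> = 1 / real N powr c" by (simp add: powr_minus_divide)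
  finally show "real N * exp (- real m) * (3 + (real ((2 * m + 4) * (K * N)) + 1)\<^sup>2) \<le> 1 / real N powr c" .
qed

theorem theorem1p3:
  fixes q :: real
  assumes "CARD('d::finite) \<ge> 2" and "q \<ge> 1"
  shows "\<exists>pt \<kappa>::real. pt < 1 \<and> \<kappa> > 0 \<and>
    (\<forall>p (c::real) (u::'d \<Rightarrow> 'd \<Rightarrow> real) (r::real) (k::'d) \<mu>.
      pt \<le> p \<longrightarrow> p < 1 \<longrightarrow> 1 \<le> c \<longrightarrow> orthonormal_frame u \<longrightarrow>
      real (card (box_E u r)) \<ge>
        max (3 ^ (6 * CARD('d))) ((c * real CARD('d)) powr (c * real CARD('d) ^ 2)) \<longrightarrow>
      stationary_dist (box_V u r) (box_E u r) (box_T u r k) (box_B u r k) p q \<mu> \<longrightarrow>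
      (\<Sum>s\<in>{s \<in> coupled_states (box_E u r) (box_T u r k) (box_B u r k).
             \<exists>e\<in>pivotal (box_E u r) (box_T u r k) (box_B u r k) (snd s)
                  \<union> interface (box_E u r) (fst s) (snd s).
               real (set_edge_dist e
                 ((lattice_edges - box_E u r)
                   \<union> pivotal (box_E u r) (box_T u r k) (box_B u r k) (snd s) - {e}))
               \<ge> \<kappa> * c\<^sup>2 * (ln (real (card (box_E u r))))\<^sup>2}. \<mu> s)
      \<le> 1 / real (card (box_E u r)) powr c)"
proof -
  define D :: real where "D = 25 ^ CARD('d)"
  \<comment> \<open>\<open>K\<close> is fixed before \<open>\<tau>\<close>, which depends on it; it
    makes \<open>exp (- K / 2)\<close> at most \<open>1 / (45 * D)\<close>. Each of the three
    summands in \<open>small\<close> gets this share, and \<open>5 * D\<close> times their sum is at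
    most 1/3, which is below \<open>exp (- 1)\<close>.\<close>
  define K where "K = nat \<lceil>2 * ln (45 * D)\<rceil>"
  define \<epsilon> where "\<epsilon> = 1 / (90 * D)"
  \<comment> \<open>The bound 1/2 serves \<open>1 - \<theta>2 \<ge> 1 / 2\<close>; the other two
    control closed edges at a fixed time and rare coins in a block.\<close>
  define \<tau> where "\<tau> = min (\<epsilon>\<^sup>2) (min (1 / (135 * real K * D)) (1 / 2))"
  \<comment> \<open>The solution \<open>p\<close> of \<open>q * (1 - p) / p = \<tau>\<close>, so
    that \<open>\<delta> \<le> \<tau>\<close> holds from this value on.\<close>
  define pt where "pt = q / (q + \<tau>)"
  define A where "A = 2 * (ln (576 * (real K)\<^sup>2) + 4)"
  have D1: "1 \<le> D" unfolding D_def by simp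
  have Kge: "2 * ln (45 * D) \<le> real K" unfolding K_def by linarith
  have "0 < ln (45 * D)" using D1 by (intro ln_gt_zero) linarith
  then have K1: "1 \<le> K" using Kge by linarith
  have \<epsilon>: "0 < \<epsilon>" "\<epsilon> \<le> 1" using D1 by (auto simp: \<epsilon>_def)
  have \<tau>: "0 < \<tau>" "\<tau> \<le> \<epsilon>\<^sup>2" "\<tau> \<le> 1 / (135 * real K * D)" "\<tau> \<le> 1 / 2"
    unfolding \<tau>_def using \<epsilon> K1 D1 by auto
  have pt: "0 < pt" "pt < 1" unfolding pt_def using \<tau>(1) assms(2) by auto
  have A0: "0 \<le> A"
  proof -
    have "1 \<le> (real K)\<^sup>2" using K1 by simp
    then have "0 \<le> ln (576 * (real K)\<^sup>2)" by (intro ln_ge_zero) linarith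
    then show ?thesis by (simp add: A_def)
  qed
  show ?thesis
  proof (rule exI[of _ pt], rule exI[of _ "(2 * A + 7)\<^sup>2"], intro conjI allI impI, goal_cases)
    case 1
    show ?case by (rule pt(2))
  next
    case 2
    show ?case using A0 by simp
  next
    case (3 p c u r k \<mu>)
    note pr = 3(1,2) and c = 3(3) and u = 3(4) and N = 3(5) and st = 3(6)
    define N where "N = card (box_E u r)"
    have "(3::real) ^ 1 \<le> 3 ^ (6 * CARD('d))" by (rule power_increasing) auto
    also have "\<dots> \<le> real N" unfolding N_def by (rule order.trans[OF max.cobounded1 N])
    finally have "3 \<le> real N" by (simp only: power_one_right)
    then have N3: "3 \<le> N" by simp
    interpret fk_box "box_V u r" "box_E u r" "box_T u r k" "box_B u r k" p q
    proof
      show "finite (box_V u r)" by (rule finite_box_V[OF u])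
      show "box_E u r = {e \<in> lattice_edges. e \<subseteq> box_V u r}" by (simp add: box_E_def)
      show "box_T u r k \<union> box_B u r k = vboundary (box_V u r)" by (auto simp: box_T_def box_B_def)
      show "box_T u r k \<inter> box_B u r k = {}" by (auto simp: box_T_def box_B_def)
      show "box_E u r \<noteq> {}" using N3 unfolding N_def by (metis card.empty not_numeral_le_zero)
    qed (use assms pr pt in auto)
    have d\<tau>: "\<delta> \<le> \<tau>"
    proof -
      have "q \<le> p * (q + \<tau>)" using pr(1) \<tau>(1) assms(2) by (simp add: pt_def pos_divide_le_eq)
      then have "q * (1 - p) \<le> \<tau> * p" by (simp add: algebra_simps)
      then show ?thesis unfolding \<delta>_def using p pt by (simp add: pos_divide_le_eq)
    qed
    have small: "5 * 25 ^ CARD('d) * (2 * \<epsilon> + 3 * real K * \<delta> + exp (- ((1 - \<theta>2) * real K))) \<le> exp (- 1)"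
    proof -
      have "2 * \<epsilon> = 1 / (45 * D)" by (simp add: \<epsilon>_def)
      moreover have "3 * real K * \<delta> \<le> 1 / (45 * D)"
      proof -
        have "3 * real K * \<delta> \<le> 3 * real K * (1 / (135 * real K * D))"
          using d\<tau> \<tau>(3) by (intro mult_left_mono) auto
        also have "\<dots> = 1 / (45 * D)" using K1 by simp
        finally show ?thesis .
      qed
      moreover have "exp (- ((1 - \<theta>2) * real K)) \<le> 1 / (45 * D)"
      proof -
        have "1 / 2 \<le> 1 - \<theta>2" using theta_bounds(5) d\<tau> \<tau>(4) by linarith
        then have "1 / 2 * real K \<le> (1 - \<theta>2) * real K" by (rule mult_right_mono) simp
        then have "- ((1 - \<theta>2) * real K) \<le> - ln (45 * D)" using Kge by linarith
        then have "exp (- ((1 - \<theta>2) * real K)) \<le> exp (- ln (45 * D))" by simp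
        also have "\<dots> = 1 / (45 * D)" using D1 by (simp add: exp_minus inverse_eq_divide)
        finally show ?thesis .
      qed
      ultimately have "2 * \<epsilon> + 3 * real K * \<delta> + exp (- ((1 - \<theta>2) * real K)) \<le> 3 * (1 / (45 * D))" by linarith
      then have "5 * D * (2 * \<epsilon> + 3 * real K * \<delta> + exp (- ((1 - \<theta>2) * real K))) \<le> 5 * D * (3 * (1 / (45 * D)))"
        using D1 by (intro mult_left_mono) auto
      also have "\<dots> = 1 / 3" using D1 by simp
      also have "1 / 3 \<le> exp (- 1 :: real)" using exp_le by (simp add: exp_minus field_simps)
      finally show ?thesis by (simp add: D_def)
    qed
    define m where "m = nat \<lceil>A * (c * ln (real N))\<rceil>"
    define R where "R = (2 * m + 5) * (2 * m + 3)"
    have tail: "real N * exp (- real m) * (3 + (real ((2 * m + 4) * (K * N)) + 1)\<^sup>2) \<le> 1 / real N powr c"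
      and Rle: "real R \<le> (2 * A + 7)\<^sup>2 * c\<^sup>2 * (ln (real N))\<^sup>2"
      using tail_estimate[OF K1 N3 c] unfolding m_def A_def R_def by auto
    have \<mu>: "0 \<le> \<mu> s" for s using st unfolding stationary_dist_def by blast
    have "(\<Sum>s\<in>{s\<in>CS. \<exists>e\<in>piv (snd s) \<union> intf (fst s) (snd s).
          real (set_edge_dist e (dead \<union> piv (snd s) - {e})) \<ge> (2 * A + 7)\<^sup>2 * c\<^sup>2 * (ln (real N))\<^sup>2}. \<mu> s)
        \<le> (\<Sum>s\<in>{s\<in>CS. \<exists>e\<in>piv (snd s) \<union> intf (fst s) (snd s). clear (ctr e) R (dead \<union> piv (snd s) - {e})}. \<mu> s)"
    proof (rule sum_event_mono[OF fin_CS \<mu>])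
      fix s assume "\<exists>e\<in>piv (snd s) \<union> intf (fst s) (snd s).
          real (set_edge_dist e (dead \<union> piv (snd s) - {e})) \<ge> (2 * A + 7)\<^sup>2 * c\<^sup>2 * (ln (real N))\<^sup>2"
      then obtain e where e: "e \<in> piv (snd s) \<union> intf (fst s) (snd s)"
        and d: "real (set_edge_dist e (dead \<union> piv (snd s) - {e})) \<ge> (2 * A + 7)\<^sup>2 * c\<^sup>2 * (ln (real N))\<^sup>2" by blast
      have "real R \<le> real (set_edge_dist e (dead \<union> piv (snd s) - {e}))" using d Rle by linarith
      then have "R \<le> set_edge_dist e (dead \<union> piv (snd s) - {e})" by (simp only: of_nat_le_iff)
      moreover have "e \<in> lattice_edges" using e E_lattice by (auto simp: pivotal_def interface_def)
      moreover have "dead \<union> piv (snd s) - {e} \<subseteq> lattice_edges" using E_lattice by (auto simp: pivotal_def)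
      ultimately have "clear (ctr e) R (dead \<union> piv (snd s) - {e})" by (intro clear_of_set_edge_dist)
      then show "\<exists>e\<in>piv (snd s) \<union> intf (fst s) (snd s). clear (ctr e) R (dead \<union> piv (snd s) - {e})"
        using e by blast
    qed
    also have "\<dots> \<le> real N * exp (- real m) * (3 + (real ((2 * m + 4) * (K * N)) + 1)\<^sup>2)"
      unfolding N_def
      by (rule far_edge_prob[OF st _ _ \<epsilon>(2) order.trans[OF d\<tau> \<tau>(2)] small]) (use K1 \<epsilon>(1) in \<open>auto simp: R_def\<close>)
    also have "\<dots> \<le> 1 / real N powr c" by (rule tail)
    finally show ?case unfolding N_def .
  qed
qed

end
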